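(* Assume $K=L=0$ and fix a two-parameter control band policy $\varphi=\{d,u\}$ with $d<u$. If there exist a constant $\gamma$ and a twice continuously differentiable function $V:[d,u]\to\mathbb R$ satisfying $$\Gamma V(x)+h(x)=\gamma,\qquad d\le x\le u,$$ with boundary conditions $V'(d)=-k$ and $V'(u)=\ell$, then the long-run average cost $\mathrm{AC}(x,\varphi)$ is independent of the initial inventory level $x\in\mathbb R$ and equals $\gamma$.
   Context: Parameters: $\mu\in\mathbb R$, $\sigma>0$, proportional costs $k>0$, $\ell>0$, zero fixed costs; $\lambda=2\mu/\sigma^2$. $W$ is a standard Brownian motion with respect to a filtration $\{\mathcal F_t\}$ and $X(t)=x+\mu t+\sigma W(t)$. $\Gamma V=\frac12\sigma^2V''+\mu V'$. A policy is a pair $(Y_1,Y_2)$ of adapted, nondecreasing, right-continuous processes with left limits, $Y_i(0-)=0$; the inventory process is $Z(t)=X(t)+Y_1(t)-Y_2(t)$, with $Z(0-)=x$. With zero fixed costs, $$\mathrm{AC}(x,\varphi)=\limsup_{t\to\infty}\frac1t\,\mathbb E_x\Big[\int_0^t h(Z(s))\,ds+kY_1(t)+\ell Y_2(t)\Big],$$ where $\mathbb E_x$ is expectation given $Z(0-)=x$. Two-sided regulator: for a right-continuous path $w$ on $[0,\infty)$ with left limits and $w(0)\in[d,u]$, there is a unique triple $(y_1,y_2,z)$ of such paths with $z(t)=w(t)+y_1(t)-y_2(t)$, $z(t)\in[d,u]$ for all $t\ge0$, $y_1(0)=y_2(0)=0$, $y_1,y_2$ nondecreasing, $\int_0^\infty(z(t)-d)\,dy_1(t)=0$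 and $\int_0^\infty(u-z(t))\,dy_2(t)=0$ (a known fact). Write $y_i=\Psi_i(w)$, $i=1,2$. Control band policy $\{d,u\}$: if $x\in[d,u]$, then $Y_1=\Psi_1(X)$ and $Y_2=\Psi_2(X)$. If $x\notin[d,u]$, the inventory jumps at time $0$ to the closest point of $[d,u]$ (so $Z(0)=d$ if $x<d$, $Z(0)=u$ if $x>u$, the jump being counted in $Y_1$ resp. $Y_2$), and thereafter the two-sided regulator is applied to the Brownian motion restarted from that point. Standing assumption on $h:\mathbb R\to[0,\infty)$: $h$ is continuous and convex; there is $a\in\mathbb R$ such that $h$ is $C^2$ on $\mathbb R\setminus\{a\}$ and $h(a)=0$; $h'(x)<0$ for $x<a$ and $h'(x)>0$ for $x>a$; if $\lambda>0$ then $\int_{-\infty}^a|h'(y)|e^{\lambda(y-a)}dy<\infty$; if $\lambda<0$ then $\int_a^\infty|h'(y)|e^{\lambda(y-a)}dy<\infty$. *)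

theory Defs
  imports "HOL-Probability.Probability"
begin

text \<open>
  Time is \<^typ>\<open>real\<close>; only times \<open>t \<ge> 0\<close> carry meaning. The library locale \<^locale>\<open>filtration\<close> is
  stated for the whole index type, which is harmless: a filtration on \<open>[0,\<infinity>)\<close> extends by \<open>F 0\<close>.
\<close>

type_synonym 'a process = "real \<Rightarrow> 'a \<Rightarrow> real"

definition standard_brownian_motion ::
    "'a measure \<Rightarrow> (real \<Rightarrow> 'a measure) \<Rightarrow> 'a process \<Rightarrow> bool" where
  "standard_brownian_motion M F W \<longleftrightarrow>
     (\<forall>t\<ge>0. W t \<in> borel_measurable (F t)) \<and>
     (AE \<omega> in M. W 0 \<omega> = 0 \<and> continuous_on {0..} (\<lambda>t. W t \<omega>)) \<and>
     (\<forall>s t. 0 \<le> s \<and> s < t \<longrightarrow>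
        distributed M lborel (\<lambda>\<omega>. W t \<omega> - W s \<omega>)
          (\<lambda>y. ennreal (normal_density 0 (sqrt (t - s)) y)) \<and>
        prob_space.indep_set M (sets (F s))
          {(\<lambda>\<omega>. W t \<omega> - W s \<omega>) -` B \<inter> space M | B. B \<in> sets borel})"

definition C2_on :: "real set \<Rightarrow> (real \<Rightarrow> real) \<Rightarrow> (real \<Rightarrow> real) \<Rightarrow> (real \<Rightarrow> real) \<Rightarrow> bool" where
  "C2_on S f f' f'' \<longleftrightarrow>
     (\<forall>x\<in>S. (f has_real_derivative f' x) (at x within S)) \<and>
     (\<forall>x\<in>S. (f' has_real_derivative f'' x) (at x within S)) \<and>
     continuous_on S f''"

definition holding_cost :: "real \<Rightarrow> (real \<Rightarrow> real) \<Rightarrow> bool" where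
  "holding_cost lam h \<longleftrightarrow>
     (\<forall>x. 0 \<le> h x) \<and> continuous_on UNIV h \<and> convex_on UNIV h \<and>
     (\<exists>a h' h''. C2_on (- {a}) h h' h'' \<and> h a = 0 \<and>
        (\<forall>x<a. h' x < 0) \<and> (\<forall>x>a. h' x > 0) \<and>
        (lam > 0 \<longrightarrow>
          (\<integral>\<^sup>+ y\<in>{..a}. ennreal (\<bar>h' y\<bar> * exp (lam * (y - a))) \<partial>lborel) < \<infinity>) \<and>
        (lam < 0 \<longrightarrow>
          (\<integral>\<^sup>+ y\<in>{a..}. ennreal (\<bar>h' y\<bar> * exp (lam * (y - a))) \<partial>lborel) < \<infinity>))"

definition rcll :: "(real \<Rightarrow> real) \<Rightarrow> bool" where
  "rcll f \<longleftrightarrow>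
     (\<forall>t\<ge>0. continuous (at_right t) f) \<and>
     (\<forall>t>0. \<exists>l. (f \<longlongrightarrow> l) (at_left t))"

text \<open>
  The Stieltjes measure of \<open>y\<close> on \<open>[0,\<infinity>)\<close> is the library's \<^const>\<open>interval_measure\<close> of \<open>y\<close> extended
  constantly to negative times; there is no atom at \<open>0\<close> because \<open>y 0 = 0\<close>. The two integrands are
  nonnegative, so the nonnegative integral is used: a vanishing Bochner integral could also mean
  non-integrability.
\<close>

definition two_sided_regulator ::
    "real \<Rightarrow> real \<Rightarrow> (real \<Rightarrow> real) \<Rightarrow> (real \<Rightarrow> real) \<Rightarrow> (real \<Rightarrow> real) \<Rightarrow> (real \<Rightarrow> real) \<Rightarrow> bool" where
  "two_sided_regulator d u w y1 y2 z \<longleftrightarrow>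
     rcll y1 \<and> rcll y2 \<and> rcll z \<and>
     (\<forall>t\<ge>0. z t = w t + y1 t - y2 t) \<and>
     (\<forall>t\<ge>0. z t \<in> {d..u}) \<and>
     y1 0 = 0 \<and> y2 0 = 0 \<and>
     mono_on {0..} y1 \<and> mono_on {0..} y2 \<and>
     (\<integral>\<^sup>+ t\<in>{0..}. ennreal (z t - d) \<partial>interval_measure (\<lambda>t. y1 (max 0 t))) = 0 \<and>
     (\<integral>\<^sup>+ t\<in>{0..}. ennreal (u - z t) \<partial>interval_measure (\<lambda>t. y2 (max 0 t))) = 0"

text \<open>
  The regulating triple is unique only on \<open>[0,\<infinity>)\<close>, so the definite description is taken of the
  value at time \<open>t\<close> rather than of the whole function.
\<close>

definition Psi1 :: "real \<Rightarrow> real \<Rightarrow> (real \<Rightarrow> real) \<Rightarrow> real \<Rightarrow> real" where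
  "Psi1 d u w t = (THE r. \<exists>y1 y2 z. two_sided_regulator d u w y1 y2 z \<and> r = y1 t)"

definition Psi2 :: "real \<Rightarrow> real \<Rightarrow> (real \<Rightarrow> real) \<Rightarrow> real \<Rightarrow> real" where
  "Psi2 d u w t = (THE r. \<exists>y1 y2 z. two_sided_regulator d u w y1 y2 z \<and> r = y2 t)"

definition uncontrolled :: "real \<Rightarrow> real \<Rightarrow> 'a process \<Rightarrow> real \<Rightarrow> 'a process" where
  "uncontrolled \<mu> \<sigma> W x t \<omega> = x + \<mu> * t + \<sigma> * W t \<omega>"

text \<open>
  A policy assigns to each initial level \<open>x\<close> the pair \<open>(Y\<^sub>1, Y\<^sub>2)\<close>. Since \<open>Y\<^sub>i(0-) = 0\<close>, the value at
  time \<open>0\<close> is the initial jump. For \<open>x \<in> [d,u]\<close> the closest point is \<open>x\<close> and both jumps vanish.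
\<close>

definition control_band ::
    "real \<Rightarrow> real \<Rightarrow> 'a process \<Rightarrow> real \<Rightarrow> real \<Rightarrow> real \<Rightarrow> 'a process \<times> 'a process" where
  "control_band \<mu> \<sigma> W d u x =
     (let p = closest_point {d..u} x in
       ((\<lambda>t \<omega>. max 0 (p - x) + Psi1 d u (\<lambda>s. uncontrolled \<mu> \<sigma> W p s \<omega>) t),
        (\<lambda>t \<omega>. max 0 (x - p) + Psi2 d u (\<lambda>s. uncontrolled \<mu> \<sigma> W p s \<omega>) t)))"

definition inventory ::
    "real \<Rightarrow> real \<Rightarrow> 'a process \<Rightarrow> real \<Rightarrow> 'a process \<times> 'a process \<Rightarrow> 'a process" where
  "inventory \<mu> \<sigma> W x Y t \<omega> = uncontrolled \<mu> \<sigma> W x t \<omega> + fst Y t \<omega> - snd Y t \<omega>"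

text \<open>
  All cost terms are nonnegative, so the expected cost is taken in \<open>[0,\<infinity>]\<close>; the result lives in
  \<^typ>\<open>ereal\<close> so that comparing it with a real number does not truncate negative values.
\<close>

definition AC ::
    "'a measure \<Rightarrow> real \<Rightarrow> real \<Rightarrow> 'a process \<Rightarrow> (real \<Rightarrow> real) \<Rightarrow> real \<Rightarrow> real \<Rightarrow>
     real \<Rightarrow> (real \<Rightarrow> 'a process \<times> 'a process) \<Rightarrow> ereal" where
  "AC M \<mu> \<sigma> W h k l x \<phi> =
     Limsup at_top (\<lambda>t. ereal (1 / t) * enn2ereal
       (\<integral>\<^sup>+ \<omega>. (\<integral>\<^sup>+ s\<in>{0..t}. ennreal (h (inventory \<mu> \<sigma> W x (\<phi> x) s \<omega>)) \<partial>lborel)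
               + ennreal (k * fst (\<phi> x) t \<omega> + l * snd (\<phi> x) t \<omega>) \<partial>M))"

end

theory Submission
  imports Defs
begin

text \<open>
  Let \<open>Z\<close> be the inventory under the band policy and \<open>Y\<^sub>1\<close>, \<open>Y\<^sub>2\<close> the pushes at the lower and the upper
  barrier. Ito's formula says that \<open>V (Z t) - V (Z 0) + k * Y\<^sub>1 t + l * Y\<^sub>2 t\<close> plus the holding cost up
  to \<open>t\<close> equals \<open>\<gamma> * t\<close> plus a martingale: the differential equation produces \<open>\<gamma>\<close>, and the boundary
  conditions \<open>V' d = - k\<close> and \<open>V' u = l\<close> absorb the two pushes, which act only at the barriers.
  Taking expectations, the expected cost up to \<open>t\<close> is \<open>\<gamma> * t + V (Z 0)\<close> minus the mean of \<open>V (Z t)\<close>, plus the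
  cost of the initial jump. As \<open>V\<close> is bounded on the band, dividing by \<open>t\<close> leaves \<open>\<gamma>\<close> in the limit,
  whatever the initial level.

  No stochastic integral is used. On the dyadic grid of mesh \<open>2 ^ (-n)\<close> the regulated path is replaced by
  a walk that adds the increments of the free path and is clipped to the band after each step; the
  overshoots are its pushes. For this walk Ito's formula becomes a Taylor expansion in each step, and
  independence of the increments turns it into an identity in expectation up to an error that vanishes
  with the mesh (\<open>reflected_step_taylor\<close>, \<open>expected_step\<close>, \<open>expected_cost\<close>).

  Two bridges lead back to continuous time. Pathwise, the walk depends on its input in a Lipschitz way
  for the supremum norm (\<open>band_walk_lipschitz\<close>). Hence for a continuous path the walks on finer and finer
  grids converge locally uniformly, and so do the pushes, because near any time one of the two barriers
  is out of reach. The limits solve the two-sided regulator problem (\<open>regulator_exists\<close>), whose solution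
  is unique (\<open>regulator_unique\<close>), so they are the processes of the policy. In the mean, convergence of
  the costs along almost every path has to be upgraded to convergence of expectations. The pushes are
  not dominated by an integrable variable in an obvious way, so their second moments are bounded
  uniformly in the mesh through a quadratic Lyapunov function (\<open>Q_second_moment\<close>), and boundedness in
  mean square suffices (\<open>L2_bounded_limit\<close>).
\<close>

section \<open>Elementary estimates\<close>

lemma square_sum_le: "(a + b)\<^sup>2 \<le> 2 * a\<^sup>2 + 2 * (b :: real)\<^sup>2"
  using zero_le_power2[of "a - b"] by (simp add: power2_eq_square algebra_simps)

lemma fourth_power_sum_le: "(a + b) ^ 4 \<le> 8 * a ^ 4 + 8 * (b :: real) ^ 4"
proof -
  have "((a + b)\<^sup>2)\<^sup>2 \<le> (2 * a\<^sup>2 + 2 * b\<^sup>2)\<^sup>2"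
    using square_sum_le[of a b] by (intro power_mono) auto
  also have "\<dots> \<le> 2 * (2 * a\<^sup>2)\<^sup>2 + 2 * (2 * b\<^sup>2)\<^sup>2" by (rule square_sum_le)
  finally show ?thesis by (simp flip: power_mult)
qed

lemma le_square_plus_one: "y \<le> y\<^sup>2 + (1 :: real)"
proof -
  have "0 \<le> (y - 1 / 2)\<^sup>2" by simp
  then show ?thesis by (simp add: power2_eq_square field_simps)
qed

lemma continuous_on_Icc_bounded:
  fixes f :: "real \<Rightarrow> real"
  assumes "continuous_on {a..b} f"
  obtains B where "0 < B" "\<And>z. z \<in> {a..b} \<Longrightarrow> \<bar>f z\<bar> \<le> B"
proof -
  have "bounded (f ` {a..b})"
    using assms by (intro compact_imp_bounded compact_continuous_image) auto
  then show thesis using that unfolding bounded_pos by auto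
qed

lemma half_power_less:
  assumes "(r::real) > 0" obtains N where "\<And>n. n \<ge> N \<Longrightarrow> 1 / 2 ^ n < r"
proof -
  obtain N where N: "(1/2::real) ^ N < r" using assms real_arch_pow_inv[of r "1/2"] by auto
  have "1 / 2 ^ n < r" if "n \<ge> N" for n
  proof -
    have "(1/2::real) ^ n \<le> (1/2) ^ N" using that by (intro power_decreasing) auto
    then show ?thesis using N by (simp add: power_divide)
  qed
  then show thesis using that by blast
qed

lemma eventually_near:
  assumes "\<rho> > 0" "\<And>s. 0 \<le> s \<Longrightarrow> \<bar>s - t\<bar> < \<rho> \<Longrightarrow> P s"
  shows "\<forall>\<^sub>F s in at t within {0..}. P (s::real)"
  using assms unfolding eventually_at dist_real_def by auto

section \<open>The walk reflected in a band\<close>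

primrec band_walk :: "real \<Rightarrow> real \<Rightarrow> real \<Rightarrow> (nat \<Rightarrow> real) \<Rightarrow> nat \<Rightarrow> real" where
  "band_walk d u x \<xi> 0 = x"
| "band_walk d u x \<xi> (Suc n) = max d (min u (band_walk d u x \<xi> n + \<xi> n))"

definition lower_push :: "real \<Rightarrow> real \<Rightarrow> real \<Rightarrow> (nat \<Rightarrow> real) \<Rightarrow> nat \<Rightarrow> real" where
  "lower_push d u x \<xi> n = (\<Sum>i<n. max 0 (d - (band_walk d u x \<xi> i + \<xi> i)))"

definition upper_push :: "real \<Rightarrow> real \<Rightarrow> real \<Rightarrow> (nat \<Rightarrow> real) \<Rightarrow> nat \<Rightarrow> real" where
  "upper_push d u x \<xi> n = (\<Sum>i<n. max 0 (band_walk d u x \<xi> i + \<xi> i - u))"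

lemma band_walk_mem:
  assumes "d \<le> u" "x \<in> {d..u}"
  shows "band_walk d u x \<xi> n \<in> {d..u}"
  using assms by (induction n) auto

lemma band_walk_eq_pushes:
  assumes "d \<le> u"
  shows "band_walk d u x \<xi> n = x + (\<Sum>i<n. \<xi> i) + lower_push d u x \<xi> n - upper_push d u x \<xi> n"
  using assms by (induction n) (auto simp: lower_push_def upper_push_def max_def min_def)

lemma lower_push_mono: "m \<le> n \<Longrightarrow> lower_push d u x \<xi> m \<le> lower_push d u x \<xi> n"
  unfolding lower_push_def by (rule sum_mono2) auto

lemma upper_push_mono: "m \<le> n \<Longrightarrow> upper_push d u x \<xi> m \<le> upper_push d u x \<xi> n"
  unfolding upper_push_def by (rule sum_mono2) auto

text \<open>
  A step that pushes at the lower barrier ends exactly at \<open>d\<close>, so no push occurs while the walk ends its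
  steps above \<open>d\<close>.
\<close>
lemma lower_push_const:
  assumes "d \<le> u" "m \<le> n" "\<And>j. m < j \<Longrightarrow> j \<le> n \<Longrightarrow> d < band_walk d u x \<xi> j"
  shows "lower_push d u x \<xi> n = lower_push d u x \<xi> m"
  using assms(2,3)
proof (induction n rule: dec_induct)
  case (step n)
  have "d < band_walk d u x \<xi> (Suc n)"
    by (rule step.prems) (use step.hyps in auto)
  then have "lower_push d u x \<xi> (Suc n) = lower_push d u x \<xi> n"
    using assms(1) by (auto simp: lower_push_def max_def min_def split: if_splits)
  then show ?case using step by simp
qed simp

lemma upper_push_const:
  assumes "d \<le> u" "m \<le> n" "\<And>j. m < j \<Longrightarrow> j \<le> n \<Longrightarrow> band_walk d u x \<xi> j < u"
  shows "upper_push d u x \<xi> n = upper_push d u x \<xi> m"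
  using assms(2,3)
proof (induction n rule: dec_induct)
  case (step n)
  have "band_walk d u x \<xi> (Suc n) < u"
    by (rule step.prems) (use step.hyps in auto)
  then have "upper_push d u x \<xi> (Suc n) = upper_push d u x \<xi> n"
    using assms(1) by (auto simp: upper_push_def max_def min_def split: if_splits)
  then show ?case using step by simp
qed simp

text \<open>
  Clipping is monotone and nonexpansive: the difference of the two clipped values lies between \<open>0\<close> and
  the difference before clipping. Both are at most \<open>a n - b n + e\<close>, the former because
  \<open>\<bar>a n - b n\<bar> \<le> e\<close>. A symmetric bound would not survive the induction step.
\<close>
lemma band_walk_lipschitz_aux:
  assumes "d \<le> u" "\<And>i. i \<le> n \<Longrightarrow> \<bar>a i - b i\<bar> \<le> e"
  shows "band_walk d u (a 0) (\<lambda>i. a (Suc i) - a i) n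
      - band_walk d u (b 0) (\<lambda>i. b (Suc i) - b i) n \<le> a n - b n + e"
  using assms(2)
proof (induction n)
  case 0
  then show ?case by fastforce
next
  case (Suc n)
  have "\<bar>a (Suc n) - b (Suc n)\<bar> \<le> e" using Suc by blast
  moreover have "band_walk d u (a 0) (\<lambda>i. a (Suc i) - a i) n
      - band_walk d u (b 0) (\<lambda>i. b (Suc i) - b i) n \<le> a n - b n + e"
    using Suc by simp
  ultimately show ?case
    using assms(1) by (auto simp: max_def min_def)
qed

lemma band_walk_lipschitz:
  assumes "d \<le> u" "\<And>i. i \<le> n \<Longrightarrow> \<bar>a i - b i\<bar> \<le> e"
  shows "\<bar>band_walk d u (a 0) (\<lambda>i. a (Suc i) - a i) n
      - band_walk d u (b 0) (\<lambda>i. b (Suc i) - b i) n\<bar> \<le> 2 * e"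
proof -
  have "\<bar>a n - b n\<bar> \<le> e" using assms(2) by blast
  moreover have "\<And>i. i \<le> n \<Longrightarrow> \<bar>b i - a i\<bar> \<le> e"
    using assms(2) by (metis abs_minus_commute)
  ultimately show ?thesis
    using band_walk_lipschitz_aux[of d u n a b e] band_walk_lipschitz_aux[of d u n b a e] assms
    by (smt (verit))
qed

lemma band_walk_add:
  "band_walk d u x \<xi> (i + j) = band_walk d u (band_walk d u x \<xi> i) (\<lambda>k. \<xi> (i + k)) j"
  by (induction j) auto

text \<open>
  From time \<open>i\<close> on, compare with the walk that starts at the same place and receives no input.
\<close>
lemma band_walk_oscillation:
  assumes "d \<le> u" "x \<in> {d..u}"
    and "\<And>k. k \<le> j \<Longrightarrow> \<bar>a (i + k) - a i\<bar> \<le> e"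
  shows "\<bar>band_walk d u x (\<lambda>i. a (Suc i) - a i) (i + j) - band_walk d u x (\<lambda>i. a (Suc i) - a i) i\<bar> \<le> 2 * e"
proof -
  define y where "y = band_walk d u x (\<lambda>i. a (Suc i) - a i) i"
  have y: "y \<in> {d..u}" unfolding y_def using assms band_walk_mem by blast
  have const: "band_walk d u y (\<lambda>_. 0) m = y" for m
    using y by (induction m) auto
  have "\<bar>band_walk d u y (\<lambda>k. a (i + Suc k) - a (i + k)) j - band_walk d u y (\<lambda>_. 0) j\<bar> \<le> 2 * e"
    using band_walk_lipschitz[of d u j "\<lambda>k. a (i + k) - a i + y" "\<lambda>_. y" e] assms by simp
  then show ?thesis
    unfolding band_walk_add const by (simp add: y_def)
qed

text \<open>
  Seen on a grid that is \<open>q\<close> times finer, the walk on the coarse grid is the walk whose input is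
  constant between coarse grid points. Walks on two grids thus become walks on the same grid, and
  \<open>band_walk_lipschitz\<close> compares them.
\<close>
lemma band_walk_subsample:
  assumes "d \<le> u" "a 0 \<in> {d..u}" "q > 0"
  shows "band_walk d u (a 0) (\<lambda>i. a (Suc i div q) - a (i div q)) j
       = band_walk d u (a 0) (\<lambda>i. a (Suc i) - a i) (j div q)"
proof (induction j)
  case (Suc j)
  show ?case
  proof (cases "Suc j div q = j div q")
    case True
    have "band_walk d u (a 0) (\<lambda>i. a (Suc i) - a i) (j div q) \<in> {d..u}"
      using assms band_walk_mem by blast
    then show ?thesis using Suc True by auto
  next
    case False
    then have "Suc j div q = Suc (j div q)"
      using assms(3) by (simp add: div_Suc split: if_splits)
    then show ?thesis using Suc by simp
  qed
qed simp

section \<open>Dyadic sampling of a continuous path\<close>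

definition grid_step :: "(real \<Rightarrow> real) \<Rightarrow> nat \<Rightarrow> nat \<Rightarrow> real" where
  "grid_step w n i = w (real (Suc i) / 2 ^ n) - w (real i / 2 ^ n)"

definition grid_index :: "nat \<Rightarrow> real \<Rightarrow> nat" where
  "grid_index n s = nat \<lfloor>s * 2 ^ n\<rfloor>"

lemma grid_index_le: "0 \<le> s \<Longrightarrow> real (grid_index n s) / 2 ^ n \<le> s"
  unfolding grid_index_def by (simp add: divide_le_eq)

lemma grid_index_ge: "s - 1 / 2 ^ n < real (grid_index n s) / 2 ^ n"
proof -
  have "s * 2 ^ n - 1 < real (grid_index n s)"
    unfolding grid_index_def by linarith
  then have "(s * 2 ^ n - 1) / 2 ^ n < real (grid_index n s) / 2 ^ n"
    by (intro divide_strict_right_mono) auto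
  then show ?thesis by (simp add: diff_divide_distrib)
qed

lemma grid_index_mono: "s \<le> s' \<Longrightarrow> grid_index n s \<le> grid_index n s'"
  unfolding grid_index_def by (intro nat_mono floor_mono) simp

lemma grid_index_0 [simp]: "grid_index n 0 = 0"
  by (simp add: grid_index_def)

lemma grid_index_grid [simp]: "grid_index n (real j / 2 ^ n) = j"
  by (simp add: grid_index_def)

lemma grid_index_coarsen:
  assumes "n \<le> m" "0 \<le> s"
  shows "grid_index n s = grid_index m s div 2 ^ (m - n)"
proof -
  have "(2::real) ^ m = 2 ^ n * 2 ^ (m - n)"
    using assms by (simp flip: power_add)
  then have "s * 2 ^ n = (s * 2 ^ m) / real_of_int (2 ^ (m - n))" by simp
  then have "\<lfloor>s * 2 ^ n\<rfloor> = \<lfloor>s * 2 ^ m\<rfloor> div 2 ^ (m - n)"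
    by (metis floor_divide_real_eq_div zero_le_numeral zero_le_power)
  then show ?thesis
    unfolding grid_index_def using assms by (simp add: nat_div_distrib nat_power_eq)
qed

lemma grid_index_lt: "j > grid_index n s \<Longrightarrow> s < real j / 2 ^ n"
proof -
  assume "j > grid_index n s"
  then have "s * 2 ^ n < real j" unfolding grid_index_def by linarith
  then show ?thesis by (simp add: field_simps)
qed

lemma grid_index_le2: "j \<le> grid_index n s \<Longrightarrow> 0 \<le> s \<Longrightarrow> real j / 2 ^ n \<le> s"
  by (rule order_trans[OF _ grid_index_le[of s n]]) (simp_all add: divide_right_mono)

locale band_path =
  fixes d u :: real and w :: "real \<Rightarrow> real"
  assumes band: "d < u" and cont: "continuous_on {0..} w" and start: "w 0 \<in> {d..u}"
begin

text \<open>
  The walk on the grid of mesh \<open>2 ^ (-n)\<close> and its two pushes, read as step functions of real time.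
\<close>
definition level :: "nat \<Rightarrow> real \<Rightarrow> real" where
  "level n s = band_walk d u (w 0) (grid_step w n) (grid_index n s)"

definition low :: "nat \<Rightarrow> real \<Rightarrow> real" where
  "low n s = lower_push d u (w 0) (grid_step w n) (grid_index n s)"

definition upp :: "nat \<Rightarrow> real \<Rightarrow> real" where
  "upp n s = upper_push d u (w 0) (grid_step w n) (grid_index n s)"

lemma level_mem: "level n s \<in> {d..u}"
  unfolding level_def using band start by (intro band_walk_mem) auto

lemma level_eq: "level n s = w (real (grid_index n s) / 2 ^ n) + low n s - upp n s"
proof -
  have "(\<Sum>i<N. grid_step w n i) = w (real N / 2 ^ n) - w 0" for N
    unfolding grid_step_def using sum_lessThan_telescope[of "\<lambda>i. w (real i / 2 ^ n)" N] by simp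
  then show ?thesis
    unfolding level_def low_def upp_def using band by (subst band_walk_eq_pushes) auto
qed

lemma modulus:
  assumes "e > 0"
  obtains r where "r > 0" "\<And>s s'. s \<in> {0..T} \<Longrightarrow> s' \<in> {0..T} \<Longrightarrow> \<bar>s - s'\<bar> < r \<Longrightarrow> \<bar>w s - w s'\<bar> \<le> e"
proof -
  have "uniformly_continuous_on {0..T} w"
    by (intro compact_uniformly_continuous continuous_on_subset[OF cont]) auto
  then obtain r where "r > 0" "\<And>s s'. s \<in> {0..T} \<Longrightarrow> s' \<in> {0..T} \<Longrightarrow> dist s' s < r \<Longrightarrow> dist (w s') (w s) < e"
    unfolding uniformly_continuous_on_def using assms by metis
  then show thesis
    using that[of r] by (metis abs_minus_commute dist_real_def less_imp_le)
qed

lemma level_oscillation: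
  assumes r: "\<And>s s'. s \<in> {0..T} \<Longrightarrow> s' \<in> {0..T} \<Longrightarrow> \<bar>s - s'\<bar> < r \<Longrightarrow> \<bar>w s - w s'\<bar> \<le> e"
    and s: "0 \<le> s" "s \<le> s'" "s' \<le> T" "s' - s + 1 / 2 ^ n < r"
  shows "\<bar>level n s' - level n s\<bar> \<le> 2 * e"
proof -
  define i where "i = grid_index n s"
  obtain j where j: "grid_index n s' = i + j"
    using grid_index_mono[OF s(2), of n] unfolding i_def by (metis nat_le_iff_add)
  have "\<bar>w (real (i + k) / 2 ^ n) - w (real i / 2 ^ n)\<bar> \<le> e" if "k \<le> j" for k
  proof (rule r)
    have 1: "real (i + k) / 2 ^ n \<le> s'"
      using that j s by (intro grid_index_le2) auto
    have 2: "s - 1 / 2 ^ n < real i / 2 ^ n" unfolding i_def by (rule grid_index_ge)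
    have 3: "real i / 2 ^ n \<le> real (i + k) / 2 ^ n" by (simp add: divide_right_mono)
    show "\<bar>real (i + k) / 2 ^ n - real i / 2 ^ n\<bar> < r"
      using 1 2 3 s by linarith
    show "real (i + k) / 2 ^ n \<in> {0..T}" "real i / 2 ^ n \<in> {0..T}"
      using 1 3 s by auto
  qed
  then show ?thesis
    unfolding level_def j i_def[symmetric] grid_step_def
    using band start by (intro band_walk_oscillation) auto
qed

text \<open>
  Freezing the input path between coarse grid points changes it by at most its modulus of continuity.
\<close>
lemma level_refine:
  assumes r: "\<And>s s'. s \<in> {0..T} \<Longrightarrow> s' \<in> {0..T} \<Longrightarrow> \<bar>s - s'\<bar> < r \<Longrightarrow> \<bar>w s - w s'\<bar> \<le> e"
    and s: "0 \<le> s" "s \<le> T" "1 / 2 ^ n < r" "n \<le> m"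
  shows "\<bar>level m s - level n s\<bar> \<le> 2 * e"
proof -
  define q :: nat where "q = 2 ^ (m - n)"
  define a where "a = (\<lambda>j. w (real j / 2 ^ m))"
  define b where "b = (\<lambda>j. w (real (j div q) / 2 ^ n))"
  have q: "q > 0" by (simp add: q_def)
  have pow: "(2::real) ^ m = 2 ^ n * real q"
    using s(4) by (simp add: q_def flip: power_add)
  have "level m s = band_walk d u (a 0) (\<lambda>i. a (Suc i) - a i) (grid_index m s)"
    unfolding level_def grid_step_def a_def by simp
  moreover have "level n s = band_walk d u (b 0) (\<lambda>i. b (Suc i) - b i) (grid_index m s)"
    using band_walk_subsample[of d u "\<lambda>j. w (real j / 2 ^ n)" q "grid_index m s"] band start q
    unfolding level_def grid_step_def b_def q_def grid_index_coarsen[OF s(4,1)] by simp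
  moreover have "\<bar>a i - b i\<bar> \<le> e" if i: "i \<le> grid_index m s" for i
    unfolding a_def b_def
  proof (rule r)
    have "i div q * q \<le> i" by simp
    then have "real (i div q) * real q \<le> real i"
      by (simp flip: of_nat_mult)
    then have 1: "real (i div q) / 2 ^ n \<le> real i / 2 ^ m"
      unfolding pow using q by (simp add: field_simps)
    have "i < Suc (i div q) * q"
      using q by (simp add: dividend_less_div_times)
    then have "real i < (real (i div q) + 1) * real q"
      by (metis of_nat_Suc of_nat_less_iff of_nat_mult add.commute)
    then have 2: "real i / 2 ^ m < real (i div q) / 2 ^ n + 1 / 2 ^ n"
      unfolding pow using q by (simp add: field_simps)
    have 3: "real i / 2 ^ m \<le> s" using i s by (intro grid_index_le2) auto
    show "\<bar>real i / 2 ^ m - real (i div q) / 2 ^ n\<bar> < r"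
      using 1 2 s by linarith
    show "real i / 2 ^ m \<in> {0..T}" "real (i div q) / 2 ^ n \<in> {0..T}"
      using 1 3 s by auto
  qed
  ultimately show ?thesis
    using band_walk_lipschitz[of d u "grid_index m s" a b e] band by simp
qed

definition limit_level :: "real \<Rightarrow> real" where
  "limit_level s = lim (\<lambda>n. level n s)"

lemma level_tendsto:
  assumes "0 \<le> s" shows "(\<lambda>n. level n s) \<longlonglongrightarrow> limit_level s"
proof -
  have "Cauchy (\<lambda>n. level n s)"
  proof (rule metric_CauchyI)
    fix e :: real assume e: "e > 0"
    obtain r where r: "r > 0" "\<And>x x'. x \<in> {0..s} \<Longrightarrow> x' \<in> {0..s} \<Longrightarrow> \<bar>x - x'\<bar> < r \<Longrightarrow> \<bar>w x - w x'\<bar> \<le> e / 8"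
      using modulus[of "e/8" s] e by auto
    obtain N where N: "\<And>n. n \<ge> N \<Longrightarrow> 1 / 2 ^ n < r" using half_power_less r(1) by blast
    have "\<bar>level m s - level N s\<bar> \<le> 2 * (e / 8)" if "m \<ge> N" for m
      by (rule level_refine[OF r(2)]) (use N assms that in auto)
    then have "\<forall>m\<ge>N. \<forall>n\<ge>N. dist (level m s) (level n s) < e"
      using e by (auto simp: dist_real_def) (smt (verit) field_sum_of_halves)
    then show "\<exists>N. \<forall>m\<ge>N. \<forall>n\<ge>N. dist (level m s) (level n s) < e" by blast
  qed
  then show ?thesis
    unfolding limit_level_def by (simp add: Cauchy_convergent_iff convergent_LIMSEQ_iff)
qed

lemma limit_level_mem: "0 \<le> s \<Longrightarrow> limit_level s \<in> {d..u}"
  using LIMSEQ_le_const[OF level_tendsto, of s d] LIMSEQ_le_const2[OF level_tendsto, of s u] level_mem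
  by auto

text \<open>
  The step functions have jumps, so continuity of their limit is not inherited from them; it comes from
  this estimate, which is uniform in time and in the grid at once.
\<close>
lemma level_near:
  assumes "0 \<le> t" "e > 0"
  obtains \<rho> N where "\<rho> > 0"
    "\<And>n s. n \<ge> N \<Longrightarrow> 0 \<le> s \<Longrightarrow> \<bar>s - t\<bar> < \<rho> \<Longrightarrow> \<bar>level n s - limit_level t\<bar> < e"
proof -
  obtain r where r: "r > 0" "\<And>x x'. x \<in> {0..t+1} \<Longrightarrow> x' \<in> {0..t+1} \<Longrightarrow> \<bar>x - x'\<bar> < r \<Longrightarrow> \<bar>w x - w x'\<bar> \<le> e / 8"
    using modulus[of "e/8" "t+1"] assms by auto
  obtain N1 where N1: "\<And>n. n \<ge> N1 \<Longrightarrow> 1 / 2 ^ n < r/2" using half_power_less[of "r/2"] r(1) by auto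
  obtain N2 where N2: "\<And>n. n \<ge> N2 \<Longrightarrow> \<bar>level n t - limit_level t\<bar> < e / 2"
    using LIMSEQ_D[OF level_tendsto[OF assms(1)], of "e/2"] assms by auto
  have "\<bar>level n s - limit_level t\<bar> < e"
    if n: "n \<ge> max N1 N2" and s: "0 \<le> s" "\<bar>s - t\<bar> < min 1 (r/2)" for n s
  proof -
    have "\<bar>level n s - level n t\<bar> \<le> 2 * (e / 8)"
    proof (cases "s \<le> t")
      case True
      have "\<bar>level n t - level n s\<bar> \<le> 2 * (e / 8)"
        by (rule level_oscillation[OF r(2)]) (use N1[of n] n s True in auto)
      then show ?thesis by linarith
    next
      case False
      show ?thesis
        by (rule level_oscillation[OF r(2)]) (use N1[of n] n s False assms in auto)
    qed
    moreover have "\<bar>level n t - limit_level t\<bar> < e / 2" using N2 n by simp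
    ultimately show ?thesis using assms(2) by linarith
  qed
  then show thesis using that[of "min 1 (r/2)" "max N1 N2"] r(1) by auto
qed

lemma limit_level_continuous: "continuous_on {0..} limit_level"
  unfolding continuous_on_iff
proof (intro ballI allI impI)
  fix t e :: real assume t: "t \<in> {0..}" and e: "0 < e"
  obtain \<rho> N where \<rho>: "\<rho> > 0"
    "\<And>n s. n \<ge> N \<Longrightarrow> 0 \<le> s \<Longrightarrow> \<bar>s - t\<bar> < \<rho> \<Longrightarrow> \<bar>level n s - limit_level t\<bar> < e/2"
    using level_near[of t "e/2"] t e by auto
  have "dist (limit_level s) (limit_level t) < e" if s: "s \<in> {0..}" "dist s t < \<rho>" for s
  proof -
    have "(\<lambda>n. \<bar>level n s - limit_level t\<bar>) \<longlonglongrightarrow> \<bar>limit_level s - limit_level t\<bar>"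
      using s by (intro tendsto_intros level_tendsto) auto
    moreover have "\<exists>N. \<forall>n\<ge>N. \<bar>level n s - limit_level t\<bar> \<le> e / 2"
      using \<rho>(2) s unfolding dist_real_def by (metis atLeast_iff less_imp_le)
    ultimately have "\<bar>limit_level s - limit_level t\<bar> \<le> e / 2"
      by (rule LIMSEQ_le_const2)
    then show ?thesis using e by (simp add: dist_real_def)
  qed
  then show "\<exists>\<rho>>0. \<forall>s\<in>{0..}. dist s t < \<rho> \<longrightarrow> dist (limit_level s) (limit_level t) < e"
    using \<rho>(1) by blast
qed

text \<open>
  Near a time at which the limit lies above \<open>d\<close>, all fine walks stay above \<open>d\<close>.
\<close>
lemma low_locally_const:
  assumes "0 \<le> t" "d < limit_level t"
  obtains \<rho> N where "\<rho> > 0" "\<And>n s. n \<ge> N \<Longrightarrow> 0 \<le> s \<Longrightarrow> \<bar>s - t\<bar> < \<rho> \<Longrightarrow> low n s = low n t"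
proof -
  obtain \<rho> N where \<rho>: "\<rho> > 0"
    "\<And>n s. n \<ge> N \<Longrightarrow> 0 \<le> s \<Longrightarrow> \<bar>s - t\<bar> < \<rho> \<Longrightarrow> \<bar>level n s - limit_level t\<bar> < limit_level t - d"
    using level_near[of t "limit_level t - d"] assms by auto
  have *: "low n s' = low n s" if "n \<ge> N" "0 \<le> s" "s \<le> s'" "\<bar>s - t\<bar> < \<rho>" "\<bar>s' - t\<bar> < \<rho>" for n s s'
    unfolding low_def
  proof (rule lower_push_const)
    fix j assume j: "grid_index n s < j" "j \<le> grid_index n s'"
    have "s < real j / 2 ^ n" "real j / 2 ^ n \<le> s'"
      using grid_index_lt[OF j(1)] grid_index_le2[OF j(2)] that by auto
    then have "\<bar>level n (real j / 2 ^ n) - limit_level t\<bar> < limit_level t - d"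
      using that by (intro \<rho>(2)) auto
    then show "d < band_walk d u (w 0) (grid_step w n) j"
      by (simp add: level_def)
  qed (use band that grid_index_mono in auto)
  have "low n s = low n t" if "n \<ge> N" "0 \<le> s" "\<bar>s - t\<bar> < \<rho>" for n s
    using *[of n s t] *[of n t s] that assms(1) \<rho>(1) by (cases "s \<le> t") auto
  then show thesis using that \<rho>(1) by blast
qed

lemma upp_locally_const:
  assumes "0 \<le> t" "limit_level t < u"
  obtains \<rho> N where "\<rho> > 0" "\<And>n s. n \<ge> N \<Longrightarrow> 0 \<le> s \<Longrightarrow> \<bar>s - t\<bar> < \<rho> \<Longrightarrow> upp n s = upp n t"
proof -
  obtain \<rho> N where \<rho>: "\<rho> > 0"
    "\<And>n s. n \<ge> N \<Longrightarrow> 0 \<le> s \<Longrightarrow> \<bar>s - t\<bar> < \<rho> \<Longrightarrow> \<bar>level n s - limit_level t\<bar> < u - limit_level t"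
    using level_near[of t "u - limit_level t"] assms by auto
  have *: "upp n s' = upp n s" if "n \<ge> N" "0 \<le> s" "s \<le> s'" "\<bar>s - t\<bar> < \<rho>" "\<bar>s' - t\<bar> < \<rho>" for n s s'
    unfolding upp_def
  proof (rule upper_push_const)
    fix j assume j: "grid_index n s < j" "j \<le> grid_index n s'"
    have "s < real j / 2 ^ n" "real j / 2 ^ n \<le> s'"
      using grid_index_lt[OF j(1)] grid_index_le2[OF j(2)] that by auto
    then have "\<bar>level n (real j / 2 ^ n) - limit_level t\<bar> < u - limit_level t"
      using that by (intro \<rho>(2)) auto
    then show "band_walk d u (w 0) (grid_step w n) j < u"
      by (simp add: level_def)
  qed (use band that grid_index_mono in auto)
  have "upp n s = upp n t" if "n \<ge> N" "0 \<le> s" "\<bar>s - t\<bar> < \<rho>" for n s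
    using *[of n s t] *[of n t s] that assms(1) \<rho>(1) by (cases "s \<le> t") auto
  then show thesis using that \<rho>(1) by blast
qed

text \<open>
  Convergence of the walks controls the difference of the two pushes only; separating them needs
  \<open>low_locally_const\<close> and \<open>upp_locally_const\<close>.
\<close>
lemma net_push_tendsto:
  assumes "0 \<le> s"
  shows "(\<lambda>n. low n s - upp n s) \<longlonglongrightarrow> limit_level s - w s"
proof -
  have "(\<lambda>n. real (grid_index n s) / 2 ^ n) \<longlonglongrightarrow> s"
  proof (rule tendsto_sandwich)
    have "(\<lambda>n. (1/2::real) ^ n) \<longlonglongrightarrow> 0" by (simp add: LIMSEQ_realpow_zero)
    then have "(\<lambda>n. s - (1/2::real) ^ n) \<longlonglongrightarrow> s - 0" by (rule tendsto_diff[OF tendsto_const])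
    then show "(\<lambda>n. s - 1 / 2 ^ n) \<longlonglongrightarrow> s" by (simp add: power_divide)
    show "\<forall>\<^sub>F n in sequentially. s - 1 / 2 ^ n \<le> real (grid_index n s) / 2 ^ n"
      using grid_index_ge less_imp_le by (intro always_eventually) blast
    show "\<forall>\<^sub>F n in sequentially. real (grid_index n s) / 2 ^ n \<le> s"
      using grid_index_le assms by (intro always_eventually) blast
  qed (rule tendsto_const)
  moreover have "(w \<longlongrightarrow> w s) (at s within {0..})"
    using cont assms by (auto simp: continuous_on_def)
  ultimately have "(\<lambda>n. w (real (grid_index n s) / 2 ^ n)) \<longlonglongrightarrow> w s"
    using cont assms continuous_on_tendsto_compose[of "{0..}" w "\<lambda>n. real (grid_index n s) / 2 ^ n" s sequentially] by auto
  then have "(\<lambda>n. level n s - w (real (grid_index n s) / 2 ^ n)) \<longlonglongrightarrow> limit_level s - w s"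
    using level_tendsto[OF assms] by (intro tendsto_diff)
  then show ?thesis by (simp add: level_eq)
qed

lemma low_upp_convergent_iff:
  assumes "0 \<le> s" shows "convergent (\<lambda>n. low n s) \<longleftrightarrow> convergent (\<lambda>n. upp n s)"
proof
  assume "convergent (\<lambda>n. low n s)"
  then have "convergent (\<lambda>n. low n s - (low n s - upp n s))"
    by (intro convergent_diff convergentI[OF net_push_tendsto[OF assms]])
  then show "convergent (\<lambda>n. upp n s)" by simp
next
  assume "convergent (\<lambda>n. upp n s)"
  then have "convergent (\<lambda>n. upp n s + (low n s - upp n s))"
    by (intro convergent_add convergentI[OF net_push_tendsto[OF assms]])
  then show "convergent (\<lambda>n. low n s)" by simp
qed

text \<open>
  As \<open>d < u\<close>, near every time one of the two pushes is eventually frozen there, and then increments of the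
  other one are increments of the convergent net push. So convergence at a time is equivalent to
  convergence at all nearby times, and it spreads from time \<open>0\<close> over the connected set \<open>[0, \<infinity>)\<close>.
\<close>
lemma low_convergent:
  assumes "0 \<le> t" shows "convergent (\<lambda>n. low n t)"
proof -
  have "convergent (\<lambda>n. low n 0) = convergent (\<lambda>n. low n t)"
  proof (rule connected_local_const[of "{0..}"])
    show "\<forall>a\<in>{0..}. \<forall>\<^sub>F b in at a within {0..}. convergent (\<lambda>n. low n a) = convergent (\<lambda>n. low n b)"
    proof
      fix a :: real assume a: "a \<in> {0..}"
      have transfer: "convergent f \<longleftrightarrow> convergent g" if "\<And>n. n \<ge> N \<Longrightarrow> f n = g n" for f g :: "nat \<Rightarrow> real" and N
        by (rule convergent_cong) (use that in \<open>auto simp: eventually_sequentially\<close>)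
      consider "d < limit_level a" | "limit_level a < u" using band by linarith
      then show "\<forall>\<^sub>F b in at a within {0..}. convergent (\<lambda>n. low n a) = convergent (\<lambda>n. low n b)"
      proof cases
        case 1
        then obtain \<rho> N where "\<rho> > 0" and c: "\<And>n s. n \<ge> N \<Longrightarrow> 0 \<le> s \<Longrightarrow> \<bar>s - a\<bar> < \<rho> \<Longrightarrow> low n s = low n a"
          using low_locally_const[of a] a by auto
        from \<open>\<rho> > 0\<close> show ?thesis
        proof (intro eventually_near[of \<rho>])
          fix s assume s: "0 \<le> s" "\<bar>s - a\<bar> < \<rho>"
          show "convergent (\<lambda>n. low n a) = convergent (\<lambda>n. low n s)"
            by (rule transfer[of N]) (simp add: c s)
        qed
      next
        case 2
        then obtain \<rho> N where "\<rho> > 0" and c: "\<And>n s. n \<ge> N \<Longrightarrow> 0 \<le> s \<Longrightarrow> \<bar>s - a\<bar> < \<rho> \<Longrightarrow> upp n s = upp n a"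
          using upp_locally_const[of a] a by auto
        from \<open>\<rho> > 0\<close> show ?thesis
        proof (intro eventually_near[of \<rho>])
          fix s assume s: "0 \<le> s" "\<bar>s - a\<bar> < \<rho>"
          have "convergent (\<lambda>n. upp n a) = convergent (\<lambda>n. upp n s)"
            by (rule transfer[of N]) (simp add: c s)
          then show "convergent (\<lambda>n. low n a) = convergent (\<lambda>n. low n s)"
            using a s(1) by (simp add: low_upp_convergent_iff)
        qed
      qed
    qed
  qed (use assms in auto)
  moreover have "low n 0 = 0" for n by (simp add: low_def lower_push_def)
  ultimately show ?thesis by (simp add: convergent_const)
qed

definition limit_low :: "real \<Rightarrow> real" where
  "limit_low s = lim (\<lambda>n. low n s)"

definition limit_upp :: "real \<Rightarrow> real" where
  "limit_upp s = lim (\<lambda>n. upp n s)"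

lemma low_tendsto: "0 \<le> s \<Longrightarrow> (\<lambda>n. low n s) \<longlonglongrightarrow> limit_low s"
  using low_convergent unfolding limit_low_def by (simp add: convergent_LIMSEQ_iff)

lemma upp_tendsto: "0 \<le> s \<Longrightarrow> (\<lambda>n. upp n s) \<longlonglongrightarrow> limit_upp s"
  using low_convergent low_upp_convergent_iff unfolding limit_upp_def by (simp add: convergent_LIMSEQ_iff)

lemma limit_level_eq: "0 \<le> s \<Longrightarrow> limit_level s = w s + limit_low s - limit_upp s"
  using LIMSEQ_unique[OF net_push_tendsto tendsto_diff[OF low_tendsto upp_tendsto], of s] by simp

lemma limit_low_mono: "mono_on {0..} limit_low"
  by (intro mono_onI LIMSEQ_le[OF low_tendsto low_tendsto])
    (auto simp: low_def lower_push_mono grid_index_mono)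

lemma limit_upp_mono: "mono_on {0..} limit_upp"
  by (intro mono_onI LIMSEQ_le[OF upp_tendsto upp_tendsto])
    (auto simp: upp_def upper_push_mono grid_index_mono)

lemma limit_low_locally_const:
  assumes "0 \<le> t" "d < limit_level t"
  obtains \<rho> where "\<rho> > 0" "\<And>s. 0 \<le> s \<Longrightarrow> \<bar>s - t\<bar> < \<rho> \<Longrightarrow> limit_low s = limit_low t"
proof -
  obtain \<rho> N where \<rho>: "\<rho> > 0" "\<And>n s. n \<ge> N \<Longrightarrow> 0 \<le> s \<Longrightarrow> \<bar>s - t\<bar> < \<rho> \<Longrightarrow> low n s = low n t"
    using low_locally_const assms by metis
  have "limit_low s = limit_low t" if "0 \<le> s" "\<bar>s - t\<bar> < \<rho>" for s
  proof (rule LIMSEQ_unique)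
    show "(\<lambda>n. low n s) \<longlonglongrightarrow> limit_low t"
      by (rule Lim_transform_eventually[OF low_tendsto[OF assms(1)]])
        (use \<rho>(2)[OF _ that] in \<open>auto simp: eventually_sequentially intro!: exI[of _ N]\<close>)
  qed (rule low_tendsto[OF that(1)])
  then show thesis using that \<rho>(1) by blast
qed

lemma limit_upp_locally_const:
  assumes "0 \<le> t" "limit_level t < u"
  obtains \<rho> where "\<rho> > 0" "\<And>s. 0 \<le> s \<Longrightarrow> \<bar>s - t\<bar> < \<rho> \<Longrightarrow> limit_upp s = limit_upp t"
proof -
  obtain \<rho> N where \<rho>: "\<rho> > 0" "\<And>n s. n \<ge> N \<Longrightarrow> 0 \<le> s \<Longrightarrow> \<bar>s - t\<bar> < \<rho> \<Longrightarrow> upp n s = upp n t"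
    using upp_locally_const assms by metis
  have "limit_upp s = limit_upp t" if "0 \<le> s" "\<bar>s - t\<bar> < \<rho>" for s
  proof (rule LIMSEQ_unique)
    show "(\<lambda>n. upp n s) \<longlonglongrightarrow> limit_upp t"
      by (rule Lim_transform_eventually[OF upp_tendsto[OF assms(1)]])
        (use \<rho>(2)[OF _ that] in \<open>auto simp: eventually_sequentially intro!: exI[of _ N]\<close>)
  qed (rule upp_tendsto[OF that(1)])
  then show thesis using that \<rho>(1) by blast
qed

lemma limit_low_continuous: "continuous_on {0..} limit_low"
  unfolding continuous_on_def
proof
  fix t :: real assume t: "t \<in> {0..}"
  consider "d < limit_level t" | "limit_level t < u" using band by linarith
  then show "(limit_low \<longlongrightarrow> limit_low t) (at t within {0..})"
  proof cases
    case 1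
    then obtain \<rho> where "\<rho> > 0" "\<And>s. 0 \<le> s \<Longrightarrow> \<bar>s - t\<bar> < \<rho> \<Longrightarrow> limit_low s = limit_low t"
      using limit_low_locally_const t by auto
    then show ?thesis
      by (intro tendsto_eventually eventually_near)
  next
    case 2
    then obtain \<rho> where \<rho>: "\<rho> > 0" "\<And>s. 0 \<le> s \<Longrightarrow> \<bar>s - t\<bar> < \<rho> \<Longrightarrow> limit_upp s = limit_upp t"
      using limit_upp_locally_const t by auto
    have "((\<lambda>s. limit_level s - w s + limit_upp t) \<longlongrightarrow> limit_level t - w t + limit_upp t) (at t within {0..})"
      using limit_level_continuous cont t by (intro tendsto_intros) (auto simp: continuous_on_def)
    moreover have "\<forall>\<^sub>F s in at t within {0..}. limit_level s - w s + limit_upp t = limit_low s"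
      using \<rho> by (intro eventually_near[of \<rho>]) (auto simp: limit_level_eq)
    ultimately show ?thesis
      using t limit_level_eq[of t] Lim_transform_eventually by fastforce
  qed
qed

lemma limit_upp_continuous: "continuous_on {0..} limit_upp"
proof -
  have "continuous_on {0..} (\<lambda>s. w s + limit_low s - limit_level s)"
    using cont limit_low_continuous limit_level_continuous by (intro continuous_intros)
  then show ?thesis
    by (rule continuous_on_eq) (simp add: limit_level_eq)
qed

end

section \<open>Pushes as Stieltjes measures\<close>

lemma rcll_if_continuous_on:
  assumes "continuous_on {0..} f" shows "rcll f"
  unfolding rcll_def
proof (intro conjI allI impI)
  fix t :: real assume "t \<ge> 0"
  then have "continuous (at t within {0..}) f"
    using assms by (simp add: continuous_on_eq_continuous_within)
  then show "continuous (at_right t) f"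
    using \<open>t \<ge> 0\<close> by (elim continuous_within_subset) auto
next
  fix t :: real assume "t > 0"
  then have "continuous (at t) f"
    using assms continuous_on_interior[of "{0..}" f t] by simp
  then have "(f \<longlongrightarrow> f t) (at_left t)"
    by (auto simp: isCont_def intro: tendsto_within_subset)
  then show "\<exists>l. (f \<longlongrightarrow> l) (at_left t)" ..
qed

definition stieltjes :: "(real \<Rightarrow> real) \<Rightarrow> real measure" where
  "stieltjes y = interval_measure (\<lambda>t. y (max 0 t))"

lemma emeasure_stieltjes:
  assumes y: "rcll y" "mono_on {0..} y" and "a \<le> b"
  shows "emeasure (stieltjes y) {a<..b} = ennreal (y (max 0 b) - y (max 0 a))"
  unfolding stieltjes_def
proof (rule emeasure_interval_measure_Ioc)
  show "y (max 0 x) \<le> y (max 0 x')" if "x \<le> x'" for x x'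
    using that by (intro mono_onD[OF y(2)]) auto
  show "continuous (at_right a) (\<lambda>t. y (max 0 t))" for a
  proof (cases "0 \<le> a")
    case True
    then have "(y \<longlongrightarrow> y a) (at_right a)"
      using y(1) by (auto simp: rcll_def continuous_within)
    moreover have "\<forall>\<^sub>F t in at_right a. y t = y (max 0 t)"
      using True by (auto simp: eventually_at_filter)
    ultimately show ?thesis
      using True by (auto simp: continuous_within intro: Lim_transform_eventually)
  next
    case False
    have "\<forall>\<^sub>F t in at_right a. t < 0"
      using False by (intro eventually_at_rightI[of _ 0]) auto
    then have "\<forall>\<^sub>F t in at_right a. y (max 0 t) = y 0"
      by eventually_elim simp
    then show ?thesis
      using False by (auto simp: continuous_within intro: tendsto_eventually)
  qed
qed (use assms in auto)

lemma sets_stieltjes [simp, measurable_cong]: "sets (stieltjes y) = sets borel"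
  by (simp add: stieltjes_def)

text \<open>
  A lower bound for the integral that makes sense for an arbitrary \<open>g\<close>: what is integrated is a constant below
  \<open>g\<close> on the Borel set \<open>A\<close>.
\<close>
lemma idle_interval_null:
  assumes int0: "(\<integral>\<^sup>+ t\<in>{0..}. ennreal (g t) \<partial>stieltjes y) = 0"
    and A: "A \<in> sets borel" "A \<subseteq> {0..}" and e: "e > 0" "\<And>t. t \<in> A \<Longrightarrow> e \<le> g t"
  shows "emeasure (stieltjes y) A = 0"
proof -
  have "ennreal e * emeasure (stieltjes y) A = (\<integral>\<^sup>+ t. ennreal e * indicator A t \<partial>stieltjes y)"
    using A by (subst nn_integral_cmult_indicator) auto
  also have "\<dots> \<le> (\<integral>\<^sup>+ t\<in>{0..}. ennreal (g t) \<partial>stieltjes y)"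
    using A e by (intro nn_integral_mono) (auto simp: indicator_def ennreal_leI)
  finally show ?thesis using int0 e by auto
qed

lemma idle_push_const:
  assumes y: "rcll y" "mono_on {0..} y"
    and int0: "(\<integral>\<^sup>+ t\<in>{0..}. ennreal (g t) \<partial>stieltjes y) = 0"
    and ab: "0 \<le> a" "a \<le> b" and e: "e > 0" "\<And>t. a < t \<Longrightarrow> t \<le> b \<Longrightarrow> e \<le> g t"
  shows "y b = y a"
proof -
  have "emeasure (stieltjes y) {a<..b} = 0"
    by (rule idle_interval_null[OF int0, of _ e]) (use ab e in auto)
  then have "y b \<le> y a"
    using emeasure_stieltjes[OF y ab(2)] ab by (simp add: max_absorb2 ennreal_eq_0_iff)
  moreover have "y a \<le> y b" using y(2) ab by (auto intro: mono_onD)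
  ultimately show ?thesis by simp
qed

text \<open>
  A jump of \<open>y\<close> at \<open>s\<close> would be an atom of its Stieltjes measure at a point where \<open>g\<close> is positive.
\<close>
lemma idle_push_no_jump:
  assumes y: "rcll y" "mono_on {0..} y"
    and int0: "(\<integral>\<^sup>+ t\<in>{0..}. ennreal (g t) \<partial>stieltjes y) = 0"
    and s: "0 < s" "0 < g s" and l: "(y \<longlongrightarrow> l) (at_left s)"
  shows "l = y s"
proof -
  define A where "A n = {s - s / real (Suc n) <.. s}" for n
  have sub: "0 \<le> s - s / real (Suc n)" "s - s / real (Suc n) < s" for n
    using s by (auto simp: field_simps)
  have eA: "emeasure (stieltjes y) (A n) = ennreal (y s - y (s - s / real (Suc n)))" for n
    unfolding A_def using emeasure_stieltjes[OF y, of "s - s / real (Suc n)" s] sub[of n] s by (simp add: max_absorb2)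
  have dec: "decseq A"
  proof (unfold decseq_def, intro allI impI)
    fix m n :: nat assume "m \<le> n"
    then have "s / real (Suc n) \<le> s / real (Suc m)" using s by (intro frac_le) auto
    then show "A n \<subseteq> A m" unfolding A_def by auto
  qed
  have seq: "(\<lambda>n. s - s / real (Suc n)) \<longlonglongrightarrow> s"
    using tendsto_diff[OF tendsto_const LIMSEQ_Suc[OF lim_const_over_n[of s]], of s] by simp
  have inter: "(\<Inter>n. A n) = {s}"
  proof
    show "(\<Inter>n. A n) \<subseteq> {s}"
    proof
      fix x assume x: "x \<in> (\<Inter>n. A n)"
      then have "s \<le> x"
        using LIMSEQ_le_const2[OF seq, of x] by (auto simp: A_def intro: less_imp_le)
      then show "x \<in> {s}" using x by (auto simp: A_def)
    qed
  qed (use sub in \<open>auto simp: A_def\<close>)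
  have "(\<lambda>n. emeasure (stieltjes y) (A n)) \<longlonglongrightarrow> emeasure (stieltjes y) (\<Inter>n. A n)"
    using eA by (intro Lim_emeasure_decseq[OF _ dec]) (auto simp: A_def)
  moreover have "emeasure (stieltjes y) {s} = 0"
    by (rule idle_interval_null[OF int0, of _ "g s"]) (use s in auto)
  ultimately have 1: "(\<lambda>n. ennreal (y s - y (s - s / real (Suc n)))) \<longlonglongrightarrow> ennreal 0"
    unfolding inter eA by simp
  have "y (s - s / real (Suc n)) \<le> y s" for n
    using sub[of n] s by (intro mono_onD[OF y(2)]) auto
  then have "(\<lambda>n. y s - y (s - s / real (Suc n))) \<longlonglongrightarrow> 0"
    using tendsto_ennrealD[OF 1] by auto
  moreover have "filterlim (\<lambda>n. s - s / real (Suc n)) (at_left s) sequentially"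
    unfolding filterlim_at using seq sub by (auto intro!: always_eventually simp: less_imp_neq)
  then have "(\<lambda>n. y s - y (s - s / real (Suc n))) \<longlonglongrightarrow> y s - l"
    using filterlim_compose[OF l] by (intro tendsto_diff tendsto_const) auto
  ultimately show ?thesis using LIMSEQ_unique by fastforce
qed

text \<open>
  The set where \<open>g\<close> is positive is covered by intervals with rational end points on which \<open>y\<close> is
  constant; these are countably many null sets.
\<close>
lemma stieltjes_integral_eq_0:
  assumes y: "rcll y" "mono_on {0..} y"
    and const: "\<And>t. 0 \<le> t \<Longrightarrow> 0 < g t \<Longrightarrow> \<exists>\<rho>>0. \<forall>s\<ge>0. \<bar>s - t\<bar> < \<rho> \<longrightarrow> y s = y t"
  shows "(\<integral>\<^sup>+ t\<in>{0..}. ennreal (g t) \<partial>stieltjes y) = 0"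
proof -
  \<comment> \<open>Pairs of rational end points at which \<open>y\<close> takes the same value. Since \<open>y\<close> is monotone, it is constant
             in between.\<close>
  define Q where "Q = {q :: rat \<times> rat. of_rat (fst q) \<le> (of_rat (snd q) :: real) \<and>
                        y (max 0 (of_rat (fst q))) = y (max 0 (of_rat (snd q)))}"
  define U where "U = (\<Union>q\<in>Q. {of_rat (fst q) <.. (of_rat (snd q) :: real)})"
  have "U \<in> null_sets (stieltjes y)"
    unfolding U_def
  proof (rule null_sets_UN')
    show "countable Q" by simp
    fix q assume "q \<in> Q"
    then show "{of_rat (fst q) <.. of_rat (snd q)} \<in> null_sets (stieltjes y)"
      by (intro null_setsI) (auto simp: Q_def emeasure_stieltjes[OF y])
  qed
  moreover have "t \<in> U" if t: "0 \<le> t" "0 < g t" for t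
  proof -
    obtain \<rho> where \<rho>: "\<rho> > 0" "\<And>s. s \<ge> 0 \<Longrightarrow> \<bar>s - t\<bar> < \<rho> \<Longrightarrow> y s = y t"
      using const[OF t] by blast
    obtain a where a: "t - \<rho> < of_rat a" "of_rat a < t" using of_rat_dense[of "t - \<rho>" t] \<rho>(1) by auto
    obtain b where b: "t < of_rat b" "of_rat b < t + \<rho>" using of_rat_dense[of t "t + \<rho>"] \<rho>(1) by auto
    have "y (max 0 (of_rat a)) = y t" using a t by (intro \<rho>(2)) auto
    moreover have "y (max 0 (of_rat b)) = y t" using b t by (intro \<rho>(2)) auto
    ultimately have "(a, b) \<in> Q" using a b by (auto simp: Q_def)
    then show ?thesis unfolding U_def using a b by force
  qed
  ultimately have "AE t in stieltjes y. ennreal (g t) * indicator {0..} t = 0"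
    by (intro AE_I'[of U]) (auto simp: indicator_def ennreal_eq_0_iff split: if_splits)
  then show ?thesis by (subst nn_integral_cong_AE[where v = "\<lambda>_. 0"]) auto
qed

lemma idle_push_locally_const:
  assumes "continuous_on {0..} g" "0 \<le> t" "0 < g t"
    and "rcll y" "mono_on {0..} y" "(\<integral>\<^sup>+ t\<in>{0..}. ennreal (g t) \<partial>stieltjes y) = 0"
  obtains \<rho> where "\<rho> > 0" "\<And>s. 0 \<le> s \<Longrightarrow> \<bar>s - t\<bar> < \<rho> \<Longrightarrow> y s = y (t::real)"
proof -
  obtain \<rho> where \<rho>: "\<rho> > 0" "\<And>s. 0 \<le> s \<Longrightarrow> \<bar>s - t\<bar> < \<rho> \<Longrightarrow> \<bar>g s - g t\<bar> < g t / 2"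
    using assms(1-3) unfolding continuous_on_iff dist_real_def
    by (metis atLeast_iff half_gt_zero)
  have *: "y s' = y s" if "0 \<le> s" "s \<le> s'" "\<bar>s - t\<bar> < \<rho>" "\<bar>s' - t\<bar> < \<rho>" for s s'
  proof (rule idle_push_const[OF assms(4-6), of s s' "g t / 2"])
    fix r assume "s < r" "r \<le> s'"
    then have "\<bar>g r - g t\<bar> < g t / 2" using that by (intro \<rho>(2)) auto
    then show "g t / 2 \<le> g r" by linarith
  qed (use that assms in auto)
  show thesis
  proof (rule that[OF \<rho>(1)])
    fix s assume "0 \<le> s" "\<bar>s - t\<bar> < \<rho>"
    then show "y s = y t" using *[of s t] *[of t s] assms(2) \<rho>(1) by (cases "s \<le> t") auto
  qed
qed

lemma idle_push_const_compact:
  assumes g: "continuous_on {0..} g" and ab: "0 \<le> a" "a \<le> b" "\<And>t. a \<le> t \<Longrightarrow> t \<le> b \<Longrightarrow> 0 < g t"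
    and y: "rcll y" "mono_on {0..} y" "(\<integral>\<^sup>+ t\<in>{0..}. ennreal (g t) \<partial>stieltjes y) = 0"
  shows "y b = y (a::real)"
proof -
  obtain m where m: "m \<in> {a..b}" "\<And>t. t \<in> {a..b} \<Longrightarrow> g m \<le> g t"
    using continuous_attains_inf[of "{a..b}" g] ab continuous_on_subset[OF g, of "{a..b}"] by auto
  show ?thesis
    by (rule idle_push_const[OF y ab(1,2), of "g m"]) (use m ab in auto)
qed

lemma regulatorD:
  assumes "two_sided_regulator d u w y1 y2 z"
  shows "rcll y1" "rcll y2" "rcll z" "\<And>t. t \<ge> 0 \<Longrightarrow> z t = w t + y1 t - y2 t"
    "\<And>t. t \<ge> 0 \<Longrightarrow> d \<le> z t" "\<And>t. t \<ge> 0 \<Longrightarrow> z t \<le> u" "y1 0 = 0" "y2 0 = 0"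
    "mono_on {0..} y1" "mono_on {0..} y2"
    "(\<integral>\<^sup>+ t\<in>{0..}. ennreal (z t - d) \<partial>stieltjes y1) = 0"
    "(\<integral>\<^sup>+ t\<in>{0..}. ennreal (u - z t) \<partial>stieltjes y2) = 0"
  using assms unfolding two_sided_regulator_def stieltjes_def by auto

lemma continuous_on_if_no_jump:
  assumes "rcll y" "\<And>s. s > 0 \<Longrightarrow> (y \<longlongrightarrow> y s) (at_left s)"
  shows "continuous_on {0::real..} (y :: real \<Rightarrow> real)"
  unfolding continuous_on_def
proof
  fix s :: real assume s: "s \<in> {0..}"
  have right: "(y \<longlongrightarrow> y s) (at_right s)"
    using assms(1) s by (auto simp: rcll_def continuous_within)
  show "(y \<longlongrightarrow> y s) (at s within {0..})"
  proof (cases "s = 0")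
    case True
    then show ?thesis using right by (simp add: at_within_Ici_at_right)
  next
    case False
    then have "(y \<longlongrightarrow> y s) (at s)"
      using right assms(2) s by (simp add: filterlim_at_split)
    then show ?thesis by (rule tendsto_within_subset) auto
  qed
qed

lemma mono_left_limit_le:
  fixes y :: "real \<Rightarrow> real"
  assumes "mono_on {0..} y" "0 < s" "(y \<longlongrightarrow> l) (at_left s)"
  shows "l \<le> y s"
proof (rule tendsto_upperbound[OF assms(3)])
  show "\<forall>\<^sub>F r in at_left s. y r \<le> y s"
    using assms by (intro eventually_at_leftI[of 0]) (auto intro: mono_onD)
qed auto

section \<open>Existence and uniqueness of the regulator\<close>

context band_path begin

lemma regulator_exists: "two_sided_regulator d u w limit_low limit_upp limit_level"
proof -
  have "(\<integral>\<^sup>+ t\<in>{0..}. ennreal (limit_level t - d) \<partial>stieltjes limit_low) = 0"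
    by (rule stieltjes_integral_eq_0)
      (auto intro: rcll_if_continuous_on limit_low_continuous limit_low_mono elim!: limit_low_locally_const[rotated])
  moreover have "(\<integral>\<^sup>+ t\<in>{0..}. ennreal (u - limit_level t) \<partial>stieltjes limit_upp) = 0"
    by (rule stieltjes_integral_eq_0)
      (auto intro: rcll_if_continuous_on limit_upp_continuous limit_upp_mono elim!: limit_upp_locally_const[rotated])
  moreover have "limit_low 0 = 0" "limit_upp 0 = 0"
    using LIMSEQ_unique[OF low_tendsto[of 0], of 0] LIMSEQ_unique[OF upp_tendsto[of 0], of 0]
    by (simp_all add: low_def upp_def lower_push_def upper_push_def)
  ultimately show ?thesis
    unfolding two_sided_regulator_def stieltjes_def
    using limit_low_continuous limit_upp_continuous limit_level_continuous limit_low_mono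
      limit_upp_mono limit_level_mem limit_level_eq rcll_if_continuous_on by auto
qed

text \<open>
  If \<open>y1\<close> jumps up at \<open>s\<close>, then \<open>z s = d\<close> by complementarity, so \<open>y2\<close> does not jump there and \<open>z\<close> would jump
  up to \<open>d\<close> from below the band. The same holds for \<open>y2\<close> and \<open>u\<close>.
\<close>
lemma regulator_continuous:
  assumes "two_sided_regulator d u w y1 y2 z"
  shows "continuous_on {0..} y1" "continuous_on {0..} y2" "continuous_on {0..} z"
proof -
  note r = regulatorD[OF assms]
  have left: "(y1 \<longlongrightarrow> y1 s) (at_left s) \<and> (y2 \<longlongrightarrow> y2 s) (at_left s)" if s: "s > 0" for s
  proof -
    obtain l1 l2 where l: "(y1 \<longlongrightarrow> l1) (at_left s)" "(y2 \<longlongrightarrow> l2) (at_left s)"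
      using r(1,2) s unfolding rcll_def by blast
    have le: "l1 \<le> y1 s" "l2 \<le> y2 s"
      using mono_left_limit_le r(9,10) l s by blast+
    have "isCont w s"
      using cont s continuous_on_interior[of "{0..}" w s] by simp
    then have "(w \<longlongrightarrow> w s) (at_left s)"
      by (auto simp: isCont_def intro: tendsto_within_subset)
    then have lz: "((\<lambda>r. w r + y1 r - y2 r) \<longlongrightarrow> w s + l1 - l2) (at_left s)"
      using l by (intro tendsto_intros)
    have ev: "\<forall>\<^sub>F r in at_left s. w r + y1 r - y2 r \<in> {d..u}"
      using r(4,5,6) s by (intro eventually_at_leftI[of 0]) fastforce+
    have mem: "d \<le> w s + l1 - l2" "w s + l1 - l2 \<le> u"
      by (rule tendsto_lowerbound[OF lz] tendsto_upperbound[OF lz], rule eventually_mono[OF ev], auto)+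
    have zs: "z s = w s + y1 s - y2 s" using r(4) s by simp
    have e1: "l1 = y1 s" if "z s > d"
      by (rule idle_push_no_jump[OF r(1,9,11) s _ l(1)]) (use that in simp)
    have e2: "l2 = y2 s" if "z s < u"
      by (rule idle_push_no_jump[OF r(2,10,12) s _ l(2)]) (use that in simp)
    have "l1 = y1 s" "l2 = y2 s"
      using e1 e2 le mem zs r(5,6)[of s] s band by linarith+
    then show ?thesis using l by simp
  qed
  show 1: "continuous_on {0..} y1" "continuous_on {0..} y2"
    using left r(1,2) by (auto intro: continuous_on_if_no_jump)
  have "continuous_on {0..} (\<lambda>t. w t + y1 t - y2 t)"
    using 1 cont by (intro continuous_intros)
  then show "continuous_on {0..} z"
    by (rule continuous_on_eq) (simp add: r(4))
qed

text \<open>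
  Suppose \<open>z t > z' t\<close> and go back to the last time at which \<open>z \<le> z'\<close>. In between, \<open>z > z' \<ge> d\<close> keeps \<open>y1\<close> at
  rest and \<open>z' < z \<le> u\<close> keeps \<open>y2'\<close> at rest, while the remaining pushes \<open>y1'\<close> and \<open>y2\<close> only decrease \<open>z - z'\<close>.
\<close>
lemma regulator_level_le:
  assumes "two_sided_regulator d u w y1 y2 z" "two_sided_regulator d u w y1' y2' z'" "0 \<le> t"
  shows "z t \<le> z' t"
proof (rule ccontr)
  assume "\<not> z t \<le> z' t"
  then have pos: "z t - z' t > 0" by simp
  note r = regulatorD[OF assms(1)] and r' = regulatorD[OF assms(2)]
  have cz: "continuous_on {0..} z" "continuous_on {0..} z'"
    using regulator_continuous assms by blast+
  define f where "f s = z s - z' s" for s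
  have cf: "continuous_on {0..} f"
    unfolding f_def using cz by (intro continuous_intros)
  define S where "S = {0..t} \<inter> f -` {..0}"
  have "closed S"
    unfolding S_def using continuous_on_subset[OF cf, of "{0..t}"]
    by (intro continuous_closed_preimage) auto
  then have "compact S"
    unfolding S_def by (metis compact_eq_bounded_closed bounded_Int bounded_closed_interval)
  moreover have "0 \<in> S" using r(4,7,8) r'(4,7,8) assms(3) by (auto simp: S_def f_def)
  ultimately obtain s where s: "s \<in> S" "\<And>r. r \<in> S \<Longrightarrow> r \<le> s"
    using compact_attains_sup[of S] by auto
  then have st: "0 \<le> s" "s \<le> t" "f s \<le> 0" by (auto simp: S_def)
  \<comment> \<open>On \<open>[r, t]\<close> the difference stays positive, with both end points included, so the pushes at rest are
             constant there by compactness; but \<open>f\<close> would have to increase from \<open>f r\<close> to \<open>f t\<close>.\<close>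
  have "\<exists>r\<ge>s. r \<le> t \<and> f r = f t / 2"
    using st pos continuous_on_subset[OF cf, of "{s..t}"] by (intro IVT') (auto simp: f_def)
  then obtain r where rr: "s \<le> r" "r \<le> t" "f r = f t / 2" by blast
  then have "s < r" using st pos by (cases "s = r") (auto simp: f_def)
  have gt: "z q > z' q" if "r \<le> q" "q \<le> t" for q
    using s(2)[of q] that \<open>s < r\<close> st by (force simp: S_def f_def)
  have "y1 t = y1 r"
    using rr st gt r'(5) by (intro idle_push_const_compact[OF _ _ _ _ r(1,9,11)] continuous_intros cz)
      (auto, smt (verit))
  moreover have "y2' t = y2' r"
    using rr st gt r(6) by (intro idle_push_const_compact[OF _ _ _ _ r'(2,10,12)] continuous_intros cz)
      (auto, smt (verit))
  moreover have "y1' r \<le> y1' t" "y2 r \<le> y2 t"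
    using r'(9) r(10) rr st by (auto intro: mono_onD)
  ultimately have "f t \<le> f r"
    unfolding f_def using r(4)[of t] r(4)[of r] r'(4)[of t] r'(4)[of r] rr st by linarith
  then show False using rr pos by (simp add: f_def)
qed

text \<open>
  Equal levels give \<open>y1 - y1' = y2 - y2'\<close>. Near every time either both lower pushes rest or both upper
  pushes do, so this difference is locally constant, hence constant.
\<close>
lemma regulator_unique:
  assumes reg: "two_sided_regulator d u w y1 y2 z" "two_sided_regulator d u w y1' y2' z'" and "0 \<le> t"
  shows "y1 t = y1' t" "y2 t = y2' t"
proof -
  note r = regulatorD[OF reg(1)] and r' = regulatorD[OF reg(2)]
  have zz: "z s = z' s" if "0 \<le> s" for s
    using regulator_level_le[OF reg(1,2) that] regulator_level_le[OF reg(2,1) that] by simp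
  have cz: "continuous_on {0..} z" "continuous_on {0..} z'"
    using regulator_continuous reg by blast+
  have cg: "continuous_on {0..} (\<lambda>s. z s - d)" "continuous_on {0..} (\<lambda>s. u - z s)"
    "continuous_on {0..} (\<lambda>s. z' s - d)" "continuous_on {0..} (\<lambda>s. u - z' s)"
    by (intro continuous_intros cz)+
  have diff: "y1 s - y1' s = y2 s - y2' s" if "0 \<le> s" for s
    using r(4)[OF that] r'(4)[OF that] zz[OF that] by simp
  have "y1 0 - y1' 0 = y1 t - y1' t"
  proof (rule connected_local_const[where f = "\<lambda>s. y1 s - y1' s" and A = "{0..}" and a = 0 and b = t])
    show "\<forall>a\<in>{0..}. \<forall>\<^sub>F b in at a within {0..}. y1 a - y1' a = y1 b - y1' b"
    proof
      fix a :: real assume a: "a \<in> {0..}"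
      consider "d < z a" | "z a < u" using band by linarith
      then show "\<forall>\<^sub>F b in at a within {0..}. y1 a - y1' a = y1 b - y1' b"
      proof cases
        case 1
        obtain \<rho> where "\<rho> > 0" and c: "\<And>s. 0 \<le> s \<Longrightarrow> \<bar>s - a\<bar> < \<rho> \<Longrightarrow> y1 s = y1 a"
          using idle_push_locally_const[OF cg(1) _ _ r(1,9,11), of a] a 1 by auto
        obtain \<rho>' where "\<rho>' > 0" and c': "\<And>s. 0 \<le> s \<Longrightarrow> \<bar>s - a\<bar> < \<rho>' \<Longrightarrow> y1' s = y1' a"
          using idle_push_locally_const[OF cg(3) _ _ r'(1,9,11), of a] a 1 zz[of a] by auto
        show ?thesis
        proof (rule eventually_near[of "min \<rho> \<rho>'"])
          fix s assume s: "0 \<le> s" "\<bar>s - a\<bar> < min \<rho> \<rho>'"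
          have "y1 s = y1 a" "y1' s = y1' a" using c c' s by simp_all
          then show "y1 a - y1' a = y1 s - y1' s" by simp
        qed (use \<open>\<rho> > 0\<close> \<open>\<rho>' > 0\<close> in simp)
      next
        case 2
        obtain \<rho> where "\<rho> > 0" and c: "\<And>s. 0 \<le> s \<Longrightarrow> \<bar>s - a\<bar> < \<rho> \<Longrightarrow> y2 s = y2 a"
          using idle_push_locally_const[OF cg(2) _ _ r(2,10,12), of a] a 2 by auto
        obtain \<rho>' where "\<rho>' > 0" and c': "\<And>s. 0 \<le> s \<Longrightarrow> \<bar>s - a\<bar> < \<rho>' \<Longrightarrow> y2' s = y2' a"
          using idle_push_locally_const[OF cg(4) _ _ r'(2,10,12), of a] a 2 zz[of a] by auto
        show ?thesis
        proof (rule eventually_near[of "min \<rho> \<rho>'"])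
          fix s assume s: "0 \<le> s" "\<bar>s - a\<bar> < min \<rho> \<rho>'"
          have "y2 s = y2 a" "y2' s = y2' a" using c c' s by simp_all
          then show "y1 a - y1' a = y1 s - y1' s"
            using diff[OF s(1)] diff[of a] a by simp
        qed (use \<open>\<rho> > 0\<close> \<open>\<rho>' > 0\<close> in simp)
      qed
    qed
  qed (use assms in auto)
  then show "y1 t = y1' t" using r(7) r'(7) by simp
  then show "y2 t = y2' t" using diff[of t] assms(3) by simp
qed

lemma Psi1_eq: "0 \<le> t \<Longrightarrow> Psi1 d u w t = limit_low t"
  unfolding Psi1_def using regulator_exists regulator_unique by (intro the_equality) blast+

lemma Psi2_eq: "0 \<le> t \<Longrightarrow> Psi2 d u w t = limit_upp t"
  unfolding Psi2_def using regulator_exists regulator_unique by (intro the_equality) blast+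

end

context band_path begin

text \<open>
  The Riemann sums are integrals of \<open>h\<close> along the step functions \<open>level n\<close>, with the last incomplete grid
  cell left out; dominated convergence applies because \<open>h\<close> is bounded on the band.
\<close>
lemma holding_cost_tendsto:
  assumes h: "continuous_on {d..u} h" "\<And>z. z \<in> {d..u} \<Longrightarrow> 0 \<le> h z" and t: "0 \<le> t"
  shows "\<exists>I\<ge>0. (\<lambda>n. 1 / 2 ^ n * (\<Sum>i<grid_index n t. h (band_walk d u (w 0) (grid_step w n) i))) \<longlonglongrightarrow> I \<and>
     (\<integral>\<^sup>+ s\<in>{0..t}. ennreal (h (limit_level s)) \<partial>lborel) = ennreal I"
proof -
  obtain H where H: "\<And>z. z \<in> {d..u} \<Longrightarrow> \<bar>h z\<bar> \<le> H"
    using continuous_on_Icc_bounded[OF h(1)] by blast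
  define cell where "cell n i = {real i / 2 ^ n..<real (Suc i) / 2 ^ n}" for n i :: nat
  define f where "f n s = (\<Sum>i<grid_index n t. h (level n (real i / 2 ^ n)) * indicator (cell n i) s)" for n s
  define g where "g s = indicator {0..<t} s * h (limit_level s)" for s
  have f_eq: "f n s = (if 0 \<le> s \<and> grid_index n s < grid_index n t then h (level n s) else 0)" for n s
  proof -
    have mem: "s \<in> cell n i \<longleftrightarrow> 0 \<le> s \<and> grid_index n s = i" for i
    proof
      assume s: "s \<in> cell n i"
      then have "0 \<le> s" unfolding cell_def by (auto intro: order_trans[rotated])
      moreover have "real i \<le> s * 2 ^ n" "s * 2 ^ n < real i + 1"
        using s by (auto simp: cell_def field_simps)
      then have "\<lfloor>s * 2 ^ n\<rfloor> = int i" by linarith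
      ultimately show "0 \<le> s \<and> grid_index n s = i" by (simp add: grid_index_def)
    next
      assume "0 \<le> s \<and> grid_index n s = i"
      then show "s \<in> cell n i"
        using grid_index_le[of s n] grid_index_lt[of n s "Suc i"] by (auto simp: cell_def)
    qed
    have "f n s = (\<Sum>i<grid_index n t. if i = grid_index n s then (if 0 \<le> s then h (level n (real i / 2 ^ n)) else 0) else 0)"
      unfolding f_def by (intro sum.cong) (auto simp: indicator_def mem)
    also have "\<dots> = (if 0 \<le> s \<and> grid_index n s < grid_index n t then h (level n s) else 0)"
      by (auto simp: level_def)
    finally show ?thesis .
  qed
  have lim: "(\<lambda>n. f n s) \<longlonglongrightarrow> g s" for s
  proof (cases "0 \<le> s \<and> s < t")
    case True
    have "(\<lambda>n. h (level n s)) \<longlonglongrightarrow> h (limit_level s)"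
      using continuous_on_tendsto_compose[OF h(1) level_tendsto] True limit_level_mem level_mem by auto
    moreover obtain N where N: "\<And>n. n \<ge> N \<Longrightarrow> 1 / 2 ^ n < t - s"
      using half_power_less[of "t - s"] True by auto
    have "f n s = h (level n s)" if "n \<ge> N" for n
    proof -
      have "real (grid_index n s) / 2 ^ n < real (grid_index n t) / 2 ^ n"
        using grid_index_le[of s n] grid_index_ge[of t n] N[OF that] True by linarith
      then have "grid_index n s < grid_index n t" by (simp add: divide_less_cancel)
      then show ?thesis using True by (simp add: f_eq)
    qed
    then have "\<forall>\<^sub>F n in sequentially. h (level n s) = f n s"
      by (auto simp: eventually_sequentially intro!: exI[of _ N])
    ultimately show ?thesis
      using True Lim_transform_eventually by (fastforce simp: g_def)
  next
    case False
    have "f n s = 0" for n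
      using False grid_index_mono[of t s n] by (auto simp: f_eq)
    then show ?thesis using False by (simp add: g_def)
  qed
  have fm: "f n \<in> borel_measurable lborel" for n
    unfolding f_def[abs_def] cell_def by measurable
  have gm: "g \<in> borel_measurable lborel"
    by (rule borel_measurable_LIMSEQ_real[OF lim fm])
  have bound: "norm (f n s) \<le> indicator {0..t} s * H" for n s
  proof -
    have "0 \<le> H" using H[OF level_mem[of n s]] by linarith
    moreover have "s \<le> t" if "grid_index n s < grid_index n t"
      using that grid_index_mono[of t s n] by linarith
    ultimately show ?thesis using H[OF level_mem[of n s]] by (auto simp: f_eq indicator_def)
  qed
  have intH: "integrable lborel (\<lambda>s. indicator {0..t} s * H)"
    using t by (intro integrable_mult_left integrable_real_indicator) auto
  have AE_lim: "AE s in lborel. (\<lambda>n. f n s) \<longlonglongrightarrow> g s"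
    and AE_bound: "\<And>n. AE s in lborel. norm (f n s) \<le> indicator {0..t} s * H"
    using lim bound by (auto intro: always_eventually)
  note conv = integrable_dominated_convergence[OF gm fm intH AE_lim AE_bound]
    integral_dominated_convergence[OF gm fm intH AE_lim AE_bound]
  have int_f: "integral\<^sup>L lborel (f n) = 1 / 2 ^ n * (\<Sum>i<grid_index n t. h (band_walk d u (w 0) (grid_step w n) i))" for n
  proof -
    have "measure lborel (cell n i) = 1 / 2 ^ n" for i
      unfolding cell_def by (simp add: divide_right_mono field_simps)
    moreover have "integrable lborel (\<lambda>s. c * indicator (cell n i) s :: real)" for i c
      unfolding cell_def by (intro integrable_mult_right integrable_real_indicator) (auto simp: divide_right_mono)
    ultimately show ?thesis
      unfolding f_def[abs_def] by (subst Bochner_Integration.integral_sum) (auto simp: level_def sum_divide_distrib cell_def)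
  qed
  have g0: "0 \<le> g s" for s
    using h(2)[OF limit_level_mem] by (auto simp: g_def indicator_def)
  have "AE s in lborel. ennreal (h (limit_level s)) * indicator {0..t} s = ennreal (g s)"
    using AE_lborel_singleton[of t] by eventually_elim (auto simp: g_def indicator_def)
  then have "(\<integral>\<^sup>+ s\<in>{0..t}. ennreal (h (limit_level s)) \<partial>lborel) = (\<integral>\<^sup>+ s. ennreal (g s) \<partial>lborel)"
    by (rule nn_integral_cong_AE)
  also have "\<dots> = ennreal (integral\<^sup>L lborel g)"
    using conv(1) g0 by (intro nn_integral_eq_integral) auto
  finally show ?thesis
    using conv(2) g0 unfolding int_f by (intro exI[of _ "integral\<^sup>L lborel g"]) auto
qed

end

section \<open>One reflected step of a smooth function\<close>

text \<open>
  For \<open>\<bar>b - a\<bar>\<close> below a threshold \<open>r\<close> the oscillation of \<open>V''\<close> is less than \<open>e\<close>; beyond it the crude bound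
  \<open>2 * B\<close> is at most \<open>2 * B * (b - a)\<^sup>2 / r\<^sup>2\<close>. The quartic term is affordable because the fourth moment
  of an increment over time \<open>\<delta>\<close> has order \<open>\<delta>\<^sup>2\<close>.
\<close>
lemma second_order_taylor:
  fixes V :: "real \<Rightarrow> real"
  assumes V: "C2_on {d..u} V V' V''" and e: "0 < e"
  obtains C where "0 \<le> C"
    "\<And>a b. a \<in> {d..u} \<Longrightarrow> b \<in> {d..u} \<Longrightarrow>
       \<bar>V b - V a - V' a * (b - a) - 1 / 2 * V'' a * (b - a)\<^sup>2\<bar> \<le> e * (b - a)\<^sup>2 + C * (b - a) ^ 4"
proof -
  note D = V[unfolded C2_on_def]
  obtain B where B: "B > 0" "\<And>x. x \<in> {d..u} \<Longrightarrow> \<bar>V'' x\<bar> \<le> B"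
    using continuous_on_Icc_bounded[of d u V''] D by blast
  have "uniformly_continuous_on {d..u} V''"
    using D by (intro compact_uniformly_continuous) auto
  then obtain r where r: "r > 0" "\<And>x y. x \<in> {d..u} \<Longrightarrow> y \<in> {d..u} \<Longrightarrow> dist y x < r \<Longrightarrow> dist (V'' y) (V'' x) < e"
    unfolding uniformly_continuous_on_def using e by metis
  define C where "C = 2 * B / r\<^sup>2"
  have "\<bar>V b - V a - V' a * (b - a) - 1 / 2 * V'' a * (b - a)\<^sup>2\<bar> \<le> e * (b - a)\<^sup>2 + C * (b - a) ^ 4"
    if ab: "a \<in> {d..u}" "b \<in> {d..u}" for a b
  proof -
    define S where "S = {min a b..max a b}"
    define w where "w = e + C * (b - a)\<^sup>2"
    have S: "convex S" "a \<in> S" "b \<in> S" "S \<subseteq> {d..u}" "\<And>x. x \<in> S \<Longrightarrow> \<bar>x - a\<bar> \<le> \<bar>b - a\<bar>"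
      using ab unfolding S_def by (auto simp: min_def max_def split: if_splits)
    have w: "\<bar>V'' x - V'' a\<bar> \<le> w" if x: "x \<in> S" for x
    proof (cases "\<bar>x - a\<bar> < r")
      case True
      then have "\<bar>V'' x - V'' a\<bar> < e" using r(2)[of a x] x S ab by (auto simp: dist_real_def)
      then show ?thesis using B r unfolding w_def C_def by (smt (verit) divide_nonneg_nonneg mult_nonneg_nonneg zero_le_power2)
    next
      case False
      then have "r\<^sup>2 \<le> \<bar>b - a\<bar>\<^sup>2"
        using S(5)[OF x] r by (intro power_mono) auto
      then have "1 \<le> (b - a)\<^sup>2 / r\<^sup>2" using r by simp
      then have "2 * B * 1 \<le> 2 * B * ((b - a)\<^sup>2 / r\<^sup>2)"
        using B by (intro mult_left_mono) auto
      moreover have "\<bar>V'' x - V'' a\<bar> \<le> 2 * B" using B(2)[of x] B(2)[of a] x ab S by (auto simp: subset_iff)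
      ultimately show ?thesis using e unfolding w_def C_def by simp
    qed
    have w0: "0 \<le> w" using w[OF S(2)] by simp
    have D1: "(V has_real_derivative V' x) (at x within S)" "(V' has_real_derivative V'' x) (at x within S)" if "x \<in> S" for x
      using D that S(4) by (auto intro: DERIV_subset)
    have first: "\<bar>V' x - V' a - V'' a * (x - a)\<bar> \<le> w * \<bar>b - a\<bar>" if x: "x \<in> S" for x
    proof -
      have "norm ((V' x - V'' a * x) - (V' a - V'' a * a)) \<le> w * norm (x - a)"
      proof (rule field_differentiable_bound[OF S(1)])
        fix y assume y: "y \<in> S"
        show "((\<lambda>y. V' y - V'' a * y) has_field_derivative (V'' y - V'' a)) (at y within S)"
          by (auto intro!: derivative_eq_intros D1(2)[OF y])
        show "norm (V'' y - V'' a) \<le> w" using w[OF y] by simp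
      qed (use x S in auto)
      also have "\<dots> \<le> w * \<bar>b - a\<bar>" using S(5)[OF x] w0 by (intro mult_left_mono) auto
      finally show ?thesis by (simp add: algebra_simps)
    qed
    have "norm ((V b - V' a * (b - a) - 1 / 2 * V'' a * (b - a)\<^sup>2) - (V a - V' a * (a - a) - 1 / 2 * V'' a * (a - a)\<^sup>2))
        \<le> (w * \<bar>b - a\<bar>) * norm (b - a)"
    proof (rule field_differentiable_bound[OF S(1)])
      fix y assume y: "y \<in> S"
      show "((\<lambda>y. V y - V' a * (y - a) - 1 / 2 * V'' a * (y - a)\<^sup>2) has_field_derivative
          (V' y - V' a - V'' a * (y - a))) (at y within S)"
        by (auto intro!: derivative_eq_intros D1(1)[OF y])
      show "norm (V' y - V' a - V'' a * (y - a)) \<le> w * \<bar>b - a\<bar>" using first[OF y] by simp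
    qed (use S in auto)
    also have "\<dots> = w * (b - a)\<^sup>2" by (simp add: power2_eq_square)
    also have "\<dots> = e * (b - a)\<^sup>2 + C * (b - a) ^ 4"
      unfolding w_def by (simp add: algebra_simps flip: power_add)
    finally show ?thesis by (simp add: algebra_simps)
  qed
  moreover have "0 \<le> C" using B r by (simp add: C_def)
  ultimately show thesis using that by blast
qed

text \<open>
  One step of Ito's formula. The boundary values of \<open>V'\<close> make the first-order effect of a push cancel its
  cost, up to \<open>\<bar>x\<bar>\<close> times the push: a push happens only if \<open>z\<close> is within \<open>\<bar>x\<bar>\<close> of that barrier. The
  product of \<open>\<bar>x\<bar>\<close> and the push is split into a small multiple of the push, for small \<open>x\<close>, and a multiple of
  \<open>x ^ 4\<close>, for large \<open>x\<close>.
\<close>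
lemma reflected_step_taylor:
  fixes V :: "real \<Rightarrow> real"
  assumes V: "C2_on {d..u} V V' V''" and bc: "V' d = - k" "V' u = l" and e: "0 < e" and du: "d < u"
  obtains C where "0 \<le> C"
    "\<And>z x p q. z \<in> {d..u} \<Longrightarrow> p = max 0 (d - (z + x)) \<Longrightarrow> q = max 0 (z + x - u) \<Longrightarrow>
      \<bar>V (max d (min u (z + x))) - V z + k * p + l * q - V' z * x - 1 / 2 * V'' z * x\<^sup>2\<bar>
       \<le> e * (x\<^sup>2 + p + q) + C * x ^ 4"
proof -
  note D = V[unfolded C2_on_def]
  obtain B where B: "B > 0" "\<And>x. x \<in> {d..u} \<Longrightarrow> \<bar>V'' x\<bar> \<le> B"
    using continuous_on_Icc_bounded[of d u V''] D by blast
  have lip: "\<bar>V' x - V' y\<bar> \<le> B * \<bar>x - y\<bar>" if "x \<in> {d..u}" "y \<in> {d..u}" for x y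
    using field_differentiable_bound[of "{d..u}" V' V'' B x y] D B that by auto
  obtain C where C: "0 \<le> C"
    "\<And>a b. a \<in> {d..u} \<Longrightarrow> b \<in> {d..u} \<Longrightarrow>
       \<bar>V b - V a - V' a * (b - a) - 1 / 2 * V'' a * (b - a)\<^sup>2\<bar> \<le> e * (b - a)\<^sup>2 + C * (b - a) ^ 4"
    using second_order_taylor[OF V e] by blast
  define b where "b = 5 / 2 * B"
  \<comment> \<open>The size of \<open>x\<close> that separates the two cases: up to \<open>h\<close>, the error \<open>b * \<bar>x\<bar>\<close> times the push is at
             most \<open>e\<close> times the push.\<close>
  define h where "h = e / b"
  have b: "b > 0" "h > 0" "b * h = e" using B e by (auto simp: b_def h_def)
  define C' where "C' = C + b / h\<^sup>2"
  have "\<bar>V (max d (min u (z + x))) - V z + k * p + l * q - V' z * x - 1 / 2 * V'' z * x\<^sup>2\<bar>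
       \<le> e * (x\<^sup>2 + p + q) + C' * x ^ 4"
    if z: "z \<in> {d..u}" and p: "p = max 0 (d - (z + x))" and q: "q = max 0 (z + x - u)" for z x p q
  proof -
    define z' where "z' = max d (min u (z + x))"
    have z': "z' \<in> {d..u}" "z' - z = x + p - q" "\<bar>z' - z\<bar> \<le> \<bar>x\<bar>"
      using z du unfolding z'_def p q by (auto simp: max_def min_def)
    have pq: "0 \<le> p" "0 \<le> q" "p + q \<le> \<bar>x\<bar>" "p * q = 0"
      "p > 0 \<Longrightarrow> \<bar>z - d\<bar> \<le> \<bar>x\<bar>" "q > 0 \<Longrightarrow> \<bar>z - u\<bar> \<le> \<bar>x\<bar>"
      using z du unfolding p q by (auto simp: max_def split: if_splits)
    have lower: "\<bar>(V' z + k) * p\<bar> \<le> B * \<bar>x\<bar> * p"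
    proof (cases "p > 0")
      case True
      have "\<bar>V' z + k\<bar> \<le> B * \<bar>z - d\<bar>" using lip[of z d] z du bc by auto
      also have "\<dots> \<le> B * \<bar>x\<bar>" using pq(5)[OF True] B by (intro mult_left_mono) auto
      finally show ?thesis using pq(1) by (simp add: abs_mult mult_right_mono)
    qed (use pq in simp)
    have upper: "\<bar>(l - V' z) * q\<bar> \<le> B * \<bar>x\<bar> * q"
    proof (cases "q > 0")
      case True
      have "\<bar>l - V' z\<bar> \<le> B * \<bar>z - u\<bar>" using lip[of u z] z du bc by (auto simp: abs_minus_commute)
      also have "\<dots> \<le> B * \<bar>x\<bar>" using pq(6)[OF True] B by (intro mult_left_mono) auto
      finally show ?thesis using pq(2) by (simp add: abs_mult mult_right_mono)
    qed (use pq in simp)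
    have second: "\<bar>1 / 2 * V'' z * ((z' - z)\<^sup>2 - x\<^sup>2)\<bar> \<le> 3 / 2 * B * \<bar>x\<bar> * (p + q)"
    proof -
      have "(z' - z)\<^sup>2 - x\<^sup>2 = (p - q) * ((z' - z) + x)"
        unfolding z'(2) by (simp add: power2_eq_square algebra_simps)
      then have "\<bar>(z' - z)\<^sup>2 - x\<^sup>2\<bar> = \<bar>p - q\<bar> * \<bar>(z' - z) + x\<bar>" by (simp add: abs_mult)
      also have "\<dots> \<le> (p + q) * (3 * \<bar>x\<bar>)"
        using pq z'(3) by (intro mult_mono) auto
      finally have *: "\<bar>(z' - z)\<^sup>2 - x\<^sup>2\<bar> \<le> (p + q) * (3 * \<bar>x\<bar>)" .
      have "\<bar>V'' z\<bar> * \<bar>(z' - z)\<^sup>2 - x\<^sup>2\<bar> \<le> B * ((p + q) * (3 * \<bar>x\<bar>))"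
        using * B(1) B(2)[OF z] by (intro mult_mono) auto
      moreover have "\<bar>1 / 2 * V'' z * ((z' - z)\<^sup>2 - x\<^sup>2)\<bar> = 1 / 2 * (\<bar>V'' z\<bar> * \<bar>(z' - z)\<^sup>2 - x\<^sup>2\<bar>)"
        by (simp only: abs_mult)
      moreover have "3 / 2 * B * \<bar>x\<bar> * (p + q) = 1 / 2 * (B * ((p + q) * (3 * \<bar>x\<bar>)))" by simp
      ultimately show ?thesis by linarith
    qed
    have sq: "(z' - z)\<^sup>2 \<le> x\<^sup>2" using z'(3) by (simp add: abs_le_square_iff)
    have qd: "(z' - z) ^ 4 \<le> x ^ 4"
      using power_mono[OF sq, of 2] by (simp flip: power_mult)
    have "\<bar>V z' - V z - V' z * (z' - z) - 1 / 2 * V'' z * (z' - z)\<^sup>2\<bar> \<le> e * (z' - z)\<^sup>2 + C * (z' - z) ^ 4"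
      using C(2)[OF z z'(1)] .
    also have "\<dots> \<le> e * x\<^sup>2 + C * x ^ 4"
      using sq qd e C(1) by (intro add_mono mult_left_mono) auto
    finally have T: "\<bar>V z' - V z - V' z * (z' - z) - 1 / 2 * V'' z * (z' - z)\<^sup>2\<bar> \<le> e * x\<^sup>2 + C * x ^ 4" .
    have x4: "0 \<le> x ^ 4" by simp
    have push: "\<bar>x\<bar> * (p + q) \<le> h * (p + q) + x ^ 4 / h\<^sup>2"
    proof (cases "\<bar>x\<bar> \<le> h")
      case True
      then have "\<bar>x\<bar> * (p + q) \<le> h * (p + q)" using pq by (intro mult_right_mono) auto
      then show ?thesis using x4 by (smt (verit) divide_nonneg_nonneg zero_le_power2)
    next
      case False
      have "\<bar>x\<bar> * (p + q) \<le> \<bar>x\<bar> * \<bar>x\<bar>" using pq by (intro mult_left_mono) auto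
      also have "\<dots> = x\<^sup>2 * 1" by (simp add: power2_eq_square)
      also have "\<dots> \<le> x\<^sup>2 * (x\<^sup>2 / h\<^sup>2)"
      proof (intro mult_left_mono)
        have "h\<^sup>2 \<le> \<bar>x\<bar>\<^sup>2" using False b by (intro power_mono) auto
        then show "1 \<le> x\<^sup>2 / h\<^sup>2" using b by simp
      qed simp
      also have "\<dots> = x ^ 4 / h\<^sup>2" by (simp flip: power_add)
      finally show ?thesis using pq b by (smt (verit) mult_nonneg_nonneg)
    qed
    have "V z' - V z + k * p + l * q - V' z * x - 1 / 2 * V'' z * x\<^sup>2
      = (V z' - V z - V' z * (z' - z) - 1 / 2 * V'' z * (z' - z)\<^sup>2)
        + (V' z + k) * p + (l - V' z) * q + 1 / 2 * V'' z * ((z' - z)\<^sup>2 - x\<^sup>2)"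
      unfolding z'(2) by (simp add: algebra_simps)
    then have "\<bar>V z' - V z + k * p + l * q - V' z * x - 1 / 2 * V'' z * x\<^sup>2\<bar>
      \<le> e * x\<^sup>2 + C * x ^ 4 + B * \<bar>x\<bar> * p + B * \<bar>x\<bar> * q + 3 / 2 * B * \<bar>x\<bar> * (p + q)"
      using T lower upper second by linarith
    also have "\<dots> = e * x\<^sup>2 + C * x ^ 4 + b * (\<bar>x\<bar> * (p + q))"
      by (simp add: b_def algebra_simps)
    also have "\<dots> \<le> e * x\<^sup>2 + C * x ^ 4 + b * (h * (p + q) + x ^ 4 / h\<^sup>2)"
      using push b by simp
    also have "\<dots> = e * (x\<^sup>2 + p + q) + C' * x ^ 4"
      unfolding C'_def b(3)[symmetric] by (simp add: algebra_simps)
    finally show ?thesis unfolding z'_def .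
  qed
  moreover have "0 \<le> C'" using C b by (simp add: C'_def)
  ultimately show thesis using that by blast
qed

text \<open>
  Clipping shortens the distance to the centre of the band, and the gain pays for the push: with half
  width \<open>r\<close>, an overshoot \<open>e\<close> lowers the squared distance from \<open>(r + e)\<^sup>2\<close> to \<open>r\<^sup>2\<close>.
\<close>
lemma reflected_step_square:
  fixes d u z x :: real
  assumes "d < u" "z \<in> {d..u}"
  defines "m \<equiv> (d + u) / 2"
  shows "(max d (min u (z + x)) - m)\<^sup>2 + (u - d) * (max 0 (d - (z + x)) + max 0 (z + x - u)) \<le> (z + x - m)\<^sup>2"
proof -
  consider "z + x < d" | "z + x > u" | "d \<le> z + x" "z + x \<le> u" by linarith
  then show ?thesis
  proof cases
    case 1
    have eq: "(d - m)\<^sup>2 + (u - d) * (d - (z + x)) + (d - (z + x))\<^sup>2 = (z + x - m)\<^sup>2"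
      by (simp add: m_def power2_eq_square field_simps)
    have mm: "max d (min u (z + x)) = d" "max 0 (d - (z + x)) = d - (z + x)" "max 0 (z + x - u) = 0"
      using 1 assms(1) by (auto simp: max_def min_def)
    show ?thesis unfolding mm add_0_left add_0_right using eq zero_le_power2[of "d - (z + x)"] by linarith
  next
    case 2
    have eq: "(u - m)\<^sup>2 + (u - d) * (z + x - u) + (z + x - u)\<^sup>2 = (z + x - m)\<^sup>2"
      by (simp add: m_def power2_eq_square field_simps)
    have mm: "max d (min u (z + x)) = u" "max 0 (d - (z + x)) = 0" "max 0 (z + x - u) = z + x - u"
      using 2 assms(1) by (auto simp: max_def min_def)
    show ?thesis unfolding mm add_0_left add_0_right using eq zero_le_power2[of "z + x - u"] by linarith
  next
    case 3
    then show ?thesis by (simp add: max_def min_def)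
  qed
qed

section \<open>Independence, moments and passage to the limit\<close>

lemma (in prob_space) indep_set_mono_right:
  "indep_set A B \<Longrightarrow> B' \<subseteq> B \<Longrightarrow> indep_set A B'"
  unfolding indep_sets2_eq by blast

lemma (in prob_space) centred_normal_moments:
  assumes D: "distributed M lborel X (\<lambda>y. ennreal (normal_density 0 s y))" and s: "0 < s"
  shows "integrable M (\<lambda>\<omega>. X \<omega> ^ j)" "expectation X = 0"
    "expectation (\<lambda>\<omega>. (X \<omega>)\<^sup>2) = s\<^sup>2" "expectation (\<lambda>\<omega>. X \<omega> ^ 4) = 3 * s ^ 4"
proof -
  show "integrable M (\<lambda>\<omega>. X \<omega> ^ j)"
    using distributed_integrable[OF D, of "\<lambda>x. x ^ j"] integrable_normal_moment[OF s, of 0 j] by simp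
  have E: "expectation (\<lambda>\<omega>. X \<omega> ^ j) = (\<integral>x. normal_density 0 s x * x ^ j \<partial>lborel)" for j
    using distributed_integral[OF D, of "\<lambda>x. x ^ j"] by simp
  show "expectation X = 0"
    using E[of 1] integral_normal_moment_odd[OF s, of 0 0] by simp
  show "expectation (\<lambda>\<omega>. (X \<omega>)\<^sup>2) = s\<^sup>2"
    using E[of 2] integral_normal_moment_even[OF s, of 0 1] by simp
  have "fact (2 * 2) / ((2 / s\<^sup>2) ^ 2 * fact 2) = 3 * s ^ 4"
    using s by (simp add: fact_numeral power_divide flip: power_mult)
  then show "expectation (\<lambda>\<omega>. X \<omega> ^ 4) = 3 * s ^ 4"
    using E[of 4] integral_normal_moment_even[OF s, of 0 2] by simp
qed

text \<open>
  Boundedness in mean square gives uniform integrability: \<open>\<bar>t\<bar> \<le> e * t\<^sup>2 + min \<bar>t\<bar> (1 / e)\<close> splits the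
  distance of \<open>f n\<close> and its limit into a part with uniformly small mean and a bounded part. The limit \<open>g\<close> may
  fail to be measurable and is replaced by the limit of the \<open>f n\<close> where it exists.
\<close>
lemma (in prob_space) L2_bounded_limit:
  fixes f :: "nat \<Rightarrow> 'a \<Rightarrow> real"
  assumes meas: "\<And>n. f n \<in> borel_measurable M"
    and int: "\<And>n. integrable M (\<lambda>\<omega>. (f n \<omega>)\<^sup>2)"
    and bound: "\<And>n. expectation (\<lambda>\<omega>. (f n \<omega>)\<^sup>2) \<le> B"
    and lim: "AE \<omega> in M. (\<lambda>n. f n \<omega>) \<longlonglongrightarrow> g \<omega>"
    and nonneg: "AE \<omega> in M. 0 \<le> g \<omega>"
  obtains L where "(\<lambda>n. expectation (f n)) \<longlonglongrightarrow> L" "0 \<le> L" "(\<integral>\<^sup>+\<omega>. ennreal (g \<omega>) \<partial>M) = ennreal L"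
proof -
  note meas[measurable]
  define g' where "g' \<omega> = lim (\<lambda>n. f n \<omega>)" for \<omega>
  have [measurable]: "g' \<in> borel_measurable M" unfolding g'_def[abs_def] by measurable
  have gg': "AE \<omega> in M. g \<omega> = g' \<omega>"
    using lim by eventually_elim (simp add: g'_def limI)
  have lim': "AE \<omega> in M. (\<lambda>n. f n \<omega>) \<longlonglongrightarrow> g' \<omega>"
    using lim gg' by eventually_elim simp
  have intf: "integrable M (f n)" for n
    by (rule square_integrable_imp_integrable) (use int in auto)
  have B: "0 \<le> B"
  proof -
    have "0 \<le> expectation (\<lambda>\<omega>. (f 0 \<omega>)\<^sup>2)" by simp
    then show ?thesis using bound[of 0] by linarith
  qed
  have nnf: "(\<integral>\<^sup>+\<omega>. ennreal ((f n \<omega>)\<^sup>2) \<partial>M) \<le> ennreal B" for n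
    using int[of n] bound[of n] by (subst nn_integral_eq_integral) (auto intro: ennreal_leI)
  have "(\<integral>\<^sup>+\<omega>. ennreal ((g' \<omega>)\<^sup>2) \<partial>M) = (\<integral>\<^sup>+\<omega>. liminf (\<lambda>n. ennreal ((f n \<omega>)\<^sup>2)) \<partial>M)"
  proof (rule nn_integral_cong_AE)
    show "AE \<omega> in M. ennreal ((g' \<omega>)\<^sup>2) = liminf (\<lambda>n. ennreal ((f n \<omega>)\<^sup>2))"
      using lim'
    proof eventually_elim
      case (elim \<omega>)
      then have "(\<lambda>n. ennreal ((f n \<omega>)\<^sup>2)) \<longlonglongrightarrow> ennreal ((g' \<omega>)\<^sup>2)"
        by (intro tendsto_ennrealI tendsto_power)
      from lim_imp_Liminf[OF trivial_limit_sequentially this] show ?case by simp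
    qed
  qed
  also have "\<dots> \<le> liminf (\<lambda>n. \<integral>\<^sup>+\<omega>. ennreal ((f n \<omega>)\<^sup>2) \<partial>M)"
    by (rule nn_integral_liminf) simp
  also have "\<dots> \<le> ennreal B"
    using nnf by (intro Liminf_le) (auto simp: trivial_limit_sequentially)
  finally have nng: "(\<integral>\<^sup>+\<omega>. ennreal ((g' \<omega>)\<^sup>2) \<partial>M) \<le> ennreal B" .
  then have intg2: "integrable M (\<lambda>\<omega>. (g' \<omega>)\<^sup>2)"
    by (intro integrableI_bounded) (auto intro: le_less_trans)
  have Eg2: "expectation (\<lambda>\<omega>. (g' \<omega>)\<^sup>2) \<le> B"
    using nng B intg2 by (subst (asm) nn_integral_eq_integral) auto
  have intg: "integrable M g'"
    by (rule square_integrable_imp_integrable) (use intg2 in auto)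
  have intD: "integrable M (\<lambda>\<omega>. \<bar>f n \<omega> - g' \<omega>\<bar>)" for n
    using intf intg by simp
  have "(\<lambda>n. expectation (\<lambda>\<omega>. \<bar>f n \<omega> - g' \<omega>\<bar>)) \<longlonglongrightarrow> 0"
  proof (rule LIMSEQ_I)
    fix r :: real assume r: "0 < r"
    \<comment> \<open>The quadratic part has mean at most \<open>4 * B * e\<close>, which is to be at most \<open>r / 2\<close>.\<close>
    define e where "e = r / (8 * (B + 1))"
    have e: "0 < e" using r B by (simp add: e_def)
    have m1: "(\<lambda>n. expectation (\<lambda>\<omega>. min \<bar>f n \<omega> - g' \<omega>\<bar> (1 / e))) \<longlonglongrightarrow> expectation (\<lambda>\<omega>. 0)"
    proof (rule integral_dominated_convergence[where w = "\<lambda>_. 1 / e"])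
      show "AE \<omega> in M. (\<lambda>n. min \<bar>f n \<omega> - g' \<omega>\<bar> (1 / e)) \<longlonglongrightarrow> 0"
        using lim'
      proof eventually_elim
        case (elim \<omega>)
        then have "(\<lambda>n. min \<bar>f n \<omega> - g' \<omega>\<bar> (1 / e)) \<longlonglongrightarrow> min \<bar>g' \<omega> - g' \<omega>\<bar> (1 / e)"
          by (intro tendsto_intros)
        then show ?case using e by simp
      qed
    qed (use e in auto)
    then obtain N where N: "\<And>n. n \<ge> N \<Longrightarrow> \<bar>expectation (\<lambda>\<omega>. min \<bar>f n \<omega> - g' \<omega>\<bar> (1 / e))\<bar> < r / 2"
      using LIMSEQ_D[OF m1, of "r / 2"] r by auto
    have "norm (expectation (\<lambda>\<omega>. \<bar>f n \<omega> - g' \<omega>\<bar>) - 0) < r" if n: "n \<ge> N" for n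
    proof -
      have intmin: "integrable M (\<lambda>\<omega>. min \<bar>f n \<omega> - g' \<omega>\<bar> (1 / e))"
        using e by (intro integrable_const_bound[where B = "1 / e"]) auto
      have pt: "\<bar>t\<bar> \<le> e * t\<^sup>2 + min \<bar>t\<bar> (1 / e)" for t :: real
      proof (cases "\<bar>t\<bar> \<le> 1 / e")
        case True
        then show ?thesis using e by simp
      next
        case False
        then have "1 \<le> e * \<bar>t\<bar>" using e by (simp add: field_simps)
        then have "1 * \<bar>t\<bar> \<le> e * \<bar>t\<bar> * \<bar>t\<bar>" by (intro mult_right_mono) auto
        then have "\<bar>t\<bar> \<le> e * t\<^sup>2" by (simp add: power2_eq_square mult.assoc)
        moreover have "0 \<le> min \<bar>t\<bar> (1 / e)" using e by simp
        ultimately show ?thesis by linarith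
      qed
      have sq: "(a - b)\<^sup>2 \<le> 2 * a\<^sup>2 + 2 * b\<^sup>2" for a b :: real
        using square_sum_le[of a "- b"] by simp
      have "expectation (\<lambda>\<omega>. \<bar>f n \<omega> - g' \<omega>\<bar>)
          \<le> expectation (\<lambda>\<omega>. e * (2 * (f n \<omega>)\<^sup>2 + 2 * (g' \<omega>)\<^sup>2) + min \<bar>f n \<omega> - g' \<omega>\<bar> (1 / e))"
      proof (rule integral_mono[OF intD])
        show "integrable M (\<lambda>\<omega>. e * (2 * (f n \<omega>)\<^sup>2 + 2 * (g' \<omega>)\<^sup>2) + min \<bar>f n \<omega> - g' \<omega>\<bar> (1 / e))"
          using int intg2 intmin by simp
        show "\<bar>f n \<omega> - g' \<omega>\<bar> \<le> e * (2 * (f n \<omega>)\<^sup>2 + 2 * (g' \<omega>)\<^sup>2) + min \<bar>f n \<omega> - g' \<omega>\<bar> (1 / e)" for \<omega>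
          using pt[of "f n \<omega> - g' \<omega>"] mult_left_mono[OF sq[of "f n \<omega>" "g' \<omega>"], of e] e by linarith
      qed
      also have "\<dots> = e * (2 * expectation (\<lambda>\<omega>. (f n \<omega>)\<^sup>2) + 2 * expectation (\<lambda>\<omega>. (g' \<omega>)\<^sup>2))
          + expectation (\<lambda>\<omega>. min \<bar>f n \<omega> - g' \<omega>\<bar> (1 / e))"
        using int intg2 intmin by simp
      also have "\<dots> < e * (2 * B + 2 * B) + r / 2"
        using N[OF n] bound[of n] Eg2 e by (intro add_le_less_mono mult_left_mono add_mono) auto
      also have "\<dots> \<le> r"
        using r B by (simp add: e_def field_simps)
      finally show ?thesis by simp
    qed
    then show "\<exists>N. \<forall>n\<ge>N. norm (expectation (\<lambda>\<omega>. \<bar>f n \<omega> - g' \<omega>\<bar>) - 0) < r" by blast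
  qed
  moreover have "\<bar>expectation (f n) - expectation g'\<bar> \<le> expectation (\<lambda>\<omega>. \<bar>f n \<omega> - g' \<omega>\<bar>)" for n
    using integral_abs_bound[of M "\<lambda>\<omega>. f n \<omega> - g' \<omega>"] intf intg by simp
  ultimately have "(\<lambda>n. expectation (f n) - expectation g') \<longlonglongrightarrow> 0"
    by - (rule Lim_null_comparison[rotated], assumption, simp)
  then have "(\<lambda>n. expectation (f n)) \<longlonglongrightarrow> expectation g'"
    by (rule LIM_zero_cancel)
  moreover have nn: "AE \<omega> in M. 0 \<le> g' \<omega>"
    using gg' nonneg by eventually_elim simp
  moreover have "0 \<le> expectation g'" using nn by (rule integral_nonneg_AE)
  moreover have "(\<integral>\<^sup>+\<omega>. ennreal (g \<omega>) \<partial>M) = ennreal (expectation g')"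
  proof -
    have "AE \<omega> in M. ennreal (g \<omega>) = ennreal (g' \<omega>)"
      using gg' by eventually_elim simp
    then have "(\<integral>\<^sup>+\<omega>. ennreal (g \<omega>) \<partial>M) = (\<integral>\<^sup>+\<omega>. ennreal (g' \<omega>) \<partial>M)"
      by (rule nn_integral_cong_AE)
    then show ?thesis using nn_integral_eq_integral[OF intg nn] by simp
  qed
  ultimately show thesis using that by blast
qed

section \<open>Expected cost of a reflected random walk\<close>

text \<open>
  A walk in the band whose increments have the first two moments of \<open>\<mu> * \<delta> + \<sigma> * (W (s + \<delta>) - W s)\<close> and
  a fourth moment of the same order as that of this increment.
\<close>
locale reflected_random_walk = prob_space M for M :: "'a measure" +
  fixes G :: "nat \<Rightarrow> 'a measure" and \<xi> :: "nat \<Rightarrow> 'a \<Rightarrow> real"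
    and d u x \<mu> \<sigma> \<delta> c :: real
  assumes band: "d < u" and x: "x \<in> {d..u}" and \<delta>: "0 < \<delta>" "\<delta> \<le> 1"
    and sub: "\<And>i. subalgebra M (G i)" and sub_Suc: "\<And>i. subalgebra (G (Suc i)) (G i)"
    and adapted: "\<And>i. \<xi> i \<in> borel_measurable (G (Suc i))"
    and indep: "\<And>i. indep_set (sets (G i)) {\<xi> i -` B \<inter> space M | B. B \<in> sets borel}"
    and integrable4: "\<And>i. integrable M (\<lambda>\<omega>. \<xi> i \<omega> ^ 4)"
    and moment1: "\<And>i. expectation (\<xi> i) = \<mu> * \<delta>"
    and moment2: "\<And>i. expectation (\<lambda>\<omega>. (\<xi> i \<omega>)\<^sup>2) = \<sigma>\<^sup>2 * \<delta> + \<mu>\<^sup>2 * \<delta>\<^sup>2"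
    and moment4: "\<And>i. expectation (\<lambda>\<omega>. \<xi> i \<omega> ^ 4) \<le> c * \<delta>\<^sup>2"
begin

definition Z :: "nat \<Rightarrow> 'a \<Rightarrow> real" where
  "Z i \<omega> = band_walk d u x (\<lambda>i. \<xi> i \<omega>) i"

definition push :: "nat \<Rightarrow> 'a \<Rightarrow> real" where
  "push i \<omega> = lower_push d u x (\<lambda>i. \<xi> i \<omega>) i + upper_push d u x (\<lambda>i. \<xi> i \<omega>) i"

definition low_step :: "nat \<Rightarrow> 'a \<Rightarrow> real" where
  "low_step i \<omega> = max 0 (d - (Z i \<omega> + \<xi> i \<omega>))"

definition upp_step :: "nat \<Rightarrow> 'a \<Rightarrow> real" where
  "upp_step i \<omega> = max 0 (Z i \<omega> + \<xi> i \<omega> - u)"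

lemma Z_Suc: "Z (Suc i) \<omega> = max d (min u (Z i \<omega> + \<xi> i \<omega>))"
  by (simp add: Z_def)

lemma Z_0: "Z 0 \<omega> = x"
  by (simp add: Z_def)

lemma lower_push_eq: "lower_push d u x (\<lambda>i. \<xi> i \<omega>) n = (\<Sum>i<n. low_step i \<omega>)"
  by (simp add: lower_push_def low_step_def Z_def)

lemma upper_push_eq: "upper_push d u x (\<lambda>i. \<xi> i \<omega>) n = (\<Sum>i<n. upp_step i \<omega>)"
  by (simp add: upper_push_def upp_step_def Z_def)

lemma push_eq: "push n \<omega> = (\<Sum>i<n. low_step i \<omega> + upp_step i \<omega>)"
  by (simp add: push_def lower_push_eq upper_push_eq sum.distrib)

lemma Z_mem: "Z i \<omega> \<in> {d..u}"
  unfolding Z_def using band x by (intro band_walk_mem) auto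

lemma \<xi>_measurable [measurable]: "\<xi> i \<in> borel_measurable M"
  using measurable_from_subalg[OF sub adapted] .

lemma Z_adapted: "Z i \<in> borel_measurable (G i)"
proof (induction i)
  case 0
  then show ?case by (simp add: Z_0[abs_def])
next
  case (Suc i)
  have [measurable]: "Z i \<in> borel_measurable (G (Suc i))" "\<xi> i \<in> borel_measurable (G (Suc i))"
    using measurable_from_subalg[OF sub_Suc Suc] adapted by auto
  show ?case unfolding Z_Suc[abs_def] by measurable
qed

lemma Z_measurable [measurable]: "Z i \<in> borel_measurable M"
  using measurable_from_subalg[OF sub Z_adapted] .

lemma steps_adapted:
  "low_step i \<in> borel_measurable (G (Suc i))" "upp_step i \<in> borel_measurable (G (Suc i))"
proof -
  have [measurable]: "Z i \<in> borel_measurable (G (Suc i))" "\<xi> i \<in> borel_measurable (G (Suc i))"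
    using measurable_from_subalg[OF sub_Suc Z_adapted] adapted by auto
  show "low_step i \<in> borel_measurable (G (Suc i))" "upp_step i \<in> borel_measurable (G (Suc i))"
    unfolding low_step_def[abs_def] upp_step_def[abs_def] by measurable
qed

lemma steps_measurable [measurable]:
  "low_step i \<in> borel_measurable M" "upp_step i \<in> borel_measurable M"
  using measurable_from_subalg[OF sub] steps_adapted by blast+

lemma push_measurable [measurable]: "push i \<in> borel_measurable M"
  unfolding push_eq[abs_def] by measurable

lemma push_adapted: "push i \<in> borel_measurable (G i)"
proof (induction i)
  case 0
  then show ?case by (simp add: push_eq[abs_def])
next
  case (Suc i)
  have [measurable]: "push i \<in> borel_measurable (G (Suc i))"
    "low_step i \<in> borel_measurable (G (Suc i))" "upp_step i \<in> borel_measurable (G (Suc i))"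
    using measurable_from_subalg[OF sub_Suc Suc] steps_adapted by auto
  have "push (Suc i) = (\<lambda>\<omega>. push i \<omega> + (low_step i \<omega> + upp_step i \<omega>))"
    by (simp add: push_eq[abs_def])
  then show ?case by simp
qed

lemma steps_bound: "0 \<le> low_step i \<omega>" "0 \<le> upp_step i \<omega>" "low_step i \<omega> + upp_step i \<omega> \<le> \<bar>\<xi> i \<omega>\<bar>"
  using Z_mem[of i \<omega>] unfolding low_step_def upp_step_def by (auto simp: max_def)

lemma push_nonneg: "0 \<le> push n \<omega>"
  unfolding push_eq using steps_bound by (intro sum_nonneg add_nonneg_nonneg)

lemma integrable2 [simp]: "integrable M (\<lambda>\<omega>. (\<xi> i \<omega>)\<^sup>2)"
  using integrable4[of i] by - (rule square_integrable_imp_integrable, simp_all flip: power_mult)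

lemma integrable1 [simp]: "integrable M (\<xi> i)"
  by (rule square_integrable_imp_integrable) simp_all

lemma integrable_steps [simp]: "integrable M (low_step i)" "integrable M (upp_step i)"
proof -
  have "norm (low_step i \<omega>) \<le> norm (\<xi> i \<omega>)" "norm (upp_step i \<omega>) \<le> norm (\<xi> i \<omega>)" for \<omega>
    using steps_bound[of i \<omega>] by auto
  then show "integrable M (low_step i)" "integrable M (upp_step i)"
    by (auto intro!: Bochner_Integration.integrable_bound[OF integrable1[of i]])
qed

lemma indep_product:
  assumes f: "f \<in> borel_measurable (G i)" "integrable M f"
    and g: "g \<in> borel_measurable borel" "integrable M (\<lambda>\<omega>. g (\<xi> i \<omega>))"
  shows "integrable M (\<lambda>\<omega>. f \<omega> * g (\<xi> i \<omega>) :: real)"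
    "expectation (\<lambda>\<omega>. f \<omega> * g (\<xi> i \<omega>)) = expectation f * expectation (\<lambda>\<omega>. g (\<xi> i \<omega>))"
proof -
  have space: "space (G i) = space M" using sub[of i] by (simp add: subalgebra_def)
  have gm: "(\<lambda>\<omega>. g (\<xi> i \<omega>)) \<in> borel_measurable M" using g(1) by measurable
  have iset: "indep_set {f -` A \<inter> space M |A. A \<in> sets borel} {(\<lambda>\<omega>. g (\<xi> i \<omega>)) -` A \<inter> space M |A. A \<in> sets borel}"
    unfolding indep_sets2_eq
  proof (intro conjI ballI)
    show "{f -` A \<inter> space M |A. A \<in> sets borel} \<subseteq> events"
      using measurable_from_subalg[OF sub f(1)] by (auto intro: measurable_sets)
    show "{(\<lambda>\<omega>. g (\<xi> i \<omega>)) -` A \<inter> space M |A. A \<in> sets borel} \<subseteq> events"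
      using gm by (auto intro: measurable_sets)
    fix a b assume "a \<in> {f -` A \<inter> space M |A. A \<in> sets borel}"
      and "b \<in> {(\<lambda>\<omega>. g (\<xi> i \<omega>)) -` A \<inter> space M |A. A \<in> sets borel}"
    then obtain A B where AB: "a = f -` A \<inter> space M" "A \<in> sets borel"
      "b = \<xi> i -` (g -` B) \<inter> space M" "B \<in> sets borel" by auto
    have "a \<in> sets (G i)" using measurable_sets[OF f(1) AB(2)] AB(1) space by simp
    moreover have "g -` B \<in> sets borel" using measurable_sets[OF g(1) AB(4)] by simp
    then have "b \<in> {\<xi> i -` B \<inter> space M | B. B \<in> sets borel}" using AB(3) by blast
    ultimately show "prob (a \<inter> b) = prob a * prob b"
      using indep[of i] unfolding indep_sets2_eq by blast
  qed
  have stable: "Int_stable {h -` A \<inter> space M |A. A \<in> sets (borel :: real measure)}" for h :: "'a \<Rightarrow> real"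
  proof (rule Int_stableI)
    fix a b assume "a \<in> {h -` A \<inter> space M |A. A \<in> sets borel}" "b \<in> {h -` A \<inter> space M |A. A \<in> sets borel}"
    then obtain A B where "A \<in> sets borel" "B \<in> sets borel" "a \<inter> b = h -` (A \<inter> B) \<inter> space M" by auto
    then show "a \<inter> b \<in> {h -` A \<inter> space M |A. A \<in> sets borel}" by blast
  qed
  have "indep_var borel f borel (\<lambda>\<omega>. g (\<xi> i \<omega>))"
    unfolding indep_var_eq
    using measurable_from_subalg[OF sub f(1)] gm indep_set_sigma_sets[OF iset stable stable] by blast
  then show "integrable M (\<lambda>\<omega>. f \<omega> * g (\<xi> i \<omega>))"
    "expectation (\<lambda>\<omega>. f \<omega> * g (\<xi> i \<omega>)) = expectation f * expectation (\<lambda>\<omega>. g (\<xi> i \<omega>))"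
    using f g indep_var_integrable indep_var_lebesgue_integral by blast+
qed

lemma moment2_le: "expectation (\<lambda>\<omega>. (\<xi> i \<omega>)\<^sup>2) \<le> (\<sigma>\<^sup>2 + \<mu>\<^sup>2) * \<delta>"
proof -
  have "\<mu>\<^sup>2 * \<delta>\<^sup>2 \<le> \<mu>\<^sup>2 * \<delta>"
    using \<delta> by (intro mult_left_mono) (auto simp: power2_eq_square mult_left_le)
  then show ?thesis by (simp add: moment2 algebra_simps)
qed

lemma moment4_le: "expectation (\<lambda>\<omega>. \<xi> i \<omega> ^ 4) \<le> c * \<delta>" and c_nonneg: "0 \<le> c"
proof -
  have "0 \<le> expectation (\<lambda>\<omega>. \<xi> i \<omega> ^ 4)" by simp
  then have "0 \<le> c * \<delta>\<^sup>2" using moment4[of i] by linarith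
  then show c: "0 \<le> c" using \<delta> by (simp add: zero_le_mult_iff)
  have "c * \<delta>\<^sup>2 \<le> c * \<delta>"
    using \<delta> c by (intro mult_left_mono) (auto simp: power2_eq_square mult_left_le)
  then show "expectation (\<lambda>\<omega>. \<xi> i \<omega> ^ 4) \<le> c * \<delta>" using moment4[of i] by simp
qed

text \<open>
  The rate in the discrete Gronwall estimate for the second moment of \<open>Q\<close> below. It does not depend on
  the time step.
\<close>
definition growth_rate :: real where
  "growth_rate = 2 * (2 * \<bar>\<mu>\<bar> * (u - d) + \<sigma>\<^sup>2 + \<mu>\<^sup>2) + 8 * (u - d)\<^sup>2 * (\<sigma>\<^sup>2 + \<mu>\<^sup>2) + 2 * c"

text \<open>
  A Lyapunov function: by \<open>reflected_step_square\<close> it grows in each step by at most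
  \<open>2 * (Z - m) * \<xi> + \<xi>\<^sup>2\<close>, where \<open>m\<close> is the centre of the band. Summing \<open>\<bar>\<xi>\<bar>\<close> would bound the pushes as well,
  but that bound explodes as the mesh shrinks.
\<close>
definition Q :: "nat \<Rightarrow> 'a \<Rightarrow> real" where
  "Q i \<omega> = (u - d) * push i \<omega> + (Z i \<omega> - (d + u) / 2)\<^sup>2"

lemma Q_nonneg: "0 \<le> Q i \<omega>"
  unfolding Q_def using band push_nonneg by (intro add_nonneg_nonneg mult_nonneg_nonneg) auto

lemma push_le_Q: "(u - d) * push i \<omega> \<le> Q i \<omega>"
  unfolding Q_def by simp

lemma Q_adapted: "Q i \<in> borel_measurable (G i)"
  unfolding Q_def[abs_def] using push_adapted[of i] Z_adapted[of i] by measurable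

lemma Q_measurable [measurable]: "Q i \<in> borel_measurable M"
  unfolding Q_def[abs_def] by measurable

lemma Z_centre_bound: "\<bar>Z i \<omega> - (d + u) / 2\<bar> \<le> u - d"
  using Z_mem[of i \<omega>] by (auto simp: field_simps abs_le_iff)

lemma Q_Suc_le:
  "Q (Suc i) \<omega> \<le> Q i \<omega> + (2 * (Z i \<omega> - (d + u) / 2) * \<xi> i \<omega> + (\<xi> i \<omega>)\<^sup>2)"
proof -
  have "push (Suc i) \<omega> = push i \<omega> + (low_step i \<omega> + upp_step i \<omega>)" by (simp add: push_eq)
  moreover have "(Z i \<omega> + \<xi> i \<omega> - (d + u) / 2)\<^sup>2
      = (Z i \<omega> - (d + u) / 2)\<^sup>2 + (2 * (Z i \<omega> - (d + u) / 2) * \<xi> i \<omega> + (\<xi> i \<omega>)\<^sup>2)"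
    by (simp add: power2_eq_square algebra_simps)
  moreover have "(Z (Suc i) \<omega> - (d + u) / 2)\<^sup>2 + (u - d) * (low_step i \<omega> + upp_step i \<omega>)
      \<le> (Z i \<omega> + \<xi> i \<omega> - (d + u) / 2)\<^sup>2"
    unfolding Z_Suc low_step_def upp_step_def using band Z_mem by (rule reflected_step_square)
  ultimately show ?thesis unfolding Q_def by (simp add: distrib_left)
qed

text \<open>
  The bound for the increment of \<open>Q\<close> has conditional mean and second moment of order \<open>\<delta>\<close>, so squaring and taking
  expectations costs a factor \<open>1 + growth_rate * \<delta>\<close>.
\<close>
lemma Q_second_moment_step:
  assumes int: "integrable M (\<lambda>\<omega>. (Q i \<omega>)\<^sup>2)"
  shows "integrable M (\<lambda>\<omega>. (Q (Suc i) \<omega>)\<^sup>2)"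
    "expectation (\<lambda>\<omega>. (Q (Suc i) \<omega>)\<^sup>2) + 1 \<le> (1 + growth_rate * \<delta>) * (expectation (\<lambda>\<omega>. (Q i \<omega>)\<^sup>2) + 1)"
proof -
  define m where "m = (d + u) / 2"
  define D where "D \<omega> = 2 * (Z i \<omega> - m) * \<xi> i \<omega> + (\<xi> i \<omega>)\<^sup>2" for \<omega>
  have [measurable]: "D \<in> borel_measurable M" unfolding D_def[abs_def] by measurable
  have ZG [measurable]: "Z i \<in> borel_measurable (G i)" "Q i \<in> borel_measurable (G i)"
    using Z_adapted Q_adapted by auto
  have intQ: "integrable M (Q i)" by (rule square_integrable_imp_integrable) (use int in auto)
  have D2: "(D \<omega>)\<^sup>2 \<le> 8 * (u - d)\<^sup>2 * (\<xi> i \<omega>)\<^sup>2 + 2 * \<xi> i \<omega> ^ 4" for \<omega>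
  proof -
    have "(D \<omega>)\<^sup>2 \<le> 2 * (2 * (Z i \<omega> - m) * \<xi> i \<omega>)\<^sup>2 + 2 * ((\<xi> i \<omega>)\<^sup>2)\<^sup>2"
      unfolding D_def by (rule square_sum_le)
    also have "\<dots> = 8 * (Z i \<omega> - m)\<^sup>2 * (\<xi> i \<omega>)\<^sup>2 + 2 * \<xi> i \<omega> ^ 4"
    proof -
      have "2 * (2 * a * b)\<^sup>2 + 2 * (b\<^sup>2)\<^sup>2 = 8 * a\<^sup>2 * b\<^sup>2 + 2 * b ^ 4" for a b :: real
        by (simp add: power2_eq_square power4_eq_xxxx algebra_simps)
      then show ?thesis .
    qed
    also have "\<dots> \<le> 8 * (u - d)\<^sup>2 * (\<xi> i \<omega>)\<^sup>2 + 2 * \<xi> i \<omega> ^ 4"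
      using power_mono[OF Z_centre_bound[of i \<omega>], of 2]
      unfolding m_def by (intro add_mono mult_right_mono) auto
    finally show ?thesis .
  qed
  have intD2: "integrable M (\<lambda>\<omega>. (D \<omega>)\<^sup>2)"
    by (rule Bochner_Integration.integrable_bound[where f = "\<lambda>\<omega>. 8 * (u - d)\<^sup>2 * (\<xi> i \<omega>)\<^sup>2 + 2 * \<xi> i \<omega> ^ 4"])
      (use D2 integrable4[of i] in \<open>auto intro!: always_eventually order_trans[OF _ abs_ge_self]\<close>)
  have ED2: "expectation (\<lambda>\<omega>. (D \<omega>)\<^sup>2) \<le> (8 * (u - d)\<^sup>2 * (\<sigma>\<^sup>2 + \<mu>\<^sup>2) + 2 * c) * \<delta>"
  proof -
    have "expectation (\<lambda>\<omega>. (D \<omega>)\<^sup>2) \<le> expectation (\<lambda>\<omega>. 8 * (u - d)\<^sup>2 * (\<xi> i \<omega>)\<^sup>2 + 2 * \<xi> i \<omega> ^ 4)"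
      using D2 integrable4[of i] intD2 by (intro integral_mono) auto
    also have "\<dots> = 8 * (u - d)\<^sup>2 * expectation (\<lambda>\<omega>. (\<xi> i \<omega>)\<^sup>2) + 2 * expectation (\<lambda>\<omega>. \<xi> i \<omega> ^ 4)"
      using integrable4[of i] by simp
    also have "\<dots> \<le> 8 * (u - d)\<^sup>2 * ((\<sigma>\<^sup>2 + \<mu>\<^sup>2) * \<delta>) + 2 * (c * \<delta>)"
      using moment2_le[of i] moment4_le[of i] by (intro add_mono mult_left_mono) auto
    finally show ?thesis by (simp add: algebra_simps)
  qed
  have QZ_le: "\<bar>Q i \<omega> * (Z i \<omega> - m)\<bar> \<le> (u - d) * Q i \<omega>" for \<omega>
    using mult_right_mono[OF Z_centre_bound[of i \<omega>] Q_nonneg[of i \<omega>]] Q_nonneg[of i \<omega>]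
    by (simp add: abs_mult m_def mult.commute)
  have QZ: "integrable M (\<lambda>\<omega>. Q i \<omega> * (Z i \<omega> - m))"
    by (rule Bochner_Integration.integrable_bound[where f = "\<lambda>\<omega>. (u - d) * Q i \<omega>"])
      (use intQ QZ_le in \<open>auto intro!: always_eventually order_trans[OF _ abs_ge_self]\<close>)
  have QZG: "(\<lambda>\<omega>. Q i \<omega> * (Z i \<omega> - m)) \<in> borel_measurable (G i)" by measurable
  note p1 = indep_product[OF QZG QZ, of "\<lambda>y. y", simplified]
  note p2 = indep_product[OF ZG(2) intQ, of "\<lambda>y. y\<^sup>2", simplified]
  have QD_eq: "Q i \<omega> * D \<omega> = 2 * (Q i \<omega> * (Z i \<omega> - m) * \<xi> i \<omega>) + Q i \<omega> * (\<xi> i \<omega>)\<^sup>2" for \<omega>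
    unfolding D_def by (simp add: algebra_simps)
  have intQD: "integrable M (\<lambda>\<omega>. Q i \<omega> * D \<omega>)"
    unfolding QD_eq using p1(1) p2(1) by simp
  have EQ0: "0 \<le> expectation (Q i)" using Q_nonneg by simp
  have "\<bar>expectation (\<lambda>\<omega>. Q i \<omega> * (Z i \<omega> - m))\<bar> \<le> (u - d) * expectation (Q i)"
  proof -
    have "\<bar>expectation (\<lambda>\<omega>. Q i \<omega> * (Z i \<omega> - m))\<bar> \<le> expectation (\<lambda>\<omega>. \<bar>Q i \<omega> * (Z i \<omega> - m)\<bar>)"
      by (rule integral_abs_bound)
    also have "\<dots> \<le> expectation (\<lambda>\<omega>. (u - d) * Q i \<omega>)"
      using QZ intQ QZ_le by (intro integral_mono) auto
    finally show ?thesis by simp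
  qed
  note abs_le = this
  have b1: "expectation (\<lambda>\<omega>. Q i \<omega> * (Z i \<omega> - m)) * (\<mu> * \<delta>) \<le> ((u - d) * expectation (Q i)) * (\<bar>\<mu>\<bar> * \<delta>)"
  proof -
    have "expectation (\<lambda>\<omega>. Q i \<omega> * (Z i \<omega> - m)) * (\<mu> * \<delta>)
        \<le> \<bar>expectation (\<lambda>\<omega>. Q i \<omega> * (Z i \<omega> - m)) * (\<mu> * \<delta>)\<bar>" by (rule abs_ge_self)
    also have "\<dots> = \<bar>expectation (\<lambda>\<omega>. Q i \<omega> * (Z i \<omega> - m))\<bar> * (\<bar>\<mu>\<bar> * \<delta>)"
      using \<delta> by (simp add: abs_mult)
    also have "\<dots> \<le> ((u - d) * expectation (Q i)) * (\<bar>\<mu>\<bar> * \<delta>)"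
      using abs_le \<delta> by (intro mult_right_mono) auto
    finally show ?thesis .
  qed
  have b2: "expectation (Q i) * expectation (\<lambda>\<omega>. (\<xi> i \<omega>)\<^sup>2) \<le> expectation (Q i) * ((\<sigma>\<^sup>2 + \<mu>\<^sup>2) * \<delta>)"
    using moment2_le EQ0 by (intro mult_left_mono)
  have EQ: "expectation (Q i) \<le> expectation (\<lambda>\<omega>. (Q i \<omega>)\<^sup>2) + 1"
  proof -
    have "expectation (Q i) \<le> expectation (\<lambda>\<omega>. (Q i \<omega>)\<^sup>2 + 1)"
      using intQ int le_square_plus_one by (intro integral_mono) auto
    then show ?thesis using int by (simp add: prob_space)
  qed
  have "expectation (\<lambda>\<omega>. Q i \<omega> * D \<omega>)
      = 2 * (expectation (\<lambda>\<omega>. Q i \<omega> * (Z i \<omega> - m)) * (\<mu> * \<delta>)) + expectation (Q i) * expectation (\<lambda>\<omega>. (\<xi> i \<omega>)\<^sup>2)"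
    unfolding QD_eq using p1 p2 by (simp add: moment1)
  also have "\<dots> \<le> (2 * \<bar>\<mu>\<bar> * (u - d) + \<sigma>\<^sup>2 + \<mu>\<^sup>2) * \<delta> * expectation (Q i)"
    using b1 b2 by (simp add: algebra_simps)
  also have "\<dots> \<le> (2 * \<bar>\<mu>\<bar> * (u - d) + \<sigma>\<^sup>2 + \<mu>\<^sup>2) * \<delta> * (expectation (\<lambda>\<omega>. (Q i \<omega>)\<^sup>2) + 1)"
    using EQ \<delta> band by (intro mult_left_mono) auto
  finally have EQD: "expectation (\<lambda>\<omega>. Q i \<omega> * D \<omega>)
      \<le> (2 * \<bar>\<mu>\<bar> * (u - d) + \<sigma>\<^sup>2 + \<mu>\<^sup>2) * \<delta> * (expectation (\<lambda>\<omega>. (Q i \<omega>)\<^sup>2) + 1)" .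
  have sq_le: "(Q (Suc i) \<omega>)\<^sup>2 \<le> (Q i \<omega>)\<^sup>2 + 2 * (Q i \<omega> * D \<omega>) + (D \<omega>)\<^sup>2" for \<omega>
  proof -
    have "(Q (Suc i) \<omega>)\<^sup>2 \<le> (Q i \<omega> + D \<omega>)\<^sup>2"
      using Q_Suc_le[of i \<omega>] Q_nonneg[of "Suc i" \<omega>] unfolding D_def m_def by (intro power_mono) auto
    then show ?thesis by (simp add: power2_sum algebra_simps)
  qed
  show int': "integrable M (\<lambda>\<omega>. (Q (Suc i) \<omega>)\<^sup>2)"
    by (rule Bochner_Integration.integrable_bound[where f = "\<lambda>\<omega>. (Q i \<omega>)\<^sup>2 + 2 * (Q i \<omega> * D \<omega>) + (D \<omega>)\<^sup>2"])
      (use int intQD intD2 sq_le in \<open>auto intro!: always_eventually order_trans[OF _ abs_ge_self]\<close>)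
  have "expectation (\<lambda>\<omega>. (Q (Suc i) \<omega>)\<^sup>2) \<le> expectation (\<lambda>\<omega>. (Q i \<omega>)\<^sup>2 + 2 * (Q i \<omega> * D \<omega>) + (D \<omega>)\<^sup>2)"
    using int int' intQD intD2 sq_le by (intro integral_mono) auto
  also have "\<dots> = expectation (\<lambda>\<omega>. (Q i \<omega>)\<^sup>2) + 2 * expectation (\<lambda>\<omega>. Q i \<omega> * D \<omega>) + expectation (\<lambda>\<omega>. (D \<omega>)\<^sup>2)"
    using int intQD intD2 by simp
  also have "\<dots> \<le> expectation (\<lambda>\<omega>. (Q i \<omega>)\<^sup>2)
      + 2 * ((2 * \<bar>\<mu>\<bar> * (u - d) + \<sigma>\<^sup>2 + \<mu>\<^sup>2) * \<delta> * (expectation (\<lambda>\<omega>. (Q i \<omega>)\<^sup>2) + 1))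
      + (8 * (u - d)\<^sup>2 * (\<sigma>\<^sup>2 + \<mu>\<^sup>2) + 2 * c) * \<delta> * (expectation (\<lambda>\<omega>. (Q i \<omega>)\<^sup>2) + 1)"
  proof -
    have "(8 * (u - d)\<^sup>2 * (\<sigma>\<^sup>2 + \<mu>\<^sup>2) + 2 * c) * \<delta> * 1
        \<le> (8 * (u - d)\<^sup>2 * (\<sigma>\<^sup>2 + \<mu>\<^sup>2) + 2 * c) * \<delta> * (expectation (\<lambda>\<omega>. (Q i \<omega>)\<^sup>2) + 1)"
      using \<delta> c_nonneg by (intro mult_left_mono) auto
    then show ?thesis using ED2 EQD by linarith
  qed
  finally show "expectation (\<lambda>\<omega>. (Q (Suc i) \<omega>)\<^sup>2) + 1 \<le> (1 + growth_rate * \<delta>) * (expectation (\<lambda>\<omega>. (Q i \<omega>)\<^sup>2) + 1)"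
    unfolding growth_rate_def by (simp add: algebra_simps)
qed

lemma growth_rate_nonneg: "0 \<le> growth_rate"
  unfolding growth_rate_def using band c_nonneg by auto

lemma Q_second_moment:
  assumes "real n * \<delta> \<le> T"
  shows "integrable M (\<lambda>\<omega>. (Q n \<omega>)\<^sup>2)"
  "expectation (\<lambda>\<omega>. (Q n \<omega>)\<^sup>2) \<le> exp (growth_rate * T) * ((u - d) ^ 4 + 1)"
proof -
  have "integrable M (\<lambda>\<omega>. (Q n \<omega>)\<^sup>2) \<and>
    expectation (\<lambda>\<omega>. (Q n \<omega>)\<^sup>2) + 1 \<le> (1 + growth_rate * \<delta>) ^ n * ((u - d) ^ 4 + 1)"
  proof (induction n)
    case 0
    have "\<bar>x - (d + u) / 2\<bar> ^ 4 \<le> (u - d) ^ 4"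
      using Z_centre_bound[of 0] by (intro power_mono) (auto simp: Z_0)
    then show ?case by (simp add: Q_def[abs_def] Z_0 push_eq prob_space flip: power_mult)
  next
    case (Suc n)
    have "expectation (\<lambda>\<omega>. (Q (Suc n) \<omega>)\<^sup>2) + 1 \<le> (1 + growth_rate * \<delta>) * (expectation (\<lambda>\<omega>. (Q n \<omega>)\<^sup>2) + 1)"
      using Q_second_moment_step Suc by blast
    also have "\<dots> \<le> (1 + growth_rate * \<delta>) * ((1 + growth_rate * \<delta>) ^ n * ((u - d) ^ 4 + 1))"
      using Suc growth_rate_nonneg \<delta> by (intro mult_left_mono) auto
    finally show ?case using Q_second_moment_step(1) Suc by (simp add: mult.assoc)
  qed
  moreover have "(1 + growth_rate * \<delta>) ^ n * ((u - d) ^ 4 + 1) \<le> exp (growth_rate * T) * ((u - d) ^ 4 + 1)"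
  proof -
    have "(1 + growth_rate * \<delta>) ^ n \<le> exp (growth_rate * \<delta>) ^ n"
      using growth_rate_nonneg \<delta> by (intro power_mono) auto
    also have "\<dots> = exp (growth_rate * (n * \<delta>))"
      by (simp add: exp_of_nat_mult[symmetric] mult.commute mult.left_commute)
    also have "\<dots> \<le> exp (growth_rate * T)"
      using assms growth_rate_nonneg by (simp add: mult_left_mono)
    finally show ?thesis using band by (intro mult_right_mono) auto
  qed
  ultimately show "integrable M (\<lambda>\<omega>. (Q n \<omega>)\<^sup>2)"
    "expectation (\<lambda>\<omega>. (Q n \<omega>)\<^sup>2) \<le> exp (growth_rate * T) * ((u - d) ^ 4 + 1)"
    by auto
qed

text \<open>
  \<open>f\<close> is arbitrary outside the band, so it is composed with the projection onto the band.
\<close>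
lemma continuous_band_measurable:
  assumes "continuous_on {d..u} f"
  shows "(\<lambda>\<omega>. f (Z i \<omega>)) \<in> borel_measurable (G i)"
proof -
  have "continuous_on UNIV (\<lambda>z. f (max d (min u z)))"
    using band by (intro continuous_on_compose2[OF assms] continuous_intros) auto
  then have [measurable]: "(\<lambda>z. f (max d (min u z))) \<in> borel_measurable borel"
    by (rule borel_measurable_continuous_onI)
  have "max d (min u (Z i \<omega>)) = Z i \<omega>" for \<omega>
    using Z_mem[of i \<omega>] by auto
  moreover have "(\<lambda>\<omega>. f (max d (min u (Z i \<omega>)))) \<in> borel_measurable (G i)"
    by (rule measurable_compose[OF Z_adapted]) measurable
  ultimately show ?thesis by simp
qed

lemma continuous_band_integrable:
  assumes "continuous_on {d..u} f"
  shows "integrable M (\<lambda>\<omega>. f (Z i \<omega>) :: real)"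
proof -
  obtain B where "\<And>z. z \<in> {d..u} \<Longrightarrow> \<bar>f z\<bar> \<le> B"
    using continuous_on_Icc_bounded[OF assms] by blast
  then show ?thesis
    using Z_mem[of i] measurable_from_subalg[OF sub continuous_band_measurable[OF assms]]
    by (intro integrable_const_bound[where B = B]) auto
qed

definition cost :: "real \<Rightarrow> real \<Rightarrow> (real \<Rightarrow> real) \<Rightarrow> nat \<Rightarrow> 'a \<Rightarrow> real" where
  "cost k l h n \<omega> = k * lower_push d u x (\<lambda>i. \<xi> i \<omega>) n + l * upper_push d u x (\<lambda>i. \<xi> i \<omega>) n + \<delta> * (\<Sum>i<n. h (Z i \<omega>))"

lemma cost_eq: "cost k l h n \<omega> = (\<Sum>i<n. k * low_step i \<omega> + l * upp_step i \<omega> + \<delta> * h (Z i \<omega>))"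
  by (simp add: cost_def lower_push_eq upper_push_eq sum.distrib sum_distrib_left)

lemma cost_integrable:
  assumes "continuous_on {d..u} h"
  shows "integrable M (cost k l h n)"
  unfolding cost_eq[abs_def] using continuous_band_integrable[OF assms] by simp

lemma push_integrable: "integrable M (push n)"
  unfolding push_eq[abs_def] by simp

lemma expected_push_le:
  assumes "real n * \<delta> \<le> T"
  shows "expectation (push n) \<le> (exp (growth_rate * T) * ((u - d) ^ 4 + 1) + 1) / (u - d)"
proof -
  note Q2 = Q_second_moment[OF assms]
  have "(u - d) * expectation (push n) = expectation (\<lambda>\<omega>. (u - d) * push n \<omega>)" by simp
  also have "\<dots> \<le> expectation (\<lambda>\<omega>. (Q n \<omega>)\<^sup>2 + 1)"
    using push_integrable Q2(1) order_trans[OF push_le_Q le_square_plus_one] by (intro integral_mono) auto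
  also have "\<dots> \<le> exp (growth_rate * T) * ((u - d) ^ 4 + 1) + 1"
    using Q2 by (simp add: prob_space)
  finally show ?thesis using band by (simp add: field_simps)
qed

lemma cost_second_moment:
  assumes h: "continuous_on {d..u} h" "\<And>z. z \<in> {d..u} \<Longrightarrow> 0 \<le> h z" "\<And>z. z \<in> {d..u} \<Longrightarrow> h z \<le> H"
    and H: "0 \<le> H" and kl: "0 \<le> k" "0 \<le> l" and c0: "0 \<le> c0" and T: "real n * \<delta> \<le> T"
  shows "integrable M (\<lambda>\<omega>. (c0 + cost k l h n \<omega>)\<^sup>2)"
    "expectation (\<lambda>\<omega>. (c0 + cost k l h n \<omega>)\<^sup>2)
      \<le> 2 * (c0 + H * T)\<^sup>2 + 2 * ((k + l) / (u - d))\<^sup>2 * (exp (growth_rate * T) * ((u - d) ^ 4 + 1))"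
proof -
  define \<kappa> where "\<kappa> = (k + l) / (u - d)"
  have \<kappa>: "0 \<le> \<kappa>" using kl band by (simp add: \<kappa>_def)
  have meas: "cost k l h n \<in> borel_measurable M"
    using cost_integrable[OF h(1)] by (rule borel_measurable_integrable)
  note Q2 = Q_second_moment[OF T]
  have bnd: "0 \<le> c0 + cost k l h n \<omega>" "c0 + cost k l h n \<omega> \<le> (c0 + H * T) + \<kappa> * Q n \<omega>" for \<omega>
  proof -
    have pos: "0 \<le> lower_push d u x (\<lambda>i. \<xi> i \<omega>) n" "0 \<le> upper_push d u x (\<lambda>i. \<xi> i \<omega>) n"
      "0 \<le> (\<Sum>i<n. h (Z i \<omega>))"
      using h(2) Z_mem by (auto simp: lower_push_def upper_push_def intro!: sum_nonneg)
    show "0 \<le> c0 + cost k l h n \<omega>"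
      unfolding cost_def using pos c0 kl \<delta> by simp
    have "(\<Sum>i<n. h (Z i \<omega>)) \<le> of_nat (card {..<n}) * H"
      using h(3) Z_mem by (intro sum_bounded_above) blast
    then have "\<delta> * (\<Sum>i<n. h (Z i \<omega>)) \<le> \<delta> * (real n * H)"
      using \<delta> by (intro mult_left_mono) auto
    also have "\<dots> = H * (real n * \<delta>)" by simp
    also have "\<dots> \<le> H * T" using H T by (intro mult_left_mono)
    finally have hold: "\<delta> * (\<Sum>i<n. h (Z i \<omega>)) \<le> H * T" .
    have "k * lower_push d u x (\<lambda>i. \<xi> i \<omega>) n + l * upper_push d u x (\<lambda>i. \<xi> i \<omega>) n \<le> (k + l) * push n \<omega>"
      unfolding push_def using pos kl by (simp add: algebra_simps)
    also have "\<dots> = \<kappa> * ((u - d) * push n \<omega>)" using band by (simp add: \<kappa>_def)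
    also have "\<dots> \<le> \<kappa> * Q n \<omega>"
      using \<kappa> push_le_Q by (rule mult_left_mono[rotated])
    finally show "c0 + cost k l h n \<omega> \<le> (c0 + H * T) + \<kappa> * Q n \<omega>"
      unfolding cost_def using hold by simp
  qed
  have sq: "(c0 + cost k l h n \<omega>)\<^sup>2 \<le> 2 * (c0 + H * T)\<^sup>2 + 2 * \<kappa>\<^sup>2 * (Q n \<omega>)\<^sup>2" for \<omega>
  proof -
    have "(c0 + cost k l h n \<omega>)\<^sup>2 \<le> ((c0 + H * T) + \<kappa> * Q n \<omega>)\<^sup>2"
      using bnd by (intro power_mono)
    also have "\<dots> \<le> 2 * (c0 + H * T)\<^sup>2 + 2 * (\<kappa> * Q n \<omega>)\<^sup>2" by (rule square_sum_le)
    finally show ?thesis by (simp add: power_mult_distrib mult.assoc)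
  qed
  show int: "integrable M (\<lambda>\<omega>. (c0 + cost k l h n \<omega>)\<^sup>2)"
    by (rule Bochner_Integration.integrable_bound[where f = "\<lambda>\<omega>. 2 * (c0 + H * T)\<^sup>2 + 2 * \<kappa>\<^sup>2 * (Q n \<omega>)\<^sup>2"])
      (use Q2(1) sq meas in \<open>auto intro!: always_eventually order_trans[OF _ abs_ge_self]\<close>)
  have "expectation (\<lambda>\<omega>. (c0 + cost k l h n \<omega>)\<^sup>2) \<le> expectation (\<lambda>\<omega>. 2 * (c0 + H * T)\<^sup>2 + 2 * \<kappa>\<^sup>2 * (Q n \<omega>)\<^sup>2)"
    using int Q2(1) sq by (intro integral_mono) auto
  also have "\<dots> = 2 * (c0 + H * T)\<^sup>2 + 2 * \<kappa>\<^sup>2 * expectation (\<lambda>\<omega>. (Q n \<omega>)\<^sup>2)"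
    using Q2(1) by (simp add: prob_space)
  also have "\<dots> \<le> 2 * (c0 + H * T)\<^sup>2 + 2 * \<kappa>\<^sup>2 * (exp (growth_rate * T) * ((u - d) ^ 4 + 1))"
    using Q2(2) by (intro add_left_mono mult_left_mono) auto
  finally show "expectation (\<lambda>\<omega>. (c0 + cost k l h n \<omega>)\<^sup>2)
      \<le> 2 * (c0 + H * T)\<^sup>2 + 2 * ((k + l) / (u - d))\<^sup>2 * (exp (growth_rate * T) * ((u - d) ^ 4 + 1))"
    by (simp add: \<kappa>_def)
qed

text \<open>
  Ito's formula in the mean over one step: replacing \<open>\<xi>\<close> and \<open>\<xi>\<^sup>2\<close> by their means in the Taylor expansion
  turns its first- and second-order terms into \<open>\<delta>\<close> times the generator applied to \<open>V\<close>, which is \<open>\<gamma> - h\<close>, plus a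
  term of order \<open>\<delta>\<^sup>2\<close> coming from the square of the drift.
\<close>
lemma expected_step:
  assumes V: "C2_on {d..u} V V' V''" and h: "continuous_on {d..u} h"
    and ode: "\<And>z. z \<in> {d..u} \<Longrightarrow> (1 / 2 * \<sigma>\<^sup>2 * V'' z + \<mu> * V' z) + h z = \<gamma>"
    and B: "\<And>z. z \<in> {d..u} \<Longrightarrow> \<bar>V'' z\<bar> \<le> B"
    and C: "0 \<le> C"
    and taylor: "\<And>z x p q. z \<in> {d..u} \<Longrightarrow> p = max 0 (d - (z + x)) \<Longrightarrow> q = max 0 (z + x - u) \<Longrightarrow>
      \<bar>V (max d (min u (z + x))) - V z + k * p + l * q - V' z * x - 1 / 2 * V'' z * x\<^sup>2\<bar>
       \<le> e * (x\<^sup>2 + p + q) + C * x ^ 4"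
    and e: "0 \<le> e"
  shows "\<bar>expectation (\<lambda>\<omega>. V (Z (Suc i) \<omega>) - V (Z i \<omega>) + k * low_step i \<omega> + l * upp_step i \<omega> + \<delta> * h (Z i \<omega>)) - \<gamma> * \<delta>\<bar>
    \<le> e * ((\<sigma>\<^sup>2 + \<mu>\<^sup>2) * \<delta> + expectation (\<lambda>\<omega>. low_step i \<omega> + upp_step i \<omega>)) + (C * c + B * \<mu>\<^sup>2) * \<delta>\<^sup>2"
proof -
  have cont: "continuous_on {d..u} V" "continuous_on {d..u} V'" "continuous_on {d..u} V''"
    using V unfolding C2_on_def by (auto intro!: DERIV_continuous_on)
  have int: "integrable M (\<lambda>\<omega>. V (Z j \<omega>))" "integrable M (\<lambda>\<omega>. V' (Z j \<omega>))"
    "integrable M (\<lambda>\<omega>. V'' (Z j \<omega>))" "integrable M (\<lambda>\<omega>. h (Z j \<omega>))" for j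
    using continuous_band_integrable cont h by blast+
  note p1 = indep_product[OF continuous_band_measurable[OF cont(2)] int(2), of "\<lambda>y. y" i, simplified]
  note p2 = indep_product[OF continuous_band_measurable[OF cont(3)] int(3), of "\<lambda>y. y\<^sup>2" i, simplified]
  define R where "R \<omega> = V (Z (Suc i) \<omega>) - V (Z i \<omega>) + k * low_step i \<omega> + l * upp_step i \<omega>
      - V' (Z i \<omega>) * \<xi> i \<omega> - 1 / 2 * (V'' (Z i \<omega>) * (\<xi> i \<omega>)\<^sup>2)" for \<omega>
  have intR: "integrable M R"
    unfolding R_def[abs_def] using int p1 p2 by simp
  have R: "\<bar>R \<omega>\<bar> \<le> e * ((\<xi> i \<omega>)\<^sup>2 + low_step i \<omega> + upp_step i \<omega>) + C * \<xi> i \<omega> ^ 4" for \<omega>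
    using taylor[OF Z_mem[of i \<omega>] low_step_def[of i \<omega>] upp_step_def[of i \<omega>]]
    unfolding R_def Z_Suc by (simp add: mult.assoc)
  have "\<bar>expectation R\<bar> \<le> expectation (\<lambda>\<omega>. \<bar>R \<omega>\<bar>)"
    by (rule integral_abs_bound)
  also have "\<dots> \<le> expectation (\<lambda>\<omega>. e * ((\<xi> i \<omega>)\<^sup>2 + low_step i \<omega> + upp_step i \<omega>) + C * \<xi> i \<omega> ^ 4)"
    using intR R integrable4[of i] by (intro integral_mono) auto
  also have "\<dots> = e * (expectation (\<lambda>\<omega>. (\<xi> i \<omega>)\<^sup>2) + expectation (\<lambda>\<omega>. low_step i \<omega> + upp_step i \<omega>))
      + C * expectation (\<lambda>\<omega>. \<xi> i \<omega> ^ 4)"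
    using integrable4[of i] by simp
  also have "\<dots> \<le> e * ((\<sigma>\<^sup>2 + \<mu>\<^sup>2) * \<delta> + expectation (\<lambda>\<omega>. low_step i \<omega> + upp_step i \<omega>)) + C * (c * \<delta>\<^sup>2)"
    using e C moment2_le[of i] moment4[of i] by (intro add_mono mult_left_mono) auto
  finally have ER: "\<bar>expectation R\<bar>
      \<le> e * ((\<sigma>\<^sup>2 + \<mu>\<^sup>2) * \<delta> + expectation (\<lambda>\<omega>. low_step i \<omega> + upp_step i \<omega>)) + C * (c * \<delta>\<^sup>2)" .
  have "(\<lambda>\<omega>. V (Z (Suc i) \<omega>) - V (Z i \<omega>) + k * low_step i \<omega> + l * upp_step i \<omega> + \<delta> * h (Z i \<omega>))
      = (\<lambda>\<omega>. R \<omega> + V' (Z i \<omega>) * \<xi> i \<omega> + 1 / 2 * (V'' (Z i \<omega>) * (\<xi> i \<omega>)\<^sup>2) + \<delta> * h (Z i \<omega>))"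
    by (rule ext) (simp add: R_def)
  then have "expectation (\<lambda>\<omega>. V (Z (Suc i) \<omega>) - V (Z i \<omega>) + k * low_step i \<omega> + l * upp_step i \<omega> + \<delta> * h (Z i \<omega>))
      = expectation R + expectation (\<lambda>\<omega>. V' (Z i \<omega>)) * (\<mu> * \<delta>)
        + 1 / 2 * (expectation (\<lambda>\<omega>. V'' (Z i \<omega>)) * (\<sigma>\<^sup>2 * \<delta> + \<mu>\<^sup>2 * \<delta>\<^sup>2)) + \<delta> * expectation (\<lambda>\<omega>. h (Z i \<omega>))"
    using int intR p1 p2 by (simp add: moment1 moment2)
  also have "\<dots> = expectation R + 1 / 2 * \<mu>\<^sup>2 * \<delta>\<^sup>2 * expectation (\<lambda>\<omega>. V'' (Z i \<omega>))
      + \<delta> * (1 / 2 * \<sigma>\<^sup>2 * expectation (\<lambda>\<omega>. V'' (Z i \<omega>)) + \<mu> * expectation (\<lambda>\<omega>. V' (Z i \<omega>)) + expectation (\<lambda>\<omega>. h (Z i \<omega>)))"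
    by (simp add: algebra_simps)
  also have "1 / 2 * \<sigma>\<^sup>2 * expectation (\<lambda>\<omega>. V'' (Z i \<omega>)) + \<mu> * expectation (\<lambda>\<omega>. V' (Z i \<omega>)) + expectation (\<lambda>\<omega>. h (Z i \<omega>))
      = expectation (\<lambda>\<omega>. (1 / 2 * \<sigma>\<^sup>2 * V'' (Z i \<omega>) + \<mu> * V' (Z i \<omega>)) + h (Z i \<omega>))"
    using int by simp
  also have "\<dots> = \<gamma>"
    using ode[OF Z_mem] by (simp add: prob_space)
  finally have eq: "expectation (\<lambda>\<omega>. V (Z (Suc i) \<omega>) - V (Z i \<omega>) + k * low_step i \<omega> + l * upp_step i \<omega> + \<delta> * h (Z i \<omega>)) - \<gamma> * \<delta>
      = expectation R + 1 / 2 * \<mu>\<^sup>2 * \<delta>\<^sup>2 * expectation (\<lambda>\<omega>. V'' (Z i \<omega>))"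
    by (simp add: algebra_simps)
  have "\<bar>expectation (\<lambda>\<omega>. V'' (Z i \<omega>))\<bar> \<le> expectation (\<lambda>\<omega>. \<bar>V'' (Z i \<omega>)\<bar>)"
    by (rule integral_abs_bound)
  also have "\<dots> \<le> expectation (\<lambda>_. B)"
    using int B[OF Z_mem] by (intro integral_mono) auto
  finally have EV: "\<bar>expectation (\<lambda>\<omega>. V'' (Z i \<omega>))\<bar> \<le> B" by (simp add: prob_space)
  have "\<bar>1 / 2 * \<mu>\<^sup>2 * \<delta>\<^sup>2 * expectation (\<lambda>\<omega>. V'' (Z i \<omega>))\<bar> \<le> 1 / 2 * \<mu>\<^sup>2 * \<delta>\<^sup>2 * B"
    using mult_left_mono[OF EV, of "1 / 2 * \<mu>\<^sup>2 * \<delta>\<^sup>2"] by (simp add: abs_mult)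
  also have "\<dots> \<le> \<mu>\<^sup>2 * \<delta>\<^sup>2 * B"
    using EV by (simp add: mult_right_mono)
  finally show ?thesis
    unfolding eq using ER abs_triangle_ineq[of "expectation R" "1 / 2 * \<mu>\<^sup>2 * \<delta>\<^sup>2 * expectation (\<lambda>\<omega>. V'' (Z i \<omega>))"]
    by (simp add: algebra_simps)
qed

lemma expected_cost:
  assumes V: "C2_on {d..u} V V' V''" and h: "continuous_on {d..u} h"
    and ode: "\<And>z. z \<in> {d..u} \<Longrightarrow> (1 / 2 * \<sigma>\<^sup>2 * V'' z + \<mu> * V' z) + h z = \<gamma>"
    and B: "\<And>z. z \<in> {d..u} \<Longrightarrow> \<bar>V'' z\<bar> \<le> B"
    and C: "0 \<le> C"
    and taylor: "\<And>z x p q. z \<in> {d..u} \<Longrightarrow> p = max 0 (d - (z + x)) \<Longrightarrow> q = max 0 (z + x - u) \<Longrightarrow>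
      \<bar>V (max d (min u (z + x))) - V z + k * p + l * q - V' z * x - 1 / 2 * V'' z * x\<^sup>2\<bar>
       \<le> e * (x\<^sup>2 + p + q) + C * x ^ 4"
    and e: "0 \<le> e"
  shows "\<bar>expectation (cost k l h n) + expectation (\<lambda>\<omega>. V (Z n \<omega>)) - V x - \<gamma> * (n * \<delta>)\<bar>
    \<le> e * ((\<sigma>\<^sup>2 + \<mu>\<^sup>2) * (n * \<delta>) + expectation (push n)) + (C * c + B * \<mu>\<^sup>2) * \<delta> * (n * \<delta>)"
proof (induction n)
  case 0
  have "cost k l h 0 = (\<lambda>_. 0)" "push 0 = (\<lambda>_. 0)" by (auto simp: cost_eq push_eq)
  then show ?case by (simp add: Z_0 prob_space)
next
  case (Suc n)
  have "continuous_on {d..u} V"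
    using V unfolding C2_on_def by (auto intro!: DERIV_continuous_on)
  then have int: "integrable M (\<lambda>\<omega>. V (Z j \<omega>))" "integrable M (\<lambda>\<omega>. h (Z j \<omega>))" for j
    using continuous_band_integrable h by blast+
  have "cost k l h (Suc n) = (\<lambda>\<omega>. cost k l h n \<omega> + (k * low_step n \<omega> + l * upp_step n \<omega> + \<delta> * h (Z n \<omega>)))"
    by (simp add: cost_eq[abs_def])
  then have c: "expectation (cost k l h (Suc n)) + expectation (\<lambda>\<omega>. V (Z (Suc n) \<omega>))
    = expectation (cost k l h n) + expectation (\<lambda>\<omega>. V (Z n \<omega>))
      + expectation (\<lambda>\<omega>. V (Z (Suc n) \<omega>) - V (Z n \<omega>) + k * low_step n \<omega> + l * upp_step n \<omega> + \<delta> * h (Z n \<omega>))"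
    using cost_integrable[OF h, of k l n] int by simp
  have "push (Suc n) = (\<lambda>\<omega>. push n \<omega> + (low_step n \<omega> + upp_step n \<omega>))"
    by (simp add: push_eq[abs_def])
  then have p: "expectation (push (Suc n)) = expectation (push n) + expectation (\<lambda>\<omega>. low_step n \<omega> + upp_step n \<omega>)"
    using push_integrable by simp
  have split: "\<gamma> * (real (Suc n) * \<delta>) = \<gamma> * (real n * \<delta>) + \<gamma> * \<delta>"
    "e * ((\<sigma>\<^sup>2 + \<mu>\<^sup>2) * (real (Suc n) * \<delta>) + (expectation (push n) + expectation (\<lambda>\<omega>. low_step n \<omega> + upp_step n \<omega>)))
        + (C * c + B * \<mu>\<^sup>2) * \<delta> * (real (Suc n) * \<delta>)
      = (e * ((\<sigma>\<^sup>2 + \<mu>\<^sup>2) * (n * \<delta>) + expectation (push n)) + (C * c + B * \<mu>\<^sup>2) * \<delta> * (n * \<delta>))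
        + (e * ((\<sigma>\<^sup>2 + \<mu>\<^sup>2) * \<delta> + expectation (\<lambda>\<omega>. low_step n \<omega> + upp_step n \<omega>)) + (C * c + B * \<mu>\<^sup>2) * \<delta>\<^sup>2)"
    by (simp_all add: algebra_simps power2_eq_square)
  show ?case
    unfolding p c split using Suc.IH expected_step[OF V h ode B C taylor e, of n] by linarith
qed

end

section \<open>Brownian motion in the band\<close>

locale controlled_brownian_motion = prob_space M for M :: "'a measure" +
  fixes F :: "real \<Rightarrow> 'a measure" and W :: "real \<Rightarrow> 'a \<Rightarrow> real" and \<mu> \<sigma> d u :: real
  assumes filt: "filtration (space M) F" and subF: "\<And>t. t \<ge> 0 \<Longrightarrow> subalgebra M (F t)"
    and bm: "standard_brownian_motion M F W" and \<sigma>: "0 < \<sigma>" and band: "d < u"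
begin

definition dyadic_step :: "nat \<Rightarrow> nat \<Rightarrow> 'a \<Rightarrow> real" where
  "dyadic_step n i \<omega> = \<mu> * (1 / 2 ^ n) + \<sigma> * (W (real (Suc i) / 2 ^ n) \<omega> - W (real i / 2 ^ n) \<omega>)"

text \<open>
  The fourth moment of a Gaussian increment over time \<open>\<delta>\<close> is \<open>3 * \<delta>\<^sup>2\<close>, and
  \<open>(a + b) ^ 4 \<le> 8 * a ^ 4 + 8 * b ^ 4\<close>; this explains the constant.
\<close>
lemma dyadic_walk:
  assumes p: "p \<in> {d..u}"
  shows "reflected_random_walk M (\<lambda>i. F (real i / 2 ^ n)) (dyadic_step n) d u p \<mu> \<sigma> (1 / 2 ^ n) (8 * \<mu> ^ 4 + 24 * \<sigma> ^ 4)"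
proof unfold_locales
  define \<delta> :: real where "\<delta> = 1 / 2 ^ n"
  have \<delta>: "0 < \<delta>" "\<delta> \<le> 1" by (auto simp: \<delta>_def)
  show "d < u" "p \<in> {d..u}" by (fact band p)+
  show "0 < (1::real) / 2 ^ n" "(1::real) / 2 ^ n \<le> 1" using \<delta> by (auto simp: \<delta>_def)
  fix i :: nat
  define s where "s = real i / 2 ^ n"
  define t where "t = real (Suc i) / 2 ^ n"
  have st: "0 \<le> s" "s < t" "t - s = \<delta>"
    by (auto simp: s_def t_def \<delta>_def divide_strict_right_mono add_divide_distrib)
  define X where "X \<omega> = W t \<omega> - W s \<omega>" for \<omega>
  have step: "dyadic_step n i = (\<lambda>\<omega>. \<mu> * \<delta> + \<sigma> * X \<omega>)"
    by (simp add: dyadic_step_def[abs_def] X_def s_def t_def \<delta>_def)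
  show "subalgebra M (F (real i / 2 ^ n))"
    using subF[OF st(1)] by (simp add: s_def)
  have subst: "subalgebra (F t) (F s)"
    using filtration.sets_F_mono[OF filt, of s t] filtration.space_F[OF filt] st by (simp add: subalgebra_def)
  then show "subalgebra (F (real (Suc i) / 2 ^ n)) (F (real i / 2 ^ n))"
    by (simp add: s_def t_def)
  have Wm: "W t \<in> borel_measurable (F t)" "W s \<in> borel_measurable (F s)"
    using bm st unfolding standard_brownian_motion_def by auto
  have [measurable]: "W t \<in> borel_measurable (F t)" "W s \<in> borel_measurable (F t)"
    using Wm measurable_from_subalg[OF subst] by auto
  have "dyadic_step n i \<in> borel_measurable (F t)"
    unfolding step X_def by measurable
  then show "dyadic_step n i \<in> borel_measurable (F (real (Suc i) / 2 ^ n))"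
    by (simp add: t_def)
  have D: "distributed M lborel X (\<lambda>y. ennreal (normal_density 0 (sqrt \<delta>) y))"
    and ind: "indep_set (sets (F s)) {X -` B \<inter> space M | B. B \<in> sets borel}"
    using bm st unfolding standard_brownian_motion_def X_def[abs_def] by auto
  have "indep_set (sets (F s)) {dyadic_step n i -` B \<inter> space M | B. B \<in> sets borel}"
  proof -
    have "{dyadic_step n i -` B \<inter> space M | B. B \<in> sets borel} \<subseteq> {X -` B \<inter> space M | B. B \<in> sets borel}"
    proof
      fix a assume "a \<in> {dyadic_step n i -` B \<inter> space M | B. B \<in> sets borel}"
      then obtain B where B: "a = dyadic_step n i -` B \<inter> space M" "B \<in> sets borel" by blast
      have "(\<lambda>y::real. \<mu> * \<delta> + \<sigma> * y) -` B \<in> sets borel"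
        using measurable_sets[of "\<lambda>y::real. \<mu> * \<delta> + \<sigma> * y" borel borel B] B(2) by simp
      moreover have "a = X -` ((\<lambda>y. \<mu> * \<delta> + \<sigma> * y) -` B) \<inter> space M"
        unfolding B(1) step by auto
      ultimately show "a \<in> {X -` B \<inter> space M | B. B \<in> sets borel}" by blast
    qed
    with ind show ?thesis by (rule indep_set_mono_right)
  qed
  then show "indep_set (sets (F (real i / 2 ^ n))) {dyadic_step n i -` B \<inter> space M | B. B \<in> sets borel}"
    by (simp add: s_def)
  have sq: "0 < sqrt \<delta>" using \<delta> by simp
  note mom = centred_normal_moments[OF D sq]
  have "(sqrt \<delta>) ^ 4 = ((sqrt \<delta>)\<^sup>2)\<^sup>2" by (simp flip: power_mult)
  then have s4: "(sqrt \<delta>) ^ 4 = \<delta>\<^sup>2" using \<delta> by simp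
  have int: "integrable M X" "integrable M (\<lambda>\<omega>. (X \<omega>)\<^sup>2)" "integrable M (\<lambda>\<omega>. X \<omega> ^ 4)"
    using mom(1)[of 1] mom(1)[of 2] mom(1)[of 4] by simp_all
  have [measurable]: "X \<in> borel_measurable M" using int(1) by auto
  have le: "(\<mu> * \<delta> + \<sigma> * X \<omega>) ^ 4 \<le> 8 * (\<mu> * \<delta>) ^ 4 + 8 * \<sigma> ^ 4 * X \<omega> ^ 4" for \<omega>
    using fourth_power_sum_le[of "\<mu> * \<delta>" "\<sigma> * X \<omega>"] by (simp add: power_mult_distrib)
  have int4: "integrable M (\<lambda>\<omega>. (\<mu> * \<delta> + \<sigma> * X \<omega>) ^ 4)"
    by (rule Bochner_Integration.integrable_bound[where f = "\<lambda>\<omega>. 8 * (\<mu> * \<delta>) ^ 4 + 8 * \<sigma> ^ 4 * X \<omega> ^ 4"])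
      (use int le in \<open>auto intro!: always_eventually order_trans[OF _ abs_ge_self]\<close>)
  then show "integrable M (\<lambda>\<omega>. dyadic_step n i \<omega> ^ 4)" by (simp add: step)
  show "expectation (dyadic_step n i) = \<mu> * (1 / 2 ^ n)"
    using int mom(2) by (simp add: step prob_space \<delta>_def)
  have "(\<lambda>\<omega>. (\<mu> * \<delta> + \<sigma> * X \<omega>)\<^sup>2) = (\<lambda>\<omega>. (\<mu> * \<delta>)\<^sup>2 + 2 * \<mu> * \<delta> * \<sigma> * X \<omega> + \<sigma>\<^sup>2 * (X \<omega>)\<^sup>2)"
    by (simp add: power2_eq_square algebra_simps)
  then have "expectation (\<lambda>\<omega>. (\<mu> * \<delta> + \<sigma> * X \<omega>)\<^sup>2) = (\<mu> * \<delta>)\<^sup>2 + \<sigma>\<^sup>2 * \<delta>"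
    using int mom(2,3) \<delta> by (simp add: prob_space)
  then show "expectation (\<lambda>\<omega>. (dyadic_step n i \<omega>)\<^sup>2) = \<sigma>\<^sup>2 * (1 / 2 ^ n) + \<mu>\<^sup>2 * (1 / 2 ^ n)\<^sup>2"
    by (simp add: step \<delta>_def[symmetric] power_mult_distrib)
  have "expectation (\<lambda>\<omega>. (\<mu> * \<delta> + \<sigma> * X \<omega>) ^ 4) \<le> expectation (\<lambda>\<omega>. 8 * (\<mu> * \<delta>) ^ 4 + 8 * \<sigma> ^ 4 * X \<omega> ^ 4)"
    using int4 int le by (intro integral_mono) auto
  also have "\<dots> = 8 * \<mu> ^ 4 * \<delta> ^ 4 + 24 * \<sigma> ^ 4 * \<delta>\<^sup>2"
    using int mom(4) by (simp add: prob_space s4 power_mult_distrib)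
  also have "\<dots> \<le> 8 * \<mu> ^ 4 * \<delta>\<^sup>2 + 24 * \<sigma> ^ 4 * \<delta>\<^sup>2"
    using \<delta> by (intro add_right_mono mult_left_mono power_decreasing) auto
  finally show "expectation (\<lambda>\<omega>. dyadic_step n i \<omega> ^ 4) \<le> (8 * \<mu> ^ 4 + 24 * \<sigma> ^ 4) * (1 / 2 ^ n)\<^sup>2"
    by (simp add: step \<delta>_def algebra_simps)
qed

lemma AE_band_path:
  assumes p: "p \<in> {d..u}"
  shows "AE \<omega> in M. band_path d u (\<lambda>s. uncontrolled \<mu> \<sigma> W p s \<omega>) \<and> uncontrolled \<mu> \<sigma> W p 0 \<omega> = p"
proof -
  have "AE \<omega> in M. W 0 \<omega> = 0 \<and> continuous_on {0..} (\<lambda>t. W t \<omega>)"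
    using bm unfolding standard_brownian_motion_def by blast
  then show ?thesis
  proof eventually_elim
    case (elim \<omega>)
    then have "continuous_on {0..} (\<lambda>s. uncontrolled \<mu> \<sigma> W p s \<omega>)"
      unfolding uncontrolled_def by (auto intro!: continuous_intros)
    then show ?case
      using elim p band by (auto simp: band_path_def uncontrolled_def)
  qed
qed

lemma grid_step_uncontrolled:
  "grid_step (\<lambda>s. uncontrolled \<mu> \<sigma> W p s \<omega>) n = (\<lambda>i. dyadic_step n i \<omega>)"
  by (rule ext) (simp add: grid_step_def uncontrolled_def dyadic_step_def field_simps)

text \<open>
  The walks on the dyadic grids have mean cost \<open>c0 + \<gamma> * t\<close> up to twice the bound of \<open>V\<close> and a vanishing error,
  by \<open>expected_cost\<close>; the costs converge almost surely and their second moments are bounded, so the same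
  holds for the limit.
\<close>
lemma expected_cost_near_linear:
  assumes V: "C2_on {d..u} V V' V''" and bc: "V' d = - k" "V' u = l"
    and ode: "\<And>z. z \<in> {d..u} \<Longrightarrow> (1 / 2 * \<sigma>\<^sup>2 * V'' z + \<mu> * V' z) + h z = \<gamma>"
    and h: "continuous_on {d..u} h" "\<And>z. z \<in> {d..u} \<Longrightarrow> 0 \<le> h z"
    and kl: "0 \<le> k" "0 \<le> l" and c0: "0 \<le> c0"
    and A: "\<And>z. z \<in> {d..u} \<Longrightarrow> \<bar>V z\<bar> \<le> A"
    and p: "p \<in> {d..u}" and t: "0 \<le> t"
  obtains L where "0 \<le> L" "\<bar>L - \<gamma> * t\<bar> \<le> 2 * A + c0"
    "(\<integral>\<^sup>+ \<omega>. (\<integral>\<^sup>+ s\<in>{0..t}. ennreal (h (uncontrolled \<mu> \<sigma> W p s \<omega>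
          + Psi1 d u (\<lambda>s. uncontrolled \<mu> \<sigma> W p s \<omega>) s - Psi2 d u (\<lambda>s. uncontrolled \<mu> \<sigma> W p s \<omega>) s)) \<partial>lborel)
        + ennreal (c0 + k * Psi1 d u (\<lambda>s. uncontrolled \<mu> \<sigma> W p s \<omega>) t + l * Psi2 d u (\<lambda>s. uncontrolled \<mu> \<sigma> W p s \<omega>) t) \<partial>M)
     = ennreal L"
proof -
  define path where "path \<omega> = (\<lambda>s. uncontrolled \<mu> \<sigma> W p s \<omega>)" for \<omega>
  define N where "N n = grid_index n t" for n
  define \<delta> :: "nat \<Rightarrow> real" where "\<delta> n = 1 / 2 ^ n" for n
  \<comment> \<open>The constant in the fourth moments of the steps, from \<open>dyadic_walk\<close>.\<close>
  define c where "c = 8 * \<mu> ^ 4 + 24 * \<sigma> ^ 4"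
  define C where "C n \<omega> = c0 + (k * lower_push d u p (\<lambda>i. dyadic_step n i \<omega>) (N n)
      + l * upper_push d u p (\<lambda>i. dyadic_step n i \<omega>) (N n)
      + \<delta> n * (\<Sum>i<N n. h (band_walk d u p (\<lambda>i. dyadic_step n i \<omega>) i)))" for n \<omega>
  define I where "I \<omega> = (\<integral>\<^sup>+ s\<in>{0..t}. ennreal (h (path \<omega> s + Psi1 d u (path \<omega>) s - Psi2 d u (path \<omega>) s)) \<partial>lborel)" for \<omega>
  define g where "g \<omega> = c0 + (k * Psi1 d u (path \<omega>) t + l * Psi2 d u (path \<omega>) t + enn2real (I \<omega>))" for \<omega>
  note walk = dyadic_walk[OF p, folded \<delta>_def c_def]
  have N: "real (N n) * \<delta> n \<le> t" "t - \<delta> n < real (N n) * \<delta> n" for n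
    using grid_index_le[OF t, of n] grid_index_ge[of t n] by (simp_all add: N_def \<delta>_def)
  have \<delta>: "0 < \<delta> n" "\<delta> n \<le> 1" for n by (auto simp: \<delta>_def)
  have \<delta>_lim: "\<delta> \<longlonglongrightarrow> 0"
    using LIMSEQ_realpow_zero[of "1 / 2 :: real"] by (simp add: \<delta>_def[abs_def] power_divide)
  have N_lim: "(\<lambda>n. real (N n) * \<delta> n) \<longlonglongrightarrow> t"
  proof (rule tendsto_sandwich)
    show "(\<lambda>n. t - \<delta> n) \<longlonglongrightarrow> t"
      using tendsto_diff[OF tendsto_const \<delta>_lim, of t] by simp
    show "\<forall>\<^sub>F n in sequentially. t - \<delta> n \<le> real (N n) * \<delta> n" "\<forall>\<^sub>F n in sequentially. real (N n) * \<delta> n \<le> t"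
      using N less_imp_le by (intro always_eventually; blast)+
  qed (rule tendsto_const)
  have band_limit: "AE \<omega> in M. (\<lambda>n. C n \<omega>) \<longlonglongrightarrow> g \<omega> \<and> 0 \<le> g \<omega> \<and>
      I \<omega> + ennreal (c0 + k * Psi1 d u (path \<omega>) t + l * Psi2 d u (path \<omega>) t) = ennreal (g \<omega>)"
    using AE_band_path[OF p]
  proof eventually_elim
    case (elim \<omega>)
    interpret band_path d u "path \<omega>" using elim by (simp add: path_def)
    have start_p: "path \<omega> 0 = p" using elim by (simp add: path_def)
    have grid: "grid_step (path \<omega>) n = (\<lambda>i. dyadic_step n i \<omega>)" for n
      unfolding path_def by (rule grid_step_uncontrolled)
    have lev: "limit_level s = path \<omega> s + Psi1 d u (path \<omega>) s - Psi2 d u (path \<omega>) s" if "0 \<le> s" for s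
      using that by (simp add: limit_level_eq Psi1_eq Psi2_eq)
    obtain J where J: "0 \<le> J" "(\<lambda>n. 1 / 2 ^ n * (\<Sum>i<grid_index n t. h (band_walk d u (path \<omega> 0) (grid_step (path \<omega>) n) i))) \<longlonglongrightarrow> J"
      "(\<integral>\<^sup>+ s\<in>{0..t}. ennreal (h (limit_level s)) \<partial>lborel) = ennreal J"
      using holding_cost_tendsto[OF h t] by blast
    have "I \<omega> = (\<integral>\<^sup>+ s\<in>{0..t}. ennreal (h (limit_level s)) \<partial>lborel)"
      unfolding I_def by (intro nn_integral_cong) (auto simp: indicator_def lev)
    then have I: "I \<omega> = ennreal J" "enn2real (I \<omega>) = J" using J by simp_all
    have lim: "(\<lambda>n. lower_push d u p (\<lambda>i. dyadic_step n i \<omega>) (N n)) \<longlonglongrightarrow> Psi1 d u (path \<omega>) t"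
      "(\<lambda>n. upper_push d u p (\<lambda>i. dyadic_step n i \<omega>) (N n)) \<longlonglongrightarrow> Psi2 d u (path \<omega>) t"
      using low_tendsto[OF t] upp_tendsto[OF t] t
      by (simp_all add: low_def upp_def grid start_p N_def Psi1_eq Psi2_eq)
    have "(\<lambda>n. C n \<omega>) \<longlonglongrightarrow> g \<omega>"
      unfolding C_def g_def I(2) using lim J(2)
      by (intro tendsto_intros) (simp_all add: grid start_p N_def \<delta>_def)
    moreover have "0 \<le> Psi1 d u (path \<omega>) t" "0 \<le> Psi2 d u (path \<omega>) t"
      using lim by (auto intro!: LIMSEQ_le_const simp: lower_push_def upper_push_def sum_nonneg)
    then have nn: "0 \<le> c0 + k * Psi1 d u (path \<omega>) t + l * Psi2 d u (path \<omega>) t"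
      using kl c0 by simp
    ultimately show ?case
      using J(1) kl c0 by (simp add: g_def I ac_simps flip: ennreal_plus)
  qed
  obtain H where H: "0 < H" "\<And>z. z \<in> {d..u} \<Longrightarrow> \<bar>h z\<bar> \<le> H"
    using continuous_on_Icc_bounded[OF h(1)] by blast
  have "continuous_on {d..u} V''" using V unfolding C2_on_def by blast
  then obtain B where B: "0 < B" "\<And>z. z \<in> {d..u} \<Longrightarrow> \<bar>V'' z\<bar> \<le> B"
    using continuous_on_Icc_bounded by blast
  \<comment> \<open>The growth rate of the walks, which is the same on all grids.\<close>
  define rate where "rate = 2 * (2 * \<bar>\<mu>\<bar> * (u - d) + \<sigma>\<^sup>2 + \<mu>\<^sup>2) + 8 * (u - d)\<^sup>2 * (\<sigma>\<^sup>2 + \<mu>\<^sup>2) + 2 * c"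
  define K where "K = exp (rate * t) * ((u - d) ^ 4 + 1)"
  have moments: "C n \<in> borel_measurable M \<and> integrable M (\<lambda>\<omega>. (C n \<omega>)\<^sup>2) \<and>
      expectation (\<lambda>\<omega>. (C n \<omega>)\<^sup>2) \<le> 2 * (c0 + H * t)\<^sup>2 + 2 * ((k + l) / (u - d))\<^sup>2 * K" for n
  proof -
    interpret R: reflected_random_walk M "\<lambda>i. F (real i / 2 ^ n)" "dyadic_step n" d u p \<mu> \<sigma> "\<delta> n" c
      by (rule walk)
    have C_eq: "C n = (\<lambda>\<omega>. c0 + R.cost k l h (N n) \<omega>)"
      by (simp add: C_def[abs_def] R.cost_def R.Z_def)
    have "C n \<in> borel_measurable M"
      unfolding C_eq using R.cost_integrable[OF h(1), of k l "N n"] by measurable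
    moreover have "h z \<le> H" if "z \<in> {d..u}" for z using H(2)[OF that] by simp
    note R.cost_second_moment[OF h this less_imp_le[OF H(1)] kl c0 N(1)]
    ultimately show ?thesis
      unfolding C_eq K_def rate_def R.growth_rate_def by blast
  qed
  define P where "P = (K + 1) / (u - d)"
  have mean: "\<bar>expectation (C n) - \<gamma> * t\<bar> \<le> c0 + 2 * A + e * ((\<sigma>\<^sup>2 + \<mu>\<^sup>2) * t + P)
        + (D * c + B * \<mu>\<^sup>2) * \<delta> n * t + \<bar>\<gamma>\<bar> * \<delta> n"
    if e: "0 < e" and D: "0 \<le> D"
      and taylor: "\<And>z x p q. z \<in> {d..u} \<Longrightarrow> p = max 0 (d - (z + x)) \<Longrightarrow> q = max 0 (z + x - u) \<Longrightarrow>
      \<bar>V (max d (min u (z + x))) - V z + k * p + l * q - V' z * x - 1 / 2 * V'' z * x\<^sup>2\<bar>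
       \<le> e * (x\<^sup>2 + p + q) + D * x ^ 4" for n e D
  proof -
    interpret R: reflected_random_walk M "\<lambda>i. F (real i / 2 ^ n)" "dyadic_step n" d u p \<mu> \<sigma> "\<delta> n" c
      by (rule walk)
    have C_eq: "C n = (\<lambda>\<omega>. c0 + R.cost k l h (N n) \<omega>)"
      by (simp add: C_def[abs_def] R.cost_def R.Z_def)
    have EC: "expectation (C n) = c0 + expectation (R.cost k l h (N n))"
      unfolding C_eq using R.cost_integrable[OF h(1), of k l "N n"] by (simp add: prob_space)
    have push: "expectation (R.push (N n)) \<le> P"
      using R.expected_push_le[OF N(1)] unfolding P_def K_def rate_def R.growth_rate_def .
    have "continuous_on {d..u} V"
      using V unfolding C2_on_def by (auto intro!: DERIV_continuous_on)
    then have intV: "integrable M (\<lambda>\<omega>. V (R.Z (N n) \<omega>))"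
      by (rule R.continuous_band_integrable)
    have "\<bar>expectation (\<lambda>\<omega>. V (R.Z (N n) \<omega>))\<bar> \<le> expectation (\<lambda>\<omega>. \<bar>V (R.Z (N n) \<omega>)\<bar>)"
      by (rule integral_abs_bound)
    also have "\<dots> \<le> expectation (\<lambda>_. A)"
      using intV A[OF R.Z_mem] by (intro integral_mono) auto
    finally have EV: "\<bar>expectation (\<lambda>\<omega>. V (R.Z (N n) \<omega>))\<bar> \<le> A" by (simp add: prob_space)
    have main: "\<bar>expectation (R.cost k l h (N n)) + expectation (\<lambda>\<omega>. V (R.Z (N n) \<omega>)) - V p - \<gamma> * (N n * \<delta> n)\<bar>
      \<le> e * ((\<sigma>\<^sup>2 + \<mu>\<^sup>2) * (N n * \<delta> n) + expectation (R.push (N n))) + (D * c + B * \<mu>\<^sup>2) * \<delta> n * (N n * \<delta> n)"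
      using e by (intro R.expected_cost[OF V h(1) ode B(2) D taylor]) auto
    have "e * ((\<sigma>\<^sup>2 + \<mu>\<^sup>2) * (N n * \<delta> n) + expectation (R.push (N n))) \<le> e * ((\<sigma>\<^sup>2 + \<mu>\<^sup>2) * t + P)"
      using e push N(1)[of n] by (intro mult_left_mono add_mono) auto
    moreover have "(D * c + B * \<mu>\<^sup>2) * \<delta> n * (N n * \<delta> n) \<le> (D * c + B * \<mu>\<^sup>2) * \<delta> n * t"
      using D B(1) R.c_nonneg \<delta>[of n] N(1)[of n] by (intro mult_left_mono) auto
    moreover have "\<bar>\<gamma> * (N n * \<delta> n) - \<gamma> * t\<bar> \<le> \<bar>\<gamma>\<bar> * \<delta> n"
    proof -
      have "\<bar>\<gamma> * (N n * \<delta> n) - \<gamma> * t\<bar> = \<bar>\<gamma>\<bar> * \<bar>N n * \<delta> n - t\<bar>"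
        by (simp flip: abs_mult add: right_diff_distrib)
      also have "\<dots> \<le> \<bar>\<gamma>\<bar> * \<delta> n"
        using N[of n] by (intro mult_left_mono) auto
      finally show ?thesis .
    qed
    ultimately show ?thesis
      using main EV A[OF p] c0 unfolding EC by linarith
  qed
  obtain L where L: "(\<lambda>n. expectation (C n)) \<longlonglongrightarrow> L" "0 \<le> L" "(\<integral>\<^sup>+\<omega>. ennreal (g \<omega>) \<partial>M) = ennreal L"
  proof (rule L2_bounded_limit[of C "2 * (c0 + H * t)\<^sup>2 + 2 * ((k + l) / (u - d))\<^sup>2 * K" g])
    show "AE \<omega> in M. (\<lambda>n. C n \<omega>) \<longlonglongrightarrow> g \<omega>" "AE \<omega> in M. 0 \<le> g \<omega>"
      using band_limit by (eventually_elim, simp)+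
  qed (use moments in auto)
  have "\<bar>L - \<gamma> * t\<bar> \<le> 2 * A + c0 + r" if r: "0 < r" for r
  proof -
    \<comment> \<open>The first error term of \<open>mean\<close> does not vanish with the mesh; it is made small by the choice of \<open>e\<close>,
               which fixes the constant \<open>D\<close> of the Taylor estimate before the mesh is refined.\<close>
    define S where "S = (\<sigma>\<^sup>2 + \<mu>\<^sup>2) * t + P"
    have "0 \<le> K" unfolding K_def using band by auto
    then have S: "0 \<le> S" unfolding S_def P_def using band t by auto
    define e where "e = r / (S + 1)"
    have e: "0 < e" "e * S \<le> r"
      using r S by (auto simp: e_def field_simps)
    obtain D where D: "0 \<le> D"
      "\<And>z x p q. z \<in> {d..u} \<Longrightarrow> p = max 0 (d - (z + x)) \<Longrightarrow> q = max 0 (z + x - u) \<Longrightarrow>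
      \<bar>V (max d (min u (z + x))) - V z + k * p + l * q - V' z * x - 1 / 2 * V'' z * x\<^sup>2\<bar>
       \<le> e * (x\<^sup>2 + p + q) + D * x ^ 4"
      using reflected_step_taylor[OF V bc e(1) band] by blast
    have "\<bar>L - \<gamma> * t\<bar> \<le> c0 + 2 * A + e * S + (D * c + B * \<mu>\<^sup>2) * 0 * t + \<bar>\<gamma>\<bar> * 0"
    proof (rule tendsto_le[OF trivial_limit_sequentially])
      show "(\<lambda>n. c0 + 2 * A + e * S + (D * c + B * \<mu>\<^sup>2) * \<delta> n * t + \<bar>\<gamma>\<bar> * \<delta> n)
          \<longlonglongrightarrow> c0 + 2 * A + e * S + (D * c + B * \<mu>\<^sup>2) * 0 * t + \<bar>\<gamma>\<bar> * 0"
        by (intro tendsto_intros \<delta>_lim)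
      show "(\<lambda>n. \<bar>expectation (C n) - \<gamma> * t\<bar>) \<longlonglongrightarrow> \<bar>L - \<gamma> * t\<bar>"
        by (intro tendsto_intros L(1))
      show "\<forall>\<^sub>F n in sequentially. \<bar>expectation (C n) - \<gamma> * t\<bar>
          \<le> c0 + 2 * A + e * S + (D * c + B * \<mu>\<^sup>2) * \<delta> n * t + \<bar>\<gamma>\<bar> * \<delta> n"
        unfolding S_def by (intro always_eventually allI mean[OF e(1) D])
    qed
    then show ?thesis using e(2) by simp
  qed
  then have bound: "\<bar>L - \<gamma> * t\<bar> \<le> 2 * A + c0" by (rule field_le_epsilon)
  have "AE \<omega> in M. I \<omega> + ennreal (c0 + k * Psi1 d u (path \<omega>) t + l * Psi2 d u (path \<omega>) t) = ennreal (g \<omega>)"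
    using band_limit by eventually_elim simp
  then have "(\<integral>\<^sup>+\<omega>. I \<omega> + ennreal (c0 + k * Psi1 d u (path \<omega>) t + l * Psi2 d u (path \<omega>) t) \<partial>M) = ennreal L"
    unfolding L(3)[symmetric] by (rule nn_integral_cong_AE)
  then show thesis
    using that[OF L(2) bound] unfolding I_def path_def by simp
qed

end

theorem theorem6p1:
  fixes M :: "'a measure" and F :: "real \<Rightarrow> 'a measure" and W :: "real \<Rightarrow> 'a \<Rightarrow> real"
    and \<mu> \<sigma> k l d u \<gamma> :: real and h V V' V'' :: "real \<Rightarrow> real"
  assumes "prob_space M"
    and "filtration (space M) F" and "\<And>t. t \<ge> 0 \<Longrightarrow> subalgebra M (F t)"
    and "standard_brownian_motion M F W"
    and "\<sigma> > 0" and "k > 0" and "l > 0"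
    and "holding_cost (2 * \<mu> / \<sigma>\<^sup>2) h"
    and "d < u"
    and "C2_on {d..u} V V' V''"
    and "\<And>x. x \<in> {d..u} \<Longrightarrow> (1 / 2 * \<sigma>\<^sup>2 * V'' x + \<mu> * V' x) + h x = \<gamma>"
    and "V' d = - k" and "V' u = l"
  shows "\<forall>x. AC M \<mu> \<sigma> W h k l x (control_band \<mu> \<sigma> W d u) = ereal \<gamma>"
proof
  fix x :: real
  interpret controlled_brownian_motion M F W \<mu> \<sigma> d u
    using assms by (simp add: controlled_brownian_motion_def controlled_brownian_motion_axioms_def)
  define p where "p = closest_point {d..u} x"
  \<comment> \<open>The cost of the initial jump to the band. After it, the policy runs as if started at \<open>p\<close>.\<close>
  define c0 where "c0 = k * max 0 (p - x) + l * max 0 (x - p)"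
  have p: "p \<in> {d..u}"
    unfolding p_def using assms(9) by (intro closest_point_in_set) auto
  have h: "continuous_on {d..u} h" "\<And>z. z \<in> {d..u} \<Longrightarrow> 0 \<le> h z"
    using assms(8) unfolding holding_cost_def by (auto intro: continuous_on_subset)
  have "continuous_on {d..u} V"
    using assms(10) unfolding C2_on_def by (auto intro!: DERIV_continuous_on)
  then obtain A where A: "\<And>z. z \<in> {d..u} \<Longrightarrow> \<bar>V z\<bar> \<le> A"
    using continuous_on_Icc_bounded by blast
  define E where "E t = (\<integral>\<^sup>+ \<omega>. (\<integral>\<^sup>+ s\<in>{0..t}. ennreal (h (inventory \<mu> \<sigma> W x (control_band \<mu> \<sigma> W d u x) s \<omega>)) \<partial>lborel)
               + ennreal (k * fst (control_band \<mu> \<sigma> W d u x) t \<omega> + l * snd (control_band \<mu> \<sigma> W d u x) t \<omega>) \<partial>M)" for t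
  have E_eq: "E t = (\<integral>\<^sup>+ \<omega>. (\<integral>\<^sup>+ s\<in>{0..t}. ennreal (h (uncontrolled \<mu> \<sigma> W p s \<omega>
          + Psi1 d u (\<lambda>s. uncontrolled \<mu> \<sigma> W p s \<omega>) s - Psi2 d u (\<lambda>s. uncontrolled \<mu> \<sigma> W p s \<omega>) s)) \<partial>lborel)
        + ennreal (c0 + k * Psi1 d u (\<lambda>s. uncontrolled \<mu> \<sigma> W p s \<omega>) t + l * Psi2 d u (\<lambda>s. uncontrolled \<mu> \<sigma> W p s \<omega>) t) \<partial>M)" for t
  proof -
    have fs: "fst (control_band \<mu> \<sigma> W d u x) s \<omega> = max 0 (p - x) + Psi1 d u (\<lambda>s. uncontrolled \<mu> \<sigma> W p s \<omega>) s"
      "snd (control_band \<mu> \<sigma> W d u x) s \<omega> = max 0 (x - p) + Psi2 d u (\<lambda>s. uncontrolled \<mu> \<sigma> W p s \<omega>) s" for s \<omega>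
      by (simp_all add: control_band_def p_def Let_def)
    have inv: "inventory \<mu> \<sigma> W x (control_band \<mu> \<sigma> W d u x) s \<omega> = uncontrolled \<mu> \<sigma> W p s \<omega>
          + Psi1 d u (\<lambda>s. uncontrolled \<mu> \<sigma> W p s \<omega>) s - Psi2 d u (\<lambda>s. uncontrolled \<mu> \<sigma> W p s \<omega>) s" for s \<omega>
      unfolding inventory_def fs by (simp add: uncontrolled_def max_def)
    have tot: "k * fst (control_band \<mu> \<sigma> W d u x) s \<omega> + l * snd (control_band \<mu> \<sigma> W d u x) s \<omega>
       = c0 + k * Psi1 d u (\<lambda>s. uncontrolled \<mu> \<sigma> W p s \<omega>) s + l * Psi2 d u (\<lambda>s. uncontrolled \<mu> \<sigma> W p s \<omega>) s" for s \<omega>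
      unfolding fs c0_def by (simp add: algebra_simps)
    show ?thesis unfolding E_def inv tot ..
  qed
  have "\<exists>L. 0 \<le> L \<and> \<bar>L - \<gamma> * t\<bar> \<le> 2 * A + c0 \<and> E t = ennreal L" if t: "0 \<le> t" for t
  proof -
    have c0: "0 \<le> c0" unfolding c0_def using assms(6,7) by simp
    obtain L where "0 \<le> L" "\<bar>L - \<gamma> * t\<bar> \<le> 2 * A + c0" "E t = ennreal L"
      unfolding E_eq
      by (rule expected_cost_near_linear[OF assms(10,12,13,11) h less_imp_le[OF assms(6)] less_imp_le[OF assms(7)] c0 A p t])
    then show ?thesis by blast
  qed
  then obtain L where L: "\<And>t. 0 \<le> t \<Longrightarrow> 0 \<le> L t" "\<And>t. 0 \<le> t \<Longrightarrow> \<bar>L t - \<gamma> * t\<bar> \<le> 2 * A + c0"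
    "\<And>t. 0 \<le> t \<Longrightarrow> E t = ennreal (L t)"
    by metis
  have "((\<lambda>t. L t / t - \<gamma>) \<longlongrightarrow> 0) at_top"
  proof (rule Lim_null_comparison)
    show "((\<lambda>t. (2 * A + c0) / t) \<longlongrightarrow> 0) at_top"
      by (rule tendsto_divide_0[OF tendsto_const]) (simp add: filterlim_at_top_imp_at_infinity filterlim_ident)
    show "\<forall>\<^sub>F t in at_top. norm (L t / t - \<gamma>) \<le> (2 * A + c0) / t"
      using eventually_gt_at_top[of 0]
    proof eventually_elim
      case (elim t)
      have "L t / t - \<gamma> = (L t - \<gamma> * t) / t" using elim by (simp add: field_simps)
      then show ?case using L(2)[of t] elim by (simp add: divide_right_mono)
    qed
  qed
  then have "((\<lambda>t. ereal (L t / t)) \<longlongrightarrow> ereal \<gamma>) at_top"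
    by (intro tendsto_intros) (rule LIM_zero_cancel)
  moreover have "\<forall>\<^sub>F t in at_top. ereal (L t / t) = ereal (1 / t) * enn2ereal (E t)"
    using eventually_gt_at_top[of 0]
    by eventually_elim (simp add: L)
  ultimately have "((\<lambda>t. ereal (1 / t) * enn2ereal (E t)) \<longlongrightarrow> ereal \<gamma>) at_top"
    by (rule Lim_transform_eventually)
  then show "AC M \<mu> \<sigma> W h k l x (control_band \<mu> \<sigma> W d u) = ereal \<gamma>"
    unfolding AC_def E_def by (intro lim_imp_Limsup) simp
qed

end
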